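(* Let $m\ge1$ and let $C$ be an $m$-truncated free crossed resolution of a group $G$, with $\varphi:C_1\to G$. Let $p:\widetilde C\to C$ be the universal cover of $C$, let $h$ be a partial contracting homotopy of $\widetilde C$, and suppose that $\widetilde C_m$ is free on $\widetilde X_m$. Let $\widetilde X_m\to X_{m+1}$, $\tilde x\mapsto x$, be a bijection to a set $X_{m+1}$ disjoint from $\widetilde X_m$. Define an extension $e(C)$ of $C$ in dimension $m+1$ as follows. - If $m=1$: $C_2=e(C)_2$ is the free crossed $C_1$-module on $X_2$ with $\delta_2x=p_1\big((h_0\widetilde\delta^0\tilde x)^{-1}\,\tilde x\,(h_0\widetilde\delta^1\tilde x)\big)$, $\tilde x\in\widetilde X_1$. - If $m=2$: $C_3=e(C)_3$ is the free $G$-module on $X_3$ with $\delta_3:C_3\to C_2$ defined by $\delta_3x=p_2\big((h_1\widetilde\delta_2\tilde x)^{-1}\,\tilde x^{h_0\beta\tilde x}\big)$, $\tilde x\in\widetilde X_2$. - If $m\ge3$: $C_{m+1}=e(C)_{m+1}$ is the free $G$-module on $X_{m+1}$ with $\delta_{m+1}:C_{m+1}\to C_m$ defined by $\delta_{m+1}x=p_m\big(-h_{m-1}\widetilde\delta_m\tilde x+\tilde x^{h_0\beta\tilde x}\big)$, $\tilde x\in\widetilde X_m$. Let $e(p):e(\widetilde C)\to e(C)$ be the induced covering morphism, extending $p$ by $p_{m+1}:\widetilde C_{m+1}\to C_{m+1}$. Define $h_m:\widetilde C_m\to\widetilde C_{m+1}$ on the basis $\widetilde X_m$ by $h_m(\tilde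 x)=(1,x)$. Then this extension $e(h)$ of $h$ is a contracting homotopy of $e(\widetilde C)$. Hence $e(C)$ is an $(m+1)$-truncated free crossed resolution of $G$. If further $Y\subseteq X_{m+1}$ is such that $\delta_{m+1}(Y)$ also generates $\ker\delta_m$ (for $m=1$: generates $\ker\varphi$ as a normal subgroup of $C_1$; for $m\ge2$: generates $\ker\delta_m$ as a $G$-module), and a retraction $\xi:C_{m+1}\to C_{m+1}(Y)$ is given such that $\delta_{m+1}\xi(x)=\delta_{m+1}(x)$ for all $x\in X_{m+1}$, where $\xi$ is a $G$-module morphism if $m\ge2$ and a morphism of crossed $C_1$-modules if $m=1$, then on replacing $C_{m+1}$ by $C_{m+1}(Y)$ and $h_m$ by $\tilde\xi h_m$, where $\tilde\xi(g,c)=(g,\xi c)$, one again obtains an extension of the pair $(C,h)$ by one step (an $(m+1)$-truncated free crossed resolution of $G$ together with a contracting homotopy of its universal cover).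
   Context: In a groupoid the composite of $a:x\to y$, $b:y\to z$ is $ab:x\to z$. A crossed module over a groupoid $\Phi$ is a family of groups $M=(M(x))_{x\in Ob\,\Phi}$ with a groupoid morphism $\mu:M\to\Phi$, identity on objects, and a right action of $\Phi$ on $M$ ($m^u\in M(y)$ for $m\in M(x)$, $u\in\Phi(x,y)$) with $\mu(m^u)=u^{-1}\mu(m)u$ and $n^{-1}mn=m^{\mu n}$. The free crossed $\Phi$-module on a family of functions $w:S(x)\to\Phi(x,x)$ is the universal crossed $\Phi$-module $\mu:M\to\Phi$ with maps $S(x)\to M(x)$ lifting $w$. A crossed complex $C$ consists of a set $C_0$, a groupoid $C_1$ on $C_0$ (source $\delta^0$, target $\delta^1$), families of groups $C_n=(C_n(x))_{x\in C_0}$ for $n\ge2$ with base point map $\beta$ ($\beta c=x$ for $c\in C_n(x)$), right actions of $C_1$ on $C_n$ for $n\ge2$, and morphisms $\delta_n:C_n\to C_{n-1}$ ($n\ge2$) over the identity on $C_0$, such that: $\delta_2$ is a crossed module over $C_1$; for $n\ge3$, $C_n$ is a $C_1$-module (abelian, written additively) and $\delta_n$ preserves the action; $\delta_{n-1}\delta_n$ is trivial for $n\ge3$; $\delta_2C_2$ acts trivially on $C_n$ for $n\ge3$. Dimensions 1 and 2 are written multiplicatively. An $m$-truncated crossed complex has this structure only in dimensions $\le m$. An $m$-truncated free crossed resolution of a group $G$ is an $m$-truncated crossed complex $C$ with $C_0$ a single point, together with an epimorphism $\varphi:C_1\to G$, such that $C_1$ is a free group; if $m\ge2$, $C_2$ is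 a free crossed $C_1$-module and $\delta_2(C_2)=\ker\varphi$ (so $C_n$ is a $G$-module for $n\ge3$, as is $\ker\delta_2$); $C_n$ is a free $G$-module for $3\le n\le m$; and $\ker\delta_n=\operatorname{im}\delta_{n+1}$ for $2\le n<m$. The universal cover $p:\widetilde C\to C$: $\widetilde C_0=G$; $\widetilde C_1$ is the groupoid on $G$ with arrows $(g,u)\in G\times C_1$, source $g$, target $g(\varphi u)$, composition $(g,u)(g(\varphi u),v)=(g,uv)$; for $n\ge2$, $\widetilde C_n(g)=\{g\}\times C_n$ (group structure from $C_n$), $(g,c)^{(g,u)}=(g(\varphi u),c^u)$, $\widetilde\delta_n(g,c)=(g,\delta_nc)$; and $p_n(g,c)=c$. Similarly $e(\widetilde C)$ is the universal cover of $e(C)$. Let $\widetilde G$ be the groupoid on $G$ with arrows $(g,g'):g\to gg'$. That $\widetilde C_m$ is free on $\widetilde X_m$ means: $m=1$: $\widetilde C_1$ is the free groupoid on the subgraph $\widetilde X_1$ (with all objects $G$); $m=2$: $\widetilde C_2$ is the free crossed $\widetilde C_1$-module on $\widetilde X_2$; $m\ge3$: $\widetilde C_m$ is the free $\widetilde G$-module on $\widetilde X_m$. A contracting homotopy $h$ of $\widetilde C$ (to the base point $1\in G$) is a family of functions $h_n$ on $\widetilde C_n$ such that: $h_0(g)$ is an arrow $g\to1$ of $\widetilde C_1$ for each $g\in G$; $h_n(\widetilde C_n)\subseteq\widetilde C_{n+1}(1)$ for $n\ge1$; $h_1:\widetilde C_1\to\widetilde C_2(1)$ is a groupoid morphism;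 for $n\ge2$, $h_n:\widetilde C_n\to\widetilde C_{n+1}(1)$ is a morphism (a group homomorphism on each $\widetilde C_n(g)$) with $h_n(c^{a})=h_n(c)$ whenever $a\in\widetilde C_1$ and $c^a$ is defined; and $\widetilde\delta_2h_1c=(h_0\widetilde\delta^0c)^{-1}c\,(h_0\widetilde\delta^1c)$ for $c\in\widetilde C_1$; $\widetilde\delta_3h_2c=(h_1\widetilde\delta_2c)^{-1}c^{h_0\beta c}$ for $c\in\widetilde C_2$; $\widetilde\delta_{n+1}h_nc=-h_{n-1}\widetilde\delta_nc+c^{h_0\beta c}$ for $c\in\widetilde C_n$, $n\ge3$. For an $m$-truncated crossed complex, a (partial) contracting homotopy has $h_n$ defined only for $n<m$ and the conditions are required where they make sense. The map $h_m$ of the theorem is extended from the basis $\widetilde X_m$ as a groupoid morphism to $\widetilde C_2(1)$ if $m=1$, and as a morphism to $\widetilde C_{m+1}(1)$ trivialising the action of $\widetilde C_1$ if $m\ge2$. $C_{m+1}(Y)$ denotes the free crossed $C_1$-module ($m=1$) or free $G$-module ($m\ge2$) on $Y$, with boundary the restriction of $\delta_{m+1}$; a retraction $\xi$ satisfies $\xi(y)=y$ for $y\in Y$. *)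

theory Defs
  imports "HOL-Algebra.Coset" "HOL-Library.Disjoint_Sets"
begin

section \<open>Groupoids\<close>

record ('o, 'a) groupoid =
  Obj :: "'o set"
  Arr :: "'a set"
  Src :: "'a \<Rightarrow> 'o"
  Tgt :: "'a \<Rightarrow> 'o"
  Cmp :: "'a \<Rightarrow> 'a \<Rightarrow> 'a"
  Idt :: "'o \<Rightarrow> 'a"
  Inv :: "'a \<Rightarrow> 'a"

definition arrows :: "('o, 'a) groupoid \<Rightarrow> 'o \<Rightarrow> 'o \<Rightarrow> 'a set" where
  "arrows \<Phi> x y = {a \<in> Arr \<Phi>. Src \<Phi> a = x \<and> Tgt \<Phi> a = y}"

text \<open>Composition is in diagrammatic order: \<open>Cmp \<Phi> a b\<close> is ``first \<open>a\<close>, then \<open>b\<close>''.\<close>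

locale groupoid =
  fixes \<Phi> :: "('o, 'a) groupoid"
  assumes Src_closed: "a \<in> Arr \<Phi> \<Longrightarrow> Src \<Phi> a \<in> Obj \<Phi>"
    and Tgt_closed: "a \<in> Arr \<Phi> \<Longrightarrow> Tgt \<Phi> a \<in> Obj \<Phi>"
    and Cmp_closed: "\<lbrakk>a \<in> arrows \<Phi> x y; b \<in> arrows \<Phi> y z\<rbrakk> \<Longrightarrow> Cmp \<Phi> a b \<in> arrows \<Phi> x z"
    and Cmp_assoc: "\<lbrakk>a \<in> arrows \<Phi> x y; b \<in> arrows \<Phi> y z; c \<in> arrows \<Phi> z t\<rbrakk>
      \<Longrightarrow> Cmp \<Phi> (Cmp \<Phi> a b) c = Cmp \<Phi> a (Cmp \<Phi> b c)"
    and Idt_closed: "x \<in> Obj \<Phi> \<Longrightarrow> Idt \<Phi> x \<in> arrows \<Phi> x x"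
    and Idt_left: "a \<in> arrows \<Phi> x y \<Longrightarrow> Cmp \<Phi> (Idt \<Phi> x) a = a"
    and Idt_right: "a \<in> arrows \<Phi> x y \<Longrightarrow> Cmp \<Phi> a (Idt \<Phi> y) = a"
    and Inv_closed: "a \<in> arrows \<Phi> x y \<Longrightarrow> Inv \<Phi> a \<in> arrows \<Phi> y x"
    and Inv_right: "a \<in> arrows \<Phi> x y \<Longrightarrow> Cmp \<Phi> a (Inv \<Phi> a) = Idt \<Phi> x"
    and Inv_left: "a \<in> arrows \<Phi> x y \<Longrightarrow> Cmp \<Phi> (Inv \<Phi> a) a = Idt \<Phi> y"

definition vertex_group :: "('o, 'a) groupoid \<Rightarrow> 'o \<Rightarrow> 'a monoid" where
  "vertex_group \<Phi> x = \<lparr>carrier = arrows \<Phi> x x, mult = Cmp \<Phi>, one = Idt \<Phi> x\<rparr>"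

definition groupoid_morphism ::
  "('o, 'a) groupoid \<Rightarrow> ('p, 'b) groupoid \<Rightarrow> ('o \<Rightarrow> 'p) \<Rightarrow> ('a \<Rightarrow> 'b) \<Rightarrow> bool" where
  "groupoid_morphism \<Phi> \<Psi> f0 f \<longleftrightarrow>
     (\<forall>x \<in> Obj \<Phi>. f0 x \<in> Obj \<Psi>) \<and>
     (\<forall>x y. \<forall>a \<in> arrows \<Phi> x y. f a \<in> arrows \<Psi> (f0 x) (f0 y)) \<and>
     (\<forall>x y z. \<forall>a \<in> arrows \<Phi> x y. \<forall>b \<in> arrows \<Phi> y z. f (Cmp \<Phi> a b) = Cmp \<Psi> (f a) (f b))"

definition group_groupoid :: "'o \<Rightarrow> 'g monoid \<Rightarrow> ('o, 'g) groupoid" where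
  "group_groupoid x G =
     \<lparr>Obj = {x}, Arr = carrier G, Src = (\<lambda>_. x), Tgt = (\<lambda>_. x), Cmp = mult G,
      Idt = (\<lambda>_. \<one>\<^bsub>G\<^esub>), Inv = m_inv G\<rparr>"

text \<open>The groupoid written \<open>\<widetilde>G\<close> on paper: objects the elements of \<open>G\<close>, arrows
  \<open>(g, g') : g \<rightarrow> gg'\<close>.\<close>

definition translation_groupoid :: "'g monoid \<Rightarrow> ('g, 'g \<times> 'g) groupoid" where
  "translation_groupoid G =
     \<lparr>Obj = carrier G, Arr = carrier G \<times> carrier G,
      Src = fst, Tgt = (\<lambda>(g, a). g \<otimes>\<^bsub>G\<^esub> a),
      Cmp = (\<lambda>(g, a) (_, b). (g, a \<otimes>\<^bsub>G\<^esub> b)),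
      Idt = (\<lambda>g. (g, \<one>\<^bsub>G\<^esub>)), Inv = (\<lambda>(g, a). (g \<otimes>\<^bsub>G\<^esub> a, inv\<^bsub>G\<^esub> a))\<rparr>"


section \<open>Actions, crossed modules and modules over a groupoid\<close>

text \<open>Groups are HOL-Algebra groups, so that abelian groups too are written multiplicatively.
  The groups of a family are pairwise disjoint, hence a single function on elements describes a
  family of functions, and an element determines its base point.\<close>

locale groupoid_action = groupoid \<Phi> for \<Phi> :: "('o, 'a) groupoid" +
  fixes M :: "'o \<Rightarrow> 'm monoid" and act :: "'m \<Rightarrow> 'a \<Rightarrow> 'm"
  assumes fam_group: "x \<in> Obj \<Phi> \<Longrightarrow> group (M x)"
    and fam_disjoint: "disjoint_family_on (\<lambda>x. carrier (M x)) (Obj \<Phi>)"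
    and act_closed: "\<lbrakk>c \<in> carrier (M x); u \<in> arrows \<Phi> x y\<rbrakk> \<Longrightarrow> act c u \<in> carrier (M y)"
    and act_mult: "\<lbrakk>c \<in> carrier (M x); d \<in> carrier (M x); u \<in> arrows \<Phi> x y\<rbrakk>
      \<Longrightarrow> act (c \<otimes>\<^bsub>M x\<^esub> d) u = act c u \<otimes>\<^bsub>M y\<^esub> act d u"
    and act_Cmp: "\<lbrakk>c \<in> carrier (M x); u \<in> arrows \<Phi> x y; v \<in> arrows \<Phi> y z\<rbrakk>
      \<Longrightarrow> act c (Cmp \<Phi> u v) = act (act c u) v"
    and act_Idt: "\<lbrakk>x \<in> Obj \<Phi>; c \<in> carrier (M x)\<rbrakk> \<Longrightarrow> act c (Idt \<Phi> x) = c"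

locale crossed_module = groupoid_action \<Phi> M act
  for \<Phi> :: "('o, 'a) groupoid" and M :: "'o \<Rightarrow> 'm monoid" and act :: "'m \<Rightarrow> 'a \<Rightarrow> 'm" +
  fixes \<mu> :: "'m \<Rightarrow> 'a"
  assumes \<mu>_hom: "x \<in> Obj \<Phi> \<Longrightarrow> \<mu> \<in> hom (M x) (vertex_group \<Phi> x)"
    and \<mu>_act: "\<lbrakk>c \<in> carrier (M x); u \<in> arrows \<Phi> x y\<rbrakk>
      \<Longrightarrow> \<mu> (act c u) = Cmp \<Phi> (Cmp \<Phi> (Inv \<Phi> u) (\<mu> c)) u"
    and peiffer: "\<lbrakk>x \<in> Obj \<Phi>; c \<in> carrier (M x); d \<in> carrier (M x)\<rbrakk>
      \<Longrightarrow> inv\<^bsub>M x\<^esub> d \<otimes>\<^bsub>M x\<^esub> c \<otimes>\<^bsub>M x\<^esub> d = act c (\<mu> d)"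

locale groupoid_module = groupoid_action \<Phi> M act
  for \<Phi> :: "('o, 'a) groupoid" and M :: "'o \<Rightarrow> 'm monoid" and act :: "'m \<Rightarrow> 'a \<Rightarrow> 'm" +
  assumes fam_comm: "x \<in> Obj \<Phi> \<Longrightarrow> comm_group (M x)"

definition action_morphism ::
  "('o, 'a) groupoid \<Rightarrow> ('o \<Rightarrow> 'm monoid) \<Rightarrow> ('m \<Rightarrow> 'a \<Rightarrow> 'm) \<Rightarrow>
   ('o \<Rightarrow> 'n monoid) \<Rightarrow> ('n \<Rightarrow> 'a \<Rightarrow> 'n) \<Rightarrow> ('m \<Rightarrow> 'n) \<Rightarrow> bool" where
  "action_morphism \<Phi> M act N act' f \<longleftrightarrow>
     (\<forall>x \<in> Obj \<Phi>. f \<in> hom (M x) (N x)) \<and>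
     (\<forall>x y. \<forall>c \<in> carrier (M x). \<forall>u \<in> arrows \<Phi> x y. f (act c u) = act' (f c) u)"

definition crossed_module_morphism ::
  "('o, 'a) groupoid \<Rightarrow> ('o \<Rightarrow> 'm monoid) \<Rightarrow> ('m \<Rightarrow> 'a \<Rightarrow> 'm) \<Rightarrow> ('m \<Rightarrow> 'a) \<Rightarrow>
   ('o \<Rightarrow> 'n monoid) \<Rightarrow> ('n \<Rightarrow> 'a \<Rightarrow> 'n) \<Rightarrow> ('n \<Rightarrow> 'a) \<Rightarrow> ('m \<Rightarrow> 'n) \<Rightarrow> bool" where
  "crossed_module_morphism \<Phi> M act \<mu> N act' \<nu> f \<longleftrightarrow>
     action_morphism \<Phi> M act N act' f \<and> (\<forall>x \<in> Obj \<Phi>. \<forall>c \<in> carrier (M x). \<nu> (f c) = \<mu> c)"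


section \<open>Free objects\<close>

text \<open>Freeness is expressed by universal properties. HOL cannot quantify over all types inside a
  definition, so the target objects range over one type, which is chosen so large that the property
  for targets in this type implies the property for targets in every type. The right summand has
  room for the subobject generated by the images of the generators in an arbitrary target (each
  element of it is the value of a word in the generators, translated by arrows, and their
  inverses), which yields existence. The left summand has room for the subobject of elements on
  which two given morphisms into an arbitrary target agree; that subobject contains the generators
  and is therefore everything, which yields uniqueness.\<close>

type_synonym 'a group_target = "'a + ('a \<times> bool) list"
type_synonym ('o, 'a) groupoid_target = "'a + 'o \<times> ('a \<times> bool) list"
type_synonym ('o, 'a, 's, 'm) action_target = "'m + 'o \<times> ('s \<times> 'a \<times> bool) list"

definition ex_unique_on :: "'a set \<Rightarrow> (('a \<Rightarrow> 'b) \<Rightarrow> bool) \<Rightarrow> bool" where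
  "ex_unique_on A P \<longleftrightarrow> (\<exists>f. P f \<and> (\<forall>f'. P f' \<longrightarrow> (\<forall>a \<in> A. f' a = f a)))"

definition free_group_on :: "'a monoid \<Rightarrow> 'a set \<Rightarrow> bool" where
  "free_group_on H B \<longleftrightarrow> group H \<and> B \<subseteq> carrier H \<and>
     (\<forall>(K :: 'a group_target monoid) k. group K \<and> k \<in> B \<rightarrow> carrier K \<longrightarrow>
        ex_unique_on (carrier H) (\<lambda>f. f \<in> hom H K \<and> (\<forall>b \<in> B. f b = k b)))"

definition free_groupoid_on :: "('o, 'a) groupoid \<Rightarrow> 'a set \<Rightarrow> bool" where
  "free_groupoid_on \<Phi> X \<longleftrightarrow> groupoid \<Phi> \<and> X \<subseteq> Arr \<Phi> \<and>
     (\<forall>(\<Psi> :: ('o, ('o, 'a) groupoid_target) groupoid) f0 k.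
        groupoid \<Psi> \<and> (\<forall>x \<in> Obj \<Phi>. f0 x \<in> Obj \<Psi>) \<and>
        (\<forall>a \<in> X. k a \<in> arrows \<Psi> (f0 (Src \<Phi> a)) (f0 (Tgt \<Phi> a))) \<longrightarrow>
        ex_unique_on (Arr \<Phi>) (\<lambda>f. groupoid_morphism \<Phi> \<Psi> f0 f \<and> (\<forall>a \<in> X. f a = k a)))"

text \<open>The crossed \<open>\<Phi>\<close>-module \<open>\<mu> : M \<rightarrow> \<Phi>\<close>, with the maps \<open>i x : S x \<rightarrow> M x\<close>, is free on the
  functions \<open>w x : S x \<rightarrow> \<Phi>(x, x)\<close>.\<close>

definition free_crossed_module ::
  "('o, 'a) groupoid \<Rightarrow> ('o \<Rightarrow> 'm monoid) \<Rightarrow> ('m \<Rightarrow> 'a \<Rightarrow> 'm) \<Rightarrow> ('m \<Rightarrow> 'a) \<Rightarrow>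
   ('o \<Rightarrow> 's set) \<Rightarrow> ('o \<Rightarrow> 's \<Rightarrow> 'a) \<Rightarrow> ('o \<Rightarrow> 's \<Rightarrow> 'm) \<Rightarrow> bool" where
  "free_crossed_module \<Phi> M act \<mu> S w i \<longleftrightarrow>
     crossed_module \<Phi> M act \<mu> \<and>
     (\<forall>x \<in> Obj \<Phi>. \<forall>s \<in> S x. i x s \<in> carrier (M x) \<and> \<mu> (i x s) = w x s) \<and>
     (\<forall>(N :: 'o \<Rightarrow> ('o, 'a, 's, 'm) action_target monoid) act' \<nu> k.
        crossed_module \<Phi> N act' \<nu> \<and>
        (\<forall>x \<in> Obj \<Phi>. \<forall>s \<in> S x. k x s \<in> carrier (N x) \<and> \<nu> (k x s) = w x s) \<longrightarrow>
        ex_unique_on (\<Union>x \<in> Obj \<Phi>. carrier (M x))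
          (\<lambda>f. crossed_module_morphism \<Phi> M act \<mu> N act' \<nu> f \<and>
               (\<forall>x \<in> Obj \<Phi>. \<forall>s \<in> S x. f (i x s) = k x s)))"

definition free_module ::
  "('o, 'a) groupoid \<Rightarrow> ('o \<Rightarrow> 'm monoid) \<Rightarrow> ('m \<Rightarrow> 'a \<Rightarrow> 'm) \<Rightarrow>
   ('o \<Rightarrow> 's set) \<Rightarrow> ('o \<Rightarrow> 's \<Rightarrow> 'm) \<Rightarrow> bool" where
  "free_module \<Phi> M act S i \<longleftrightarrow>
     groupoid_module \<Phi> M act \<and>
     (\<forall>x \<in> Obj \<Phi>. \<forall>s \<in> S x. i x s \<in> carrier (M x)) \<and>
     (\<forall>(N :: 'o \<Rightarrow> ('o, 'a, 's, 'm) action_target monoid) act' k.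
        groupoid_module \<Phi> N act' \<and> (\<forall>x \<in> Obj \<Phi>. \<forall>s \<in> S x. k x s \<in> carrier (N x)) \<longrightarrow>
        ex_unique_on (\<Union>x \<in> Obj \<Phi>. carrier (M x))
          (\<lambda>f. action_morphism \<Phi> M act N act' f \<and>
               (\<forall>x \<in> Obj \<Phi>. \<forall>s \<in> S x. f (i x s) = k x s)))"

text \<open>Let \<open>\<psi> : \<Phi> \<rightarrow> \<Gamma>\<close> be the identity on objects and surjective on arrows. The action of \<open>\<Phi>\<close> on
  \<open>M\<close> factors through \<open>\<psi>\<close>, and for the resulting action of \<open>\<Gamma>\<close> (unique, as \<open>\<psi>\<close> is surjective) \<open>M\<close>
  is a free \<open>\<Gamma>\<close>-module.\<close>

definition free_module_along ::
  "('o, 'a) groupoid \<Rightarrow> ('o, 'b) groupoid \<Rightarrow> ('a \<Rightarrow> 'b) \<Rightarrow> ('o \<Rightarrow> 'm monoid) \<Rightarrow>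
   ('m \<Rightarrow> 'a \<Rightarrow> 'm) \<Rightarrow> ('o \<Rightarrow> 's set) \<Rightarrow> ('o \<Rightarrow> 's \<Rightarrow> 'm) \<Rightarrow> bool" where
  "free_module_along \<Phi> \<Gamma> \<psi> M act S i \<longleftrightarrow>
     (\<exists>act'. (\<forall>x y. \<forall>c \<in> carrier (M x). \<forall>u \<in> arrows \<Phi> x y. act' c (\<psi> u) = act c u) \<and>
             free_module \<Gamma> M act' S i)"

text \<open>Freeness on a subset of the elements, the generators being included by the identity.\<close>

definition free_crossed_module_on ::
  "('o, 'a) groupoid \<Rightarrow> ('o \<Rightarrow> 'm monoid) \<Rightarrow> ('m \<Rightarrow> 'a \<Rightarrow> 'm) \<Rightarrow> ('m \<Rightarrow> 'a) \<Rightarrow> 'm set \<Rightarrow> bool"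
  where
  "free_crossed_module_on \<Phi> M act \<mu> X \<longleftrightarrow>
     X \<subseteq> (\<Union>x \<in> Obj \<Phi>. carrier (M x)) \<and>
     free_crossed_module \<Phi> M act \<mu> (\<lambda>x. X \<inter> carrier (M x)) (\<lambda>_ s. \<mu> s) (\<lambda>_ s. s)"

definition free_module_along_on ::
  "('o, 'a) groupoid \<Rightarrow> ('o, 'b) groupoid \<Rightarrow> ('a \<Rightarrow> 'b) \<Rightarrow> ('o \<Rightarrow> 'm monoid) \<Rightarrow>
   ('m \<Rightarrow> 'a \<Rightarrow> 'm) \<Rightarrow> 'm set \<Rightarrow> bool" where
  "free_module_along_on \<Phi> \<Gamma> \<psi> M act X \<longleftrightarrow>
     X \<subseteq> (\<Union>x \<in> Obj \<Phi>. carrier (M x)) \<and>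
     free_module_along \<Phi> \<Gamma> \<psi> M act (\<lambda>x. X \<inter> carrier (M x)) (\<lambda>_ s. s)"


section \<open>Truncated crossed complexes\<close>

text \<open>\<open>gpd C\<close> is \<open>C\<^sub>1\<close> (with \<open>C\<^sub>0\<close> its set of objects), and for \<open>n \<ge> 2\<close> the group \<open>C\<^sub>n(x)\<close> is
  \<open>fam C n x\<close>, with action \<open>action C n\<close> of \<open>C\<^sub>1\<close> and boundary \<open>bdry C n : C\<^sub>n \<rightarrow> C\<^sub>n\<^sub>-\<^sub>1\<close>. Elements of
  all dimensions \<open>\<ge> 1\<close> are taken from one type. In an \<open>m\<close>-truncated crossed complex the
  components in dimensions above \<open>m\<close> are irrelevant.\<close>

record ('o, 'c) crossed_complex =
  gpd :: "('o, 'c) groupoid"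
  fam :: "nat \<Rightarrow> 'o \<Rightarrow> 'c monoid"
  action :: "nat \<Rightarrow> 'c \<Rightarrow> 'c \<Rightarrow> 'c"
  bdry :: "nat \<Rightarrow> 'c \<Rightarrow> 'c"

definition elems :: "('o, 'c) crossed_complex \<Rightarrow> nat \<Rightarrow> 'c set" where
  "elems C n = (if n = 1 then Arr (gpd C) else (\<Union>x \<in> Obj (gpd C). carrier (fam C n x)))"

definition unit_at :: "('o, 'c) crossed_complex \<Rightarrow> nat \<Rightarrow> 'o \<Rightarrow> 'c" where
  "unit_at C n x = (if n = 1 then Idt (gpd C) x else \<one>\<^bsub>fam C n x\<^esub>)"

definition base_point :: "('o, 'c) crossed_complex \<Rightarrow> nat \<Rightarrow> 'c \<Rightarrow> 'o" where
  "base_point C n c = (THE x. x \<in> Obj (gpd C) \<and> c \<in> carrier (fam C n x))"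

definition bdry_kernel :: "('o, 'c) crossed_complex \<Rightarrow> nat \<Rightarrow> 'o \<Rightarrow> 'c set" where
  "bdry_kernel C n x = {c \<in> carrier (fam C n x). bdry C n c = unit_at C (n - 1) x}"

locale truncated_crossed_complex =
  fixes m :: nat and C :: "('o, 'c) crossed_complex"
  assumes dim1: "groupoid (gpd C)"
    and dim2: "2 \<le> m \<Longrightarrow> crossed_module (gpd C) (fam C 2) (action C 2) (bdry C 2)"
    and dim_ge3: "\<lbrakk>3 \<le> n; n \<le> m\<rbrakk> \<Longrightarrow> groupoid_module (gpd C) (fam C n) (action C n)"
    and bdry_morphism: "\<lbrakk>3 \<le> n; n \<le> m\<rbrakk> \<Longrightarrow>
      action_morphism (gpd C) (fam C n) (action C n) (fam C (n - 1)) (action C (n - 1)) (bdry C n)"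
    and bdry_bdry: "\<lbrakk>3 \<le> n; n \<le> m; x \<in> Obj (gpd C); c \<in> carrier (fam C n x)\<rbrakk> \<Longrightarrow>
      bdry C (n - 1) (bdry C n c) = unit_at C (n - 2) x"
    and bdry2_trivial_action:
      "\<lbrakk>3 \<le> n; n \<le> m; x \<in> Obj (gpd C); c \<in> carrier (fam C n x); b \<in> carrier (fam C 2 x)\<rbrakk> \<Longrightarrow>
      action C n c (bdry C 2 b) = c"


section \<open>Free crossed resolutions and universal covers\<close>

definition the_point :: "('o, 'c) crossed_complex \<Rightarrow> 'o" where
  "the_point C = the_elem (Obj (gpd C))"

definition free_crossed_resolution ::
  "nat \<Rightarrow> 'g monoid \<Rightarrow> ('c \<Rightarrow> 'g) \<Rightarrow> ('o, 'c) crossed_complex \<Rightarrow> bool" where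
  "free_crossed_resolution m G \<phi> C \<longleftrightarrow>
     group G \<and> truncated_crossed_complex m C \<and> is_singleton (Obj (gpd C)) \<and>
     \<phi> \<in> hom (vertex_group (gpd C) (the_point C)) G \<and>
     \<phi> ` Arr (gpd C) = carrier G \<and>
     (\<exists>B. free_group_on (vertex_group (gpd C) (the_point C)) B) \<and>
     (2 \<le> m \<longrightarrow>
        (\<exists>(S :: 'o \<Rightarrow> 'c set) w i.
           free_crossed_module (gpd C) (fam C 2) (action C 2) (bdry C 2) S w i) \<and>
        bdry C 2 ` carrier (fam C 2 (the_point C))
          = kernel (vertex_group (gpd C) (the_point C)) G \<phi>) \<and>
     (\<forall>n. 3 \<le> n \<and> n \<le> m \<longrightarrow>
        (\<exists>(S :: 'o \<Rightarrow> 'c set) i.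
           free_module_along (gpd C) (group_groupoid (the_point C) G) \<phi>
             (fam C n) (action C n) S i)) \<and>
     (\<forall>n. 2 \<le> n \<and> n < m \<longrightarrow>
        bdry_kernel C n (the_point C) = bdry C (Suc n) ` carrier (fam C (Suc n) (the_point C)))"

text \<open>The covering morphism \<open>p\<close> from the universal cover to \<open>C\<close> is \<open>snd\<close> in every dimension
  \<open>\<ge> 1\<close>.\<close>

definition universal_cover ::
  "'g monoid \<Rightarrow> ('c \<Rightarrow> 'g) \<Rightarrow> ('o, 'c) crossed_complex \<Rightarrow> ('g, 'g \<times> 'c) crossed_complex" where
  "universal_cover G \<phi> C =
     \<lparr>gpd = \<lparr>Obj = carrier G, Arr = carrier G \<times> Arr (gpd C),
        Src = fst, Tgt = (\<lambda>(g, u). g \<otimes>\<^bsub>G\<^esub> \<phi> u),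
        Cmp = (\<lambda>(g, u) (_, v). (g, Cmp (gpd C) u v)),
        Idt = (\<lambda>g. (g, Idt (gpd C) (the_point C))),
        Inv = (\<lambda>(g, u). (g \<otimes>\<^bsub>G\<^esub> \<phi> u, Inv (gpd C) u))\<rparr>,
      fam = (\<lambda>n g. \<lparr>carrier = {g} \<times> carrier (fam C n (the_point C)),
        mult = (\<lambda>(_, c) (_, d). (g, c \<otimes>\<^bsub>fam C n (the_point C)\<^esub> d)),
        one = (g, \<one>\<^bsub>fam C n (the_point C)\<^esub>)\<rparr>),
      action = (\<lambda>n (g, c) (_, u). (g \<otimes>\<^bsub>G\<^esub> \<phi> u, action C n c u)),
      bdry = (\<lambda>n (g, c). (g, bdry C n c))\<rparr>"

text \<open>The \<open>m\<close>-dimensional part of the universal cover is free on the set \<open>Xt\<close>.\<close>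

definition cover_free_on ::
  "nat \<Rightarrow> 'g monoid \<Rightarrow> ('c \<Rightarrow> 'g) \<Rightarrow> ('o, 'c) crossed_complex \<Rightarrow> ('g \<times> 'c) set \<Rightarrow> bool" where
  "cover_free_on m G \<phi> C Xt \<longleftrightarrow>
     (let D = universal_cover G \<phi> C in
      if m = 1 then free_groupoid_on (gpd D) Xt
      else if m = 2 then free_crossed_module_on (gpd D) (fam D 2) (action D 2) (bdry D 2) Xt
      else free_module_along_on (gpd D) (translation_groupoid G) (\<lambda>(g, u). (g, \<phi> u))
             (fam D m) (action D m) Xt)"


section \<open>Contracting homotopies\<close>

text \<open>The morphism conditions on \<open>h\<^sub>n\<close>, for \<open>n \<ge> 1\<close>, where \<open>z\<close> is the base point.\<close>

definition homotopy_component ::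
  "('o, 'c) crossed_complex \<Rightarrow> 'o \<Rightarrow> nat \<Rightarrow> ('c \<Rightarrow> 'c) \<Rightarrow> bool" where
  "homotopy_component D z n k \<longleftrightarrow>
     (if n = 1 then
        k \<in> Arr (gpd D) \<rightarrow> carrier (fam D 2 z) \<and>
        (\<forall>x y t. \<forall>a \<in> arrows (gpd D) x y. \<forall>b \<in> arrows (gpd D) y t.
           k (Cmp (gpd D) a b) = k a \<otimes>\<^bsub>fam D 2 z\<^esub> k b)
      else
        (\<forall>x \<in> Obj (gpd D). k \<in> hom (fam D n x) (fam D (Suc n) z)) \<and>
        (\<forall>x y. \<forall>c \<in> carrier (fam D n x). \<forall>a \<in> arrows (gpd D) x y. k (action D n c a) = k c))"

text \<open>The right-hand side of the homotopy relation in dimension \<open>n \<ge> 1\<close>. For \<open>n \<ge> 3\<close> the last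
  line is \<open>-h\<^sub>n\<^sub>-\<^sub>1\<delta>\<^sub>nc + c\<close> acted on by \<open>h\<^sub>0\<beta>c\<close>, in additive notation.\<close>

definition homotopy_rhs ::
  "('o, 'c) crossed_complex \<Rightarrow> 'o \<Rightarrow> ('o \<Rightarrow> 'c) \<Rightarrow> (nat \<Rightarrow> 'c \<Rightarrow> 'c) \<Rightarrow> nat \<Rightarrow> 'c \<Rightarrow> 'c" where
  "homotopy_rhs D z h0 h n c =
     (if n = 1 then
        Cmp (gpd D) (Cmp (gpd D) (Inv (gpd D) (h0 (Src (gpd D) c))) c) (h0 (Tgt (gpd D) c))
      else
        inv\<^bsub>fam D n z\<^esub> (h (n - 1) (bdry D n c)) \<otimes>\<^bsub>fam D n z\<^esub> action D n c (h0 (base_point D n c)))"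

text \<open>A contracting homotopy of an \<open>m\<close>-truncated crossed complex consists of \<open>h\<^sub>0 = h0\<close> and
  \<open>h\<^sub>n = h n\<close> for \<open>1 \<le> n < m\<close>.\<close>

definition contracting_homotopy ::
  "nat \<Rightarrow> ('o, 'c) crossed_complex \<Rightarrow> 'o \<Rightarrow> ('o \<Rightarrow> 'c) \<Rightarrow> (nat \<Rightarrow> 'c \<Rightarrow> 'c) \<Rightarrow> bool" where
  "contracting_homotopy m D z h0 h \<longleftrightarrow>
     (\<forall>x \<in> Obj (gpd D). h0 x \<in> arrows (gpd D) x z) \<and>
     (\<forall>n. 1 \<le> n \<and> n < m \<longrightarrow>
        homotopy_component D z n (h n) \<and>
        (\<forall>c \<in> elems D n. bdry D (Suc n) (h n c) = homotopy_rhs D z h0 h n c))"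


section \<open>Extension by one dimension\<close>

text \<open>\<open>E\<close> agrees with \<open>C\<close> up to dimension \<open>m\<close>, and \<open>E\<close> in dimension \<open>m + 1\<close> is free on its subset
  \<open>X\<close>: as a crossed \<open>C\<^sub>1\<close>-module if \<open>m = 1\<close>, as a \<open>G\<close>-module if \<open>m \<ge> 2\<close>, and then the boundary is
  required to be a morphism compatible with the actions. That the boundary composes trivially with
  the previous one is not required.\<close>

definition free_extension ::
  "nat \<Rightarrow> 'g monoid \<Rightarrow> ('c \<Rightarrow> 'g) \<Rightarrow> ('o, 'c) crossed_complex \<Rightarrow>
   ('o, 'c) crossed_complex \<Rightarrow> 'c set \<Rightarrow> bool" where
  "free_extension m G \<phi> C E X \<longleftrightarrow>
     gpd E = gpd C \<and>
     (\<forall>n. 2 \<le> n \<and> n \<le> m \<longrightarrow> fam E n = fam C n \<and> action E n = action C n \<and> bdry E n = bdry C n) \<and>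
     (if m = 1 then free_crossed_module_on (gpd C) (fam E 2) (action E 2) (bdry E 2) X
      else
        free_module_along_on (gpd C) (group_groupoid (the_point C) G) \<phi>
          (fam E (Suc m)) (action E (Suc m)) X \<and>
        action_morphism (gpd C) (fam E (Suc m)) (action E (Suc m)) (fam C m) (action C m)
          (bdry E (Suc m)))"

text \<open>\<open>E\<close> is the extension \<open>e(C)\<close> determined by the homotopy and the bijection \<open>b\<close> from \<open>Xt\<close>
  to \<open>X\<close>.\<close>

definition homotopy_extension ::
  "nat \<Rightarrow> 'g monoid \<Rightarrow> ('c \<Rightarrow> 'g) \<Rightarrow> ('o, 'c) crossed_complex \<Rightarrow>
   ('g \<Rightarrow> 'g \<times> 'c) \<Rightarrow> (nat \<Rightarrow> 'g \<times> 'c \<Rightarrow> 'g \<times> 'c) \<Rightarrow>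
   ('g \<times> 'c) set \<Rightarrow> ('g \<times> 'c \<Rightarrow> 'c) \<Rightarrow> 'c set \<Rightarrow> ('o, 'c) crossed_complex \<Rightarrow> bool" where
  "homotopy_extension m G \<phi> C h0 h Xt b X E \<longleftrightarrow>
     free_extension m G \<phi> C E X \<and>
     (\<forall>xt \<in> Xt. bdry E (Suc m) (b xt) =
        snd (homotopy_rhs (universal_cover G \<phi> C) \<one>\<^bsub>G\<^esub> h0 h m xt))"

text \<open>For \<open>m = 1\<close>: \<open>R\<close> generates the kernel of \<open>\<phi>\<close> as a normal subgroup. For \<open>m \<ge> 2\<close>: \<open>R\<close>
  generates the kernel of the boundary in dimension \<open>m\<close> as a \<open>G\<close>-module; closure under \<open>G\<close> is
  closure under \<open>C\<^sub>1\<close>, as \<open>G\<close> acts on this kernel through the epimorphism from \<open>C\<^sub>1\<close>.\<close>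

definition generates_kernel ::
  "nat \<Rightarrow> 'g monoid \<Rightarrow> ('c \<Rightarrow> 'g) \<Rightarrow> ('o, 'c) crossed_complex \<Rightarrow> 'c set \<Rightarrow> bool" where
  "generates_kernel m G \<phi> C R \<longleftrightarrow>
     (if m = 1 then
        R \<subseteq> kernel (vertex_group (gpd C) (the_point C)) G \<phi> \<and>
        (\<forall>N. N \<lhd> vertex_group (gpd C) (the_point C) \<and> R \<subseteq> N \<longrightarrow>
           kernel (vertex_group (gpd C) (the_point C)) G \<phi> \<subseteq> N)
      else
        R \<subseteq> bdry_kernel C m (the_point C) \<and>
        (\<forall>K. subgroup K (fam C m (the_point C)) \<and> K \<subseteq> bdry_kernel C m (the_point C) \<and>
             (\<forall>c \<in> K. \<forall>u \<in> Arr (gpd C). action C m c u \<in> K) \<and> R \<subseteq> K \<longrightarrow>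
           bdry_kernel C m (the_point C) \<subseteq> K))"

text \<open>A retraction \<open>\<xi>\<close> from \<open>E\<close> to \<open>E'\<close> in dimension \<open>m + 1\<close>, where \<open>E\<close> and \<open>E'\<close> are free there on
  \<open>X\<close> and on \<open>Y \<subseteq> X\<close>.\<close>

definition boundary_retraction ::
  "nat \<Rightarrow> ('o, 'c) crossed_complex \<Rightarrow> 'c set \<Rightarrow> ('o, 'c) crossed_complex \<Rightarrow> 'c set \<Rightarrow>
   ('c \<Rightarrow> 'c) \<Rightarrow> bool" where
  "boundary_retraction m E X E' Y \<xi> \<longleftrightarrow>
     (if m = 1 then
        crossed_module_morphism (gpd E) (fam E 2) (action E 2) (bdry E 2)
          (fam E' 2) (action E' 2) (bdry E' 2) \<xi>
      else
        action_morphism (gpd E) (fam E (Suc m)) (action E (Suc m))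
          (fam E' (Suc m)) (action E' (Suc m)) \<xi>) \<and>
     (\<forall>y \<in> Y. \<xi> y = y) \<and>
     (\<forall>x \<in> X. bdry E' (Suc m) (\<xi> x) = bdry E (Suc m) x)"

end

theory Submission
  imports Defs
begin

text \<open>Freeness is used in two ways: a free object is generated by its generators (by uniqueness, applied to
  a subobject containing them), and it maps into any object whose type injects into the target type of
  the definition.

  Let \<open>m \<ge> 2\<close> (the case \<open>m = 1\<close> is analogous, with \<open>ker \<phi>\<close> for \<open>ker \<delta>\<^sub>m\<close>), and let \<open>r\<close> be the right-hand
  side of the homotopy relation in dimension \<open>m\<close>. The relations below \<open>m\<close> show that \<open>r\<close> is a morphism to
  the fibre over \<open>1\<close>, invariant under the action and with values in \<open>ker \<delta>\<^sub>m\<close>; for \<open>m = 2\<close> this uses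
  that the values are central. Since \<open>\<delta>\<^sub>m\<^sub>+\<^sub>1 h\<^sub>m\<close> is a morphism of the same kind and agrees with
  \<open>r\<close> on the free generators, the two are equal. The homotopy in turn gives exactness: if \<open>c\<close> lies over
  \<open>1\<close> and \<open>\<delta>\<^sub>m c = 0\<close>, let \<open>c'\<close> be \<open>c\<close> acted on by the inverse of \<open>h\<^sub>0(1)\<close>; then
  \<open>c = \<delta>\<^sub>m\<^sub>+\<^sub>1 h\<^sub>m c'\<close>. As \<open>\<delta>\<^sub>m\<^sub>+\<^sub>1 \<xi> = \<delta>\<^sub>m\<^sub>+\<^sub>1\<close>, the same argument applies to the extension on
  \<open>Y\<close>.\<close>

section \<open>Groupoids and actions\<close>

text \<open>The two maps to be compared, \<open>r\<close> and the boundary of \<open>h_m\<close>,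
  are not morphisms of the category in which the cover is free: they land in a single fibre (for m =
  1, in the group of loops at 1), they trivialise the action, and for m = 2 they do not lie over the
  identity of the groupoid. So the uniqueness clause of freeness is spent only on generation.
  Equality then follows because the elements on which two such maps agree form a closed subfamily.
  This route also puts no condition on the type of the target.

  Dimension 2 shapes the rest. There the groups are not abelian and \<open>C_2\<close> is not a
  G-module; only the kernel of its boundary is one, being central by the Peiffer identity and acted
  on trivially by the boundaries, which make up the kernel of \<phi>. Therefore the new boundary for
  m = 2 is constructed as a map into this kernel. The facts about \<open>r\<close> come in a forced
  order for the same reason: its values are cycles by the relation one dimension lower, hence
  central, and only then can the quotient of two homomorphisms be shown to be a homomorphism and to
  be invariant.\<close>

context groupoid
begin

lemma arrows_Obj:
  assumes "a \<in> arrows \<Phi> x y"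
  shows "x \<in> Obj \<Phi>" "y \<in> Obj \<Phi>"
  using assms Src_closed Tgt_closed by (auto simp: arrows_def)

lemma Arr_arrows: "a \<in> Arr \<Phi> \<Longrightarrow> a \<in> arrows \<Phi> (Src \<Phi> a) (Tgt \<Phi> a)"
  by (simp add: arrows_def)

lemma Inv_Cmp_cancel:
  assumes "a \<in> arrows \<Phi> x y" "b \<in> arrows \<Phi> y z"
  shows "Cmp \<Phi> (Inv \<Phi> a) (Cmp \<Phi> a b) = b"
  using Cmp_assoc[OF Inv_closed[OF assms(1)] assms] Inv_left[OF assms(1)] Idt_left[OF assms(2)]
  by simp

lemma Cmp_Inv_cancel:
  assumes "a \<in> arrows \<Phi> x y" "b \<in> arrows \<Phi> x z"
  shows "Cmp \<Phi> a (Cmp \<Phi> (Inv \<Phi> a) b) = b"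
  using Cmp_assoc[OF assms(1) Inv_closed[OF assms(1)] assms(2)] Inv_right[OF assms(1)] Idt_left[OF assms(2)]
  by simp

lemma Inv_unique:
  assumes "a \<in> arrows \<Phi> x y" "b \<in> arrows \<Phi> y x" "Cmp \<Phi> a b = Idt \<Phi> x"
  shows "b = Inv \<Phi> a"
  by (metis assms Idt_right Inv_Cmp_cancel Inv_closed)

lemma Inv_Inv: "a \<in> arrows \<Phi> x y \<Longrightarrow> Inv \<Phi> (Inv \<Phi> a) = a"
  by (metis Inv_closed Inv_left Inv_unique)

lemma group_vertex_group: "x \<in> Obj \<Phi> \<Longrightarrow> group (vertex_group \<Phi> x)"
  by (rule groupI)
    (auto simp: vertex_group_def Cmp_assoc Idt_left intro: Cmp_closed Idt_closed Inv_closed Inv_left)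

lemma inv_vertex_group:
  "a \<in> arrows \<Phi> x x \<Longrightarrow> inv\<^bsub>vertex_group \<Phi> x\<^esub> a = Inv \<Phi> a"
  using group.inv_equality[OF group_vertex_group, of x "Inv \<Phi> a" a]
  by (auto simp: vertex_group_def Inv_left Inv_closed dest: arrows_Obj)

end

context groupoid_action
begin

lemma act_hom: "u \<in> arrows \<Phi> x y \<Longrightarrow> (\<lambda>c. act c u) \<in> hom (M x) (M y)"
  using act_closed act_mult by (auto simp: hom_def)

lemma act_one: "u \<in> arrows \<Phi> x y \<Longrightarrow> act \<one>\<^bsub>M x\<^esub> u = \<one>\<^bsub>M y\<^esub>"
  using hom_one[OF act_hom] fam_group arrows_Obj by blast

lemma act_Inv_act:
  assumes "c \<in> carrier (M y)" "u \<in> arrows \<Phi> x y"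
  shows "act (act c (Inv \<Phi> u)) u = c"
  using act_Cmp[OF assms(1) Inv_closed[OF assms(2)] assms(2)] act_Idt[OF arrows_Obj(2)[OF assms(2)] assms(1)]
    Inv_left[OF assms(2)] by simp

lemma carrier_unique:
  "\<lbrakk>c \<in> carrier (M x); c \<in> carrier (M y); x \<in> Obj \<Phi>; y \<in> Obj \<Phi>\<rbrakk> \<Longrightarrow> x = y"
  using fam_disjoint by (auto simp: disjoint_family_on_def)

end


section \<open>Universal properties with targets of arbitrary type\<close>

text \<open>Used only for injective \<open>\<iota>\<close>; otherwise \<open>the_inv \<iota>\<close> is not meaningful.\<close>

definition image_family :: "('n \<Rightarrow> 't) \<Rightarrow> ('o \<Rightarrow> 'n monoid) \<Rightarrow> 'o \<Rightarrow> 't monoid" where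
  "image_family \<iota> N x =
     \<lparr>carrier = \<iota> ` carrier (N x),
      mult = (\<lambda>a b. \<iota> (the_inv \<iota> a \<otimes>\<^bsub>N x\<^esub> the_inv \<iota> b)), one = \<iota> \<one>\<^bsub>N x\<^esub>\<rparr>"

definition image_action :: "('n \<Rightarrow> 't) \<Rightarrow> ('n \<Rightarrow> 'a \<Rightarrow> 'n) \<Rightarrow> 't \<Rightarrow> 'a \<Rightarrow> 't" where
  "image_action \<iota> act t u = \<iota> (act (the_inv \<iota> t) u)"

lemma group_image_family:
  assumes "inj \<iota>" "group (N x)"
  shows "group (image_family \<iota> N x)"
proof -
  interpret group "N x" by fact
  have "\<exists>d\<in>carrier (N x). d \<otimes>\<^bsub>N x\<^esub> c = \<one>\<^bsub>N x\<^esub>" if "c \<in> carrier (N x)" for c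
    using that l_inv by blast
  then show ?thesis
    by (intro groupI) (auto simp: image_family_def the_inv_f_f[OF assms(1)] inj_eq[OF assms(1)] m_assoc)
qed

lemma inv_image_family:
  assumes "inj \<iota>" "group (N x)" "c \<in> carrier (N x)"
  shows "inv\<^bsub>image_family \<iota> N x\<^esub> (\<iota> c) = \<iota> (inv\<^bsub>N x\<^esub> c)"
proof (rule group.inv_equality)
  show "group (image_family \<iota> N x)"
    using group_image_family assms(1,2) .
qed (use assms in \<open>auto simp: image_family_def the_inv_f_f group.l_inv group.inv_closed\<close>)

lemma groupoid_action_image:
  assumes "groupoid_action \<Phi> N act" "inj \<iota>"
  shows "groupoid_action \<Phi> (image_family \<iota> N) (image_action \<iota> act)"
proof -
  interpret groupoid_action \<Phi> N act by fact
  note [simp] = the_inv_f_f[OF assms(2)] image_family_def image_action_def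
  show ?thesis
  proof (intro groupoid_action.intro groupoid_axioms groupoid_action_axioms.intro)
    show "group (image_family \<iota> N x)" if "x \<in> Obj \<Phi>" for x
      by (intro group_image_family assms(2) fam_group that)
    show "disjoint_family_on (\<lambda>x. carrier (image_family \<iota> N x)) (Obj \<Phi>)"
      using fam_disjoint assms(2) unfolding disjoint_family_on_def
      by (simp add: image_Int[symmetric])
    show "image_action \<iota> act c u \<in> carrier (image_family \<iota> N y)"
      if "c \<in> carrier (image_family \<iota> N x)" "u \<in> arrows \<Phi> x y" for c u x y
      using that act_closed[OF _ that(2)] by auto
    show "image_action \<iota> act (c \<otimes>\<^bsub>image_family \<iota> N x\<^esub> d) u
        = image_action \<iota> act c u \<otimes>\<^bsub>image_family \<iota> N y\<^esub> image_action \<iota> act d u"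
      if "c \<in> carrier (image_family \<iota> N x)" "d \<in> carrier (image_family \<iota> N x)" "u \<in> arrows \<Phi> x y"
      for c d u x y
      using that act_mult[OF _ _ that(3)] by auto
    show "image_action \<iota> act c (Cmp \<Phi> u v) = image_action \<iota> act (image_action \<iota> act c u) v"
      if "c \<in> carrier (image_family \<iota> N x)" "u \<in> arrows \<Phi> x y" "v \<in> arrows \<Phi> y z" for c u v x y z
      using that act_Cmp[OF _ that(2,3)] by auto
  qed (auto simp: act_Idt)
qed

lemma crossed_module_image:
  assumes "crossed_module \<Phi> N act \<nu>" "inj \<iota>"
  shows "crossed_module \<Phi> (image_family \<iota> N) (image_action \<iota> act) (\<lambda>t. \<nu> (the_inv \<iota> t))"
proof -
  interpret crossed_module \<Phi> N act \<nu> by fact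
  note inj [simp] = the_inv_f_f[OF assms(2)]
  have hom: "\<nu> (c \<otimes>\<^bsub>N x\<^esub> d) = Cmp \<Phi> (\<nu> c) (\<nu> d)" "\<nu> c \<in> arrows \<Phi> x x"
    if "x \<in> Obj \<Phi>" "c \<in> carrier (N x)" "d \<in> carrier (N x)" for c d x
    using \<mu>_hom[OF that(1)] that by (auto simp: hom_def vertex_group_def)
  show ?thesis
  proof (intro crossed_module.intro crossed_module_axioms.intro)
    show "groupoid_action \<Phi> (image_family \<iota> N) (image_action \<iota> act)"
      using groupoid_action_image groupoid_action_axioms assms(2) .
    show "(\<lambda>t. \<nu> (the_inv \<iota> t)) \<in> hom (image_family \<iota> N x) (vertex_group \<Phi> x)"
      if "x \<in> Obj \<Phi>" for x
      using hom[OF that] by (auto simp: hom_def image_family_def vertex_group_def)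
    show "inv\<^bsub>image_family \<iota> N x\<^esub> d \<otimes>\<^bsub>image_family \<iota> N x\<^esub> c \<otimes>\<^bsub>image_family \<iota> N x\<^esub> d
        = image_action \<iota> act c (\<nu> (the_inv \<iota> d))"
      if x: "x \<in> Obj \<Phi>" and c: "c \<in> carrier (image_family \<iota> N x)" "d \<in> carrier (image_family \<iota> N x)"
      for x c d
    proof -
      obtain c' d' where cd: "c = \<iota> c'" "d = \<iota> d'" "c' \<in> carrier (N x)" "d' \<in> carrier (N x)"
        using c unfolding image_family_def by auto
      then show ?thesis
        using peiffer[OF x cd(3,4)] inv_image_family[where N=N, OF assms(2) fam_group[OF x] cd(4)]
        by (simp add: image_family_def image_action_def)
    qed
    show "\<nu> (the_inv \<iota> (image_action \<iota> act c u)) = Cmp \<Phi> (Cmp \<Phi> (Inv \<Phi> u) (\<nu> (the_inv \<iota> c))) u"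
      if "c \<in> carrier (image_family \<iota> N x)" "u \<in> arrows \<Phi> x y" for c u x y
      using that \<mu>_act[OF _ that(2)] by (auto simp: image_family_def image_action_def)
  qed
qed

lemma groupoid_module_image:
  assumes "groupoid_module \<Phi> N act" "inj \<iota>"
  shows "groupoid_module \<Phi> (image_family \<iota> N) (image_action \<iota> act)"
proof -
  interpret groupoid_module \<Phi> N act by fact
  interpret I: groupoid_action \<Phi> "image_family \<iota> N" "image_action \<iota> act"
    by (rule groupoid_action_image) (use assms groupoid_action_axioms in auto)
  show ?thesis
  proof (intro groupoid_module.intro I.groupoid_action_axioms groupoid_module_axioms.intro)
    fix x assume x: "x \<in> Obj \<Phi>"
    interpret comm_group "N x" using fam_comm x .
    show "comm_group (image_family \<iota> N x)"
      by (rule group.group_comm_groupI[OF I.fam_group[OF x]])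
        (auto simp: image_family_def the_inv_f_f[OF assms(2)] m_comm)
  qed
qed


section \<open>Morphisms into a transported family\<close>

lemma action_morphism_from_image:
  assumes "groupoid_action \<Phi> M act" "inj \<iota>"
    and f: "action_morphism \<Phi> M act (image_family \<iota> N) (image_action \<iota> act') f"
  shows "action_morphism \<Phi> M act N act' (\<lambda>c. the_inv \<iota> (f c))"
proof -
  interpret groupoid_action \<Phi> M act by fact
  note [simp] = the_inv_f_f[OF assms(2)] image_family_def image_action_def
  have hom: "f c \<in> \<iota> ` carrier (N x)"
    "f (c \<otimes>\<^bsub>M x\<^esub> d) = \<iota> (the_inv \<iota> (f c) \<otimes>\<^bsub>N x\<^esub> the_inv \<iota> (f d))"
    if "x \<in> Obj \<Phi>" "c \<in> carrier (M x)" "d \<in> carrier (M x)" for x c d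
    using f that by (auto simp: action_morphism_def hom_def)
  show ?thesis
    unfolding action_morphism_def
  proof (intro conjI ballI allI homI)
    show "the_inv \<iota> (f c) \<in> carrier (N x)" if "x \<in> Obj \<Phi>" "c \<in> carrier (M x)" for x c
      using hom(1)[OF that that(2)] by auto
    show "the_inv \<iota> (f (act c u)) = act' (the_inv \<iota> (f c)) u"
      if "c \<in> carrier (M x)" "u \<in> arrows \<Phi> x y" for x y c u
      using f that by (auto simp: action_morphism_def)
  qed (simp add: hom)
qed

lemma action_morphism_to_image:
  assumes "inj \<iota>" "action_morphism \<Phi> M act N act' f"
  shows "action_morphism \<Phi> M act (image_family \<iota> N) (image_action \<iota> act') (\<lambda>c. \<iota> (f c))"
  using assms(2) unfolding action_morphism_def
  by (auto simp: hom_def image_family_def image_action_def the_inv_f_f[OF assms(1)])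

text \<open>Only one of the two composites of \<iota> and \<open>the_inv \<iota>\<close> is the
  identity everywhere. Existence therefore comes from pulling a solution of P back, and uniqueness
  from pushing a solution of Q forward and reading the result back.\<close>

lemma ex_unique_on_transfer:
  assumes "ex_unique_on A P" "inj \<iota>"
    and "\<And>f. P f \<Longrightarrow> Q (\<lambda>a. the_inv \<iota> (f a))" and "\<And>f. Q f \<Longrightarrow> P (\<lambda>a. \<iota> (f a))"
  shows "ex_unique_on A Q"
proof -
  obtain f where f: "P f" "\<And>f'. P f' \<Longrightarrow> \<forall>a\<in>A. f' a = f a"
    using assms(1) by (auto simp: ex_unique_on_def)
  have "f' a = the_inv \<iota> (f a)" if "Q f'" "a \<in> A" for f' a
    using f(2)[OF assms(4)[OF that(1)]] that(2) the_inv_f_f[OF assms(2)] by metis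
  then show ?thesis
    using assms(3)[OF f(1)] by (auto simp: ex_unique_on_def)
qed

lemma free_crossed_module_universal:
  fixes \<iota> :: "'n \<Rightarrow> ('o, 'a, 's, 'm) action_target"
  assumes free: "free_crossed_module (\<Phi> :: ('o, 'a) groupoid) (M :: 'o \<Rightarrow> 'm monoid) act \<mu> (S :: 'o \<Rightarrow> 's set) w i"
    and N: "crossed_module \<Phi> N act' \<nu>"
    and k: "\<And>x s. x \<in> Obj \<Phi> \<Longrightarrow> s \<in> S x \<Longrightarrow> (k x s :: 'n) \<in> carrier (N x) \<and> \<nu> (k x s) = w x s"
    and \<iota>: "inj \<iota>"
  shows "ex_unique_on (\<Union>x \<in> Obj \<Phi>. carrier (M x))
     (\<lambda>f. crossed_module_morphism \<Phi> M act \<mu> N act' \<nu> f \<and> (\<forall>x \<in> Obj \<Phi>. \<forall>s \<in> S x. f (i x s) = k x s))"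
proof (rule ex_unique_on_transfer[OF _ \<iota>])
  interpret crossed_module \<Phi> M act \<mu>
    using free by (simp add: free_crossed_module_def)
  note [simp] = the_inv_f_f[OF \<iota>]
  \<comment> \<open>The transported boundary reads its argument back along \<iota>, so preserving
    the boundary means the same for N and for its copy.\<close>
  let ?P = "\<lambda>f. crossed_module_morphism \<Phi> M act \<mu> (image_family \<iota> N) (image_action \<iota> act')
      (\<lambda>t. \<nu> (the_inv \<iota> t)) f \<and> (\<forall>x \<in> Obj \<Phi>. \<forall>s \<in> S x. f (i x s) = \<iota> (k x s))"
  have "\<forall>x \<in> Obj \<Phi>. \<forall>s \<in> S x. \<iota> (k x s) \<in> carrier (image_family \<iota> N x) \<and> \<nu> (the_inv \<iota> (\<iota> (k x s))) = w x s"
    using k by (auto simp: image_family_def)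
  then show "ex_unique_on (\<Union>x \<in> Obj \<Phi>. carrier (M x)) ?P"
    using crossed_module_image[OF N \<iota>]
    by (intro free[unfolded free_crossed_module_def, THEN conjunct2, THEN conjunct2, THEN spec, THEN spec,
          THEN spec, THEN spec, THEN mp, of "image_family \<iota> N" "image_action \<iota> act'"
          "\<lambda>t. \<nu> (the_inv \<iota> t)" "\<lambda>x s. \<iota> (k x s)"] conjI)
  show "crossed_module_morphism \<Phi> M act \<mu> N act' \<nu> (\<lambda>a. the_inv \<iota> (f a)) \<and>
         (\<forall>x\<in>Obj \<Phi>. \<forall>s\<in>S x. the_inv \<iota> (f (i x s)) = k x s)" if "?P f" for f
    using that action_morphism_from_image[OF groupoid_action_axioms \<iota>]
    by (auto simp: crossed_module_morphism_def)
  show "?P (\<lambda>a. \<iota> (f a))" if "crossed_module_morphism \<Phi> M act \<mu> N act' \<nu> f \<and>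
         (\<forall>x\<in>Obj \<Phi>. \<forall>s\<in>S x. f (i x s) = k x s)" for f
    using that action_morphism_to_image[OF \<iota>]
    by (auto simp: crossed_module_morphism_def)
qed

lemma free_module_universal:
  fixes \<iota> :: "'n \<Rightarrow> ('o, 'a, 's, 'm) action_target"
  assumes free: "free_module (\<Phi> :: ('o, 'a) groupoid) (M :: 'o \<Rightarrow> 'm monoid) act (S :: 'o \<Rightarrow> 's set) i"
    and N: "groupoid_module \<Phi> N act'"
    and k: "\<And>x s. x \<in> Obj \<Phi> \<Longrightarrow> s \<in> S x \<Longrightarrow> (k x s :: 'n) \<in> carrier (N x)"
    and \<iota>: "inj \<iota>"
  shows "ex_unique_on (\<Union>x \<in> Obj \<Phi>. carrier (M x))
     (\<lambda>f. action_morphism \<Phi> M act N act' f \<and> (\<forall>x \<in> Obj \<Phi>. \<forall>s \<in> S x. f (i x s) = k x s))"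
proof (rule ex_unique_on_transfer[OF _ \<iota>])
  interpret groupoid_module \<Phi> M act
    using free by (simp add: free_module_def)
  note [simp] = the_inv_f_f[OF \<iota>]
  let ?P = "\<lambda>f. action_morphism \<Phi> M act (image_family \<iota> N) (image_action \<iota> act') f \<and>
      (\<forall>x \<in> Obj \<Phi>. \<forall>s \<in> S x. f (i x s) = \<iota> (k x s))"
  have "\<forall>x \<in> Obj \<Phi>. \<forall>s \<in> S x. \<iota> (k x s) \<in> carrier (image_family \<iota> N x)"
    using k by (auto simp: image_family_def)
  then show "ex_unique_on (\<Union>x \<in> Obj \<Phi>. carrier (M x)) ?P"
    using groupoid_module_image[OF N \<iota>]
    by (intro free[unfolded free_module_def, THEN conjunct2, THEN conjunct2, THEN spec, THEN spec,
          THEN spec, THEN mp, of "image_family \<iota> N" "image_action \<iota> act'"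
          "\<lambda>x s. \<iota> (k x s)"] conjI)
  show "action_morphism \<Phi> M act N act' (\<lambda>a. the_inv \<iota> (f a)) \<and>
         (\<forall>x\<in>Obj \<Phi>. \<forall>s\<in>S x. the_inv \<iota> (f (i x s)) = k x s)" if "?P f" for f
    using that action_morphism_from_image[OF groupoid_action_axioms \<iota>] by auto
  show "?P (\<lambda>a. \<iota> (f a))" if "action_morphism \<Phi> M act N act' f \<and>
         (\<forall>x\<in>Obj \<Phi>. \<forall>s\<in>S x. f (i x s) = k x s)" for f
    using that action_morphism_to_image[OF \<iota>] by auto
qed


section \<open>Free objects are generated by their generators\<close>

text \<open>One set K serves all fibres, since the groups of a family are disjoint. Intersecting
  with the carrier allows K to be a bare solution set such as \<open>{c. f c = f' c}\<close>, with
  members outside the carriers.\<close>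

definition restrict_family :: "('o \<Rightarrow> 'm monoid) \<Rightarrow> 'm set \<Rightarrow> 'o \<Rightarrow> 'm monoid" where
  "restrict_family M K x = (M x)\<lparr>carrier := K \<inter> carrier (M x)\<rparr>"

text \<open>Subgroups stable under the action are subobjects both of crossed modules and of modules,
  because the Peiffer identity and commutativity are inherited elementwise.\<close>

definition closed_subfamily ::
  "('o, 'a) groupoid \<Rightarrow> ('o \<Rightarrow> 'm monoid) \<Rightarrow> ('m \<Rightarrow> 'a \<Rightarrow> 'm) \<Rightarrow> 'm set \<Rightarrow> bool" where
  "closed_subfamily \<Phi> M act K \<longleftrightarrow>
     (\<forall>x \<in> Obj \<Phi>. subgroup (K \<inter> carrier (M x)) (M x)) \<and>
     (\<forall>x y. \<forall>c \<in> K \<inter> carrier (M x). \<forall>u \<in> arrows \<Phi> x y. act c u \<in> K)"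

lemma groupoid_action_restrict:
  assumes "groupoid_action \<Phi> M act" and K: "closed_subfamily \<Phi> M act K"
  shows "groupoid_action \<Phi> (restrict_family M K) act"
proof -
  interpret groupoid_action \<Phi> M act by fact
  show ?thesis
  proof (intro groupoid_action.intro groupoid_axioms groupoid_action_axioms.intro)
    show "group (restrict_family M K x)" if "x \<in> Obj \<Phi>" for x
      using K that fam_group unfolding closed_subfamily_def restrict_family_def
      by (auto intro: subgroup.subgroup_is_group)
    show "disjoint_family_on (\<lambda>x. carrier (restrict_family M K x)) (Obj \<Phi>)"
      using fam_disjoint by (auto simp: disjoint_family_on_def restrict_family_def)
    show "act c u \<in> carrier (restrict_family M K y)"
      if "c \<in> carrier (restrict_family M K x)" "u \<in> arrows \<Phi> x y" for c u x y
      using K that(1) act_closed[OF _ that(2)] that(2)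
      by (auto simp: restrict_family_def closed_subfamily_def)
    show "act c (Cmp \<Phi> u v) = act (act c u) v"
      if "c \<in> carrier (restrict_family M K x)" "u \<in> arrows \<Phi> x y" "v \<in> arrows \<Phi> y z" for c u v x y z
      using act_Cmp[OF _ that(2,3)] that(1) by (simp add: restrict_family_def)
    show "act (c \<otimes>\<^bsub>restrict_family M K x\<^esub> d) u = act c u \<otimes>\<^bsub>restrict_family M K y\<^esub> act d u"
      if "c \<in> carrier (restrict_family M K x)" "d \<in> carrier (restrict_family M K x)" "u \<in> arrows \<Phi> x y"
      for c d u x y
      using act_mult[OF _ _ that(3)] that(1,2) by (simp add: restrict_family_def)
  qed (auto simp: restrict_family_def act_Idt)
qed

lemma crossed_module_restrict:
  assumes "crossed_module \<Phi> M act \<mu>" and K: "closed_subfamily \<Phi> M act K"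
  shows "crossed_module \<Phi> (restrict_family M K) act \<mu>"
proof -
  interpret crossed_module \<Phi> M act \<mu> by fact
  show ?thesis
  proof (intro crossed_module.intro crossed_module_axioms.intro)
    show "groupoid_action \<Phi> (restrict_family M K) act"
      using groupoid_action_restrict groupoid_action_axioms K .
    show "\<mu> \<in> hom (restrict_family M K x) (vertex_group \<Phi> x)" if "x \<in> Obj \<Phi>" for x
      using \<mu>_hom[OF that] by (auto simp: hom_def restrict_family_def)
    show "\<mu> (act c u) = Cmp \<Phi> (Cmp \<Phi> (Inv \<Phi> u) (\<mu> c)) u"
      if "c \<in> carrier (restrict_family M K x)" "u \<in> arrows \<Phi> x y" for c u x y
      using \<mu>_act[OF _ that(2)] that(1) by (simp add: restrict_family_def)
    show "inv\<^bsub>restrict_family M K x\<^esub> d \<otimes>\<^bsub>restrict_family M K x\<^esub> c \<otimes>\<^bsub>restrict_family M K x\<^esub> d = act c (\<mu> d)"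
      if x: "x \<in> Obj \<Phi>" and "c \<in> carrier (restrict_family M K x)" "d \<in> carrier (restrict_family M K x)"
      for c d x
    proof -
      have "subgroup (K \<inter> carrier (M x)) (M x)"
        using K x by (simp add: closed_subfamily_def)
      then show ?thesis
        using group.m_inv_consistent[OF fam_group[OF x]] peiffer[OF x] that(2,3)
        by (simp add: restrict_family_def)
    qed
  qed
qed

lemma groupoid_module_restrict:
  assumes "groupoid_module \<Phi> M act" and K: "closed_subfamily \<Phi> M act K"
  shows "groupoid_module \<Phi> (restrict_family M K) act"
proof -
  interpret groupoid_module \<Phi> M act by fact
  interpret R: groupoid_action \<Phi> "restrict_family M K" act
    by (rule groupoid_action_restrict[OF groupoid_action_axioms K])
  show ?thesis
  proof (intro groupoid_module.intro R.groupoid_action_axioms groupoid_module_axioms.intro)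
    fix x assume x: "x \<in> Obj \<Phi>"
    interpret comm_group "M x" using fam_comm x .
    show "comm_group (restrict_family M K x)"
      by (rule group.group_comm_groupI[OF R.fam_group[OF x]]) (auto simp: restrict_family_def m_comm)
  qed
qed

lemma action_morphism_restrict:
  "action_morphism \<Phi> M act (restrict_family N K) act' f \<Longrightarrow> action_morphism \<Phi> M act N act' f"
  by (auto simp: action_morphism_def hom_def restrict_family_def)

lemma action_morphism_id: "action_morphism \<Phi> M act M act (\<lambda>c. c)"
  by (auto simp: action_morphism_def hom_def)

lemma ex_unique_onD:
  assumes "ex_unique_on A P"
  shows "\<exists>f. P f" and "P f \<Longrightarrow> P f' \<Longrightarrow> a \<in> A \<Longrightarrow> f a = f' a"
  using assms unfolding ex_unique_on_def by (blast, metis)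

text \<open>Freeness gives a morphism f from M to the subobject K that fixes the generators.
  Followed by the inclusion it is an endomorphism of M fixing the generators, hence the identity, so
  c = f c lies in K. Both targets have the element type of M and enter the target type by
  \<open>Inl\<close>.\<close>

lemma free_crossed_module_generated:
  assumes free: "free_crossed_module \<Phi> M act \<mu> S w i"
    and K: "closed_subfamily \<Phi> M act K"
    and gen: "\<And>x s. x \<in> Obj \<Phi> \<Longrightarrow> s \<in> S x \<Longrightarrow> i x s \<in> K"
    and c: "x \<in> Obj \<Phi>" "c \<in> carrier (M x)"
  shows "c \<in> K"
proof -
  have M: "crossed_module \<Phi> M act \<mu>"
    and i: "\<And>x s. x \<in> Obj \<Phi> \<Longrightarrow> s \<in> S x \<Longrightarrow> i x s \<in> carrier (M x) \<and> \<mu> (i x s) = w x s"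
    using free by (auto simp: free_crossed_module_def)
  have "i x s \<in> carrier (restrict_family M K x) \<and> \<mu> (i x s) = w x s" if "x \<in> Obj \<Phi>" "s \<in> S x" for x s
    using i[OF that] gen[OF that] by (simp add: restrict_family_def)
  then obtain f where f: "crossed_module_morphism \<Phi> M act \<mu> (restrict_family M K) act \<mu> f"
      "\<forall>x \<in> Obj \<Phi>. \<forall>s \<in> S x. f (i x s) = i x s"
    using ex_unique_onD(1)[OF free_crossed_module_universal[OF free crossed_module_restrict[OF M K] _ inj_Inl,
        of i]] by blast
  have "crossed_module_morphism \<Phi> M act \<mu> M act \<mu> f \<and> (\<forall>x \<in> Obj \<Phi>. \<forall>s \<in> S x. f (i x s) = i x s)"
    using f action_morphism_restrict by (auto simp: crossed_module_morphism_def)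
  moreover have "crossed_module_morphism \<Phi> M act \<mu> M act \<mu> (\<lambda>c. c) \<and> (\<forall>x \<in> Obj \<Phi>. \<forall>s \<in> S x. i x s = i x s)"
    using action_morphism_id by (auto simp: crossed_module_morphism_def)
  ultimately have "f c = c"
    using ex_unique_onD(2)[OF free_crossed_module_universal[where k = i, OF free M i inj_Inl]] c by blast
  moreover have "f c \<in> K"
    using f(1) c by (auto simp: crossed_module_morphism_def action_morphism_def hom_def restrict_family_def)
  ultimately show ?thesis by simp
qed

lemma free_module_generated:
  assumes free: "free_module \<Phi> M act S i"
    and K: "closed_subfamily \<Phi> M act K"
    and gen: "\<And>x s. x \<in> Obj \<Phi> \<Longrightarrow> s \<in> S x \<Longrightarrow> i x s \<in> K"
    and c: "x \<in> Obj \<Phi>" "c \<in> carrier (M x)"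
  shows "c \<in> K"
proof -
  have M: "groupoid_module \<Phi> M act"
    and i: "\<And>x s. x \<in> Obj \<Phi> \<Longrightarrow> s \<in> S x \<Longrightarrow> i x s \<in> carrier (M x)"
    using free by (auto simp: free_module_def)
  have "i x s \<in> carrier (restrict_family M K x)" if "x \<in> Obj \<Phi>" "s \<in> S x" for x s
    using i[OF that] gen[OF that] by (simp add: restrict_family_def)
  then obtain f where f: "action_morphism \<Phi> M act (restrict_family M K) act f"
      "\<forall>x \<in> Obj \<Phi>. \<forall>s \<in> S x. f (i x s) = i x s"
    using ex_unique_onD(1)[OF free_module_universal[OF free groupoid_module_restrict[OF M K] _ inj_Inl,
        of i]] by blast
  have "action_morphism \<Phi> M act M act f \<and> (\<forall>x \<in> Obj \<Phi>. \<forall>s \<in> S x. f (i x s) = i x s)"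
    using f action_morphism_restrict by auto
  moreover have "action_morphism \<Phi> M act M act (\<lambda>c. c) \<and> (\<forall>x \<in> Obj \<Phi>. \<forall>s \<in> S x. i x s = i x s)"
    using action_morphism_id by auto
  ultimately have "f c = c"
    using ex_unique_onD(2)[OF free_module_universal[where k = i, OF free M i inj_Inl]] c by blast
  moreover have "f c \<in> K"
    using f(1) c by (auto simp: action_morphism_def hom_def restrict_family_def)
  ultimately show ?thesis by simp
qed

text \<open>Stability of K is known over \<Phi> while freeness holds over \<Gamma>. Every arrow of
  \<Gamma> lifts to one of \<Phi> with the same end points, so stability passes to \<Gamma>.\<close>

lemma free_module_along_generated:
  assumes free: "free_module_along \<Phi> \<Gamma> \<psi> M act S i"
    and Obj: "Obj \<Gamma> = Obj \<Phi>"
    and surj: "\<And>x y v. v \<in> arrows \<Gamma> x y \<Longrightarrow> \<exists>u \<in> arrows \<Phi> x y. \<psi> u = v"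
    and K: "closed_subfamily \<Phi> M act K"
    and gen: "\<And>x s. x \<in> Obj \<Phi> \<Longrightarrow> s \<in> S x \<Longrightarrow> i x s \<in> K"
    and c: "x \<in> Obj \<Phi>" "c \<in> carrier (M x)"
  shows "c \<in> K"
proof -
  obtain act' where act': "\<And>x y c u. c \<in> carrier (M x) \<Longrightarrow> u \<in> arrows \<Phi> x y \<Longrightarrow> act' c (\<psi> u) = act c u"
      and free': "free_module \<Gamma> M act' S i"
    using free unfolding free_module_along_def by blast
  have "closed_subfamily \<Gamma> M act' K"
    unfolding closed_subfamily_def
  proof (intro conjI ballI allI)
    show "act' c v \<in> K" if "c \<in> K \<inter> carrier (M x)" "v \<in> arrows \<Gamma> x y" for x y c v
      using surj[OF that(2)] that(1) act' K by (auto simp: closed_subfamily_def)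
  qed (use K Obj in \<open>auto simp: closed_subfamily_def\<close>)
  then show ?thesis
    using free_module_generated[OF free'] gen c Obj by metis
qed

section \<open>Free groupoids: extension of maps into a group, and generation\<close>

lemma groupoid_group_groupoid:
  assumes "group K"
  shows "groupoid (group_groupoid z K)"
proof -
  interpret group K by fact
  show ?thesis
    by (rule groupoid.intro) (auto simp: group_groupoid_def arrows_def m_assoc)
qed

lemma free_groupoid_universal:
  fixes \<Phi> :: "('o, 'a) groupoid" and \<Psi> :: "('o, ('o, 'a) groupoid_target) groupoid"
  assumes "free_groupoid_on \<Phi> X" "groupoid \<Psi>" "\<forall>x \<in> Obj \<Phi>. f0 x \<in> Obj \<Psi>"
    and "\<forall>a \<in> X. k a \<in> arrows \<Psi> (f0 (Src \<Phi> a)) (f0 (Tgt \<Phi> a))"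
  shows "ex_unique_on (Arr \<Phi>) (\<lambda>f. groupoid_morphism \<Phi> \<Psi> f0 f \<and> (\<forall>a \<in> X. f a = k a))"
  using assms(2-4)
  by (intro assms(1)[unfolded free_groupoid_on_def, THEN conjunct2, THEN conjunct2, THEN spec, THEN spec,
        THEN spec, THEN mp, of \<Psi> f0 k] conjI)

text \<open>A multiplicative map from the arrows to a group is a groupoid morphism to a groupoid
  with one object, so freeness applies with a constant map on objects.\<close>

lemma free_groupoid_extend:
  fixes \<Phi> :: "('o, 'a) groupoid" and K :: "'n monoid" and \<iota> :: "'n \<Rightarrow> ('o, 'a) groupoid_target"
  assumes free: "free_groupoid_on \<Phi> X" and K: "group K" and k: "k \<in> X \<rightarrow> carrier K" and \<iota>: "inj \<iota>"
  shows "\<exists>f. f \<in> Arr \<Phi> \<rightarrow> carrier K \<and>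
    (\<forall>x y z. \<forall>a \<in> arrows \<Phi> x y. \<forall>b \<in> arrows \<Phi> y z. f (Cmp \<Phi> a b) = f a \<otimes>\<^bsub>K\<^esub> f b) \<and>
    (\<forall>a \<in> X. f a = k a)"
proof -
  interpret groupoid \<Phi> using free by (simp add: free_groupoid_on_def)
  \<comment> \<open>The target groupoid must have objects of type \<open>'o\<close>; any element can
    be its only object.\<close>
  define z :: 'o where "z = undefined"
  let ?L = "image_family \<iota> (\<lambda>_::'o. K) z"
  let ?\<Psi> = "group_groupoid z ?L"
  note [simp] = the_inv_f_f[OF \<iota>]
  have "groupoid ?\<Psi>"
    by (intro groupoid_group_groupoid group_image_family K \<iota>)
  moreover have "\<forall>x \<in> Obj \<Phi>. z \<in> Obj ?\<Psi>"
    by (simp add: group_groupoid_def)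
  moreover have "\<forall>a \<in> X. \<iota> (k a) \<in> arrows ?\<Psi> z z"
    using k by (auto simp: arrows_def group_groupoid_def image_family_def)
  ultimately have "ex_unique_on (Arr \<Phi>) (\<lambda>f. groupoid_morphism \<Phi> ?\<Psi> (\<lambda>_. z) f \<and> (\<forall>a \<in> X. f a = \<iota> (k a)))"
    by (rule free_groupoid_universal[OF free])
  then obtain f where f: "groupoid_morphism \<Phi> ?\<Psi> (\<lambda>_. z) f" "\<forall>a \<in> X. f a = \<iota> (k a)"
    using ex_unique_onD(1) by blast
  have "f a \<in> \<iota> ` carrier K" if "a \<in> Arr \<Phi>" for a
    using f(1) Arr_arrows[OF that]
    unfolding groupoid_morphism_def by (fastforce simp: arrows_def group_groupoid_def image_family_def)
  moreover have "f (Cmp \<Phi> a b) = \<iota> (the_inv \<iota> (f a) \<otimes>\<^bsub>K\<^esub> the_inv \<iota> (f b))"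
    if "a \<in> arrows \<Phi> x y" "b \<in> arrows \<Phi> y t" for a b x y t
    using f(1) that unfolding groupoid_morphism_def by (simp add: group_groupoid_def image_family_def)
  ultimately show ?thesis
    using f(2) by (intro exI[of _ "\<lambda>a. the_inv \<iota> (f a)"]) fastforce
qed

text \<open>The wide subgroupoid with arrow set K, copied into the left summand of the type over
  which freeness quantifies. All objects are kept, so the identity is a legitimate map on
  objects.\<close>

definition inl_groupoid :: "('o, 'a) groupoid \<Rightarrow> 'a set \<Rightarrow> ('o, 'a + 'b) groupoid" where
  "inl_groupoid \<Phi> K =
     \<lparr>Obj = Obj \<Phi>, Arr = Inl ` K, Src = (\<lambda>a. Src \<Phi> (projl a)), Tgt = (\<lambda>a. Tgt \<Phi> (projl a)),
      Cmp = (\<lambda>a b. Inl (Cmp \<Phi> (projl a) (projl b))), Idt = (\<lambda>x. Inl (Idt \<Phi> x)),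
      Inv = (\<lambda>a. Inl (Inv \<Phi> (projl a)))\<rparr>"

lemma arrows_inl_groupoid: "K \<subseteq> Arr \<Phi> \<Longrightarrow> arrows (inl_groupoid \<Phi> K) x y = Inl ` (K \<inter> arrows \<Phi> x y)"
  by (auto simp: inl_groupoid_def arrows_def)

lemma groupoid_inl_groupoid:
  fixes \<Phi> :: "('o, 'a) groupoid"
  assumes "groupoid \<Phi>" and K: "K \<subseteq> Arr \<Phi>"
    and Idt: "\<And>x. x \<in> Obj \<Phi> \<Longrightarrow> Idt \<Phi> x \<in> K"
    and Cmp: "\<And>a b x y z. \<lbrakk>a \<in> K; b \<in> K; a \<in> arrows \<Phi> x y; b \<in> arrows \<Phi> y z\<rbrakk> \<Longrightarrow> Cmp \<Phi> a b \<in> K"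
    and Inv: "\<And>a. a \<in> K \<Longrightarrow> Inv \<Phi> a \<in> K"
  shows "groupoid (inl_groupoid \<Phi> K :: ('o, 'a + 'b) groupoid)"
proof -
  let ?\<Psi> = "inl_groupoid \<Phi> K :: ('o, 'a + 'b) groupoid"
  interpret groupoid \<Phi> by fact
  note simps = arrows_inl_groupoid[OF K] inl_groupoid_def
  show ?thesis
  proof (rule groupoid.intro)
    fix a b c x y z t
    assume a: "a \<in> arrows ?\<Psi> x y"
    then obtain a' where a': "a = Inl a'" "a' \<in> K" "a' \<in> arrows \<Phi> x y"
      by (auto simp: arrows_inl_groupoid[OF K])
    show "Cmp ?\<Psi> (Idt ?\<Psi> x) a = a"
      "Cmp ?\<Psi> a (Idt ?\<Psi> y) = a"
      "Cmp ?\<Psi> a (Inv ?\<Psi> a) = Idt ?\<Psi> x"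
      "Cmp ?\<Psi> (Inv ?\<Psi> a) a = Idt ?\<Psi> y"
      using a' Idt_left[OF a'(3)] Idt_right[OF a'(3)] Inv_left[OF a'(3)] Inv_right[OF a'(3)]
      by (simp_all add: inl_groupoid_def)
    have "Inv ?\<Psi> a = Inl (Inv \<Phi> a')"
      using a' by (simp add: inl_groupoid_def)
    then show "Inv ?\<Psi> a \<in> arrows ?\<Psi> y x"
      using a' Inv Inv_closed by (simp add: arrows_inl_groupoid[OF K])
    assume b: "b \<in> arrows ?\<Psi> y z"
    then obtain b' where b': "b = Inl b'" "b' \<in> K" "b' \<in> arrows \<Phi> y z"
      by (auto simp: arrows_inl_groupoid[OF K])
    have "Cmp ?\<Psi> a b = Inl (Cmp \<Phi> a' b')"
      using a' b' by (simp add: inl_groupoid_def)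
    then show "Cmp ?\<Psi> a b \<in> arrows ?\<Psi> x z"
      using Cmp[OF a'(2) b'(2) a'(3) b'(3)] Cmp_closed[OF a'(3) b'(3)]
      by (simp add: arrows_inl_groupoid[OF K])
    assume "c \<in> arrows ?\<Psi> z t"
    then show "Cmp ?\<Psi> (Cmp ?\<Psi> a b) c
        = Cmp ?\<Psi> a (Cmp ?\<Psi> b c)"
      using a' b' Cmp_assoc[OF a'(3) b'(3)]
      by (auto simp: arrows_inl_groupoid[OF K]) (simp add: inl_groupoid_def)
  next
    fix x assume "x \<in> Obj ?\<Psi>"
    then have "x \<in> Obj \<Phi>" by (simp add: inl_groupoid_def)
    moreover have "Idt ?\<Psi> x = Inl (Idt \<Phi> x)" by (simp add: inl_groupoid_def)
    ultimately show "Idt ?\<Psi> x \<in> arrows ?\<Psi> x x"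
      using Idt Idt_closed by (simp add: arrows_inl_groupoid[OF K])
  qed (use K Src_closed Tgt_closed in \<open>auto simp: inl_groupoid_def\<close>)
qed

text \<open>Freeness gives f into the copy of K extending \<open>Inl\<close> on X. Viewed in the
  copy of all of \<Phi>, both f and \<open>Inl\<close> extend the same map on X, so they agree;
  hence \<open>Inl a\<close> already lies in the copy of K.\<close>

lemma free_groupoid_generated:
  fixes \<Phi> :: "('o, 'a) groupoid"
  assumes free: "free_groupoid_on \<Phi> X" and K: "K \<subseteq> Arr \<Phi>" "X \<subseteq> K"
    and Idt: "\<And>x. x \<in> Obj \<Phi> \<Longrightarrow> Idt \<Phi> x \<in> K"
    and Cmp: "\<And>a b x y z. \<lbrakk>a \<in> K; b \<in> K; a \<in> arrows \<Phi> x y; b \<in> arrows \<Phi> y z\<rbrakk> \<Longrightarrow> Cmp \<Phi> a b \<in> K"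
    and Inv: "\<And>a. a \<in> K \<Longrightarrow> Inv \<Phi> a \<in> K"
  shows "Arr \<Phi> \<subseteq> K"
proof
  fix a assume a: "a \<in> Arr \<Phi>"
  let ?\<Psi> = "inl_groupoid \<Phi> :: 'a set \<Rightarrow> ('o, ('o, 'a) groupoid_target) groupoid"
  interpret groupoid \<Phi> using free by (simp add: free_groupoid_on_def)
  have univ: "ex_unique_on (Arr \<Phi>) (\<lambda>f. groupoid_morphism \<Phi> (?\<Psi> L) (\<lambda>x. x) f \<and> (\<forall>a \<in> X. f a = Inl a))"
    if "groupoid (?\<Psi> L)" "L \<subseteq> Arr \<Phi>" "X \<subseteq> L" for L
  proof -
    have "\<forall>x \<in> Obj \<Phi>. x \<in> Obj (?\<Psi> L)"
      by (simp add: inl_groupoid_def)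
    moreover have "\<forall>a \<in> X. Inl a \<in> arrows (?\<Psi> L) (Src \<Phi> a) (Tgt \<Phi> a)"
      using that(2,3) Arr_arrows by (auto simp: arrows_inl_groupoid)
    ultimately show ?thesis
      using free_groupoid_universal[OF free that(1), of "\<lambda>x. x" Inl] by blast
  qed
  have "groupoid (?\<Psi> K)"
    using groupoid_inl_groupoid[OF groupoid_axioms K(1) Idt Cmp Inv] .
  from ex_unique_onD(1)[OF univ[OF this K]]
  obtain f where f: "groupoid_morphism \<Phi> (?\<Psi> K) (\<lambda>x. x) f" "\<forall>a \<in> X. f a = Inl a"
    by blast
  have f_arrows: "f a \<in> Inl ` (K \<inter> arrows \<Phi> x y)" if "a \<in> arrows \<Phi> x y" for a x y
    using f(1) that unfolding groupoid_morphism_def arrows_inl_groupoid[OF K(1)] by blast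
  have f': "groupoid_morphism \<Phi> (?\<Psi> (Arr \<Phi>)) (\<lambda>x. x) f"
    unfolding groupoid_morphism_def
  proof (intro conjI allI ballI)
    show "f a \<in> arrows (?\<Psi> (Arr \<Phi>)) x y" if "a \<in> arrows \<Phi> x y" for a x y
      using f_arrows[OF that] K(1) by (auto simp: arrows_inl_groupoid)
    show "f (Cmp \<Phi> a b) = Cmp (?\<Psi> (Arr \<Phi>)) (f a) (f b)"
      if "a \<in> arrows \<Phi> x y" "b \<in> arrows \<Phi> y z" for a b x y z
      using f(1) that unfolding groupoid_morphism_def by (simp add: inl_groupoid_def)
  qed (simp add: inl_groupoid_def)
  have "groupoid (?\<Psi> (Arr \<Phi>))"
  proof (rule groupoid_inl_groupoid[OF groupoid_axioms])
    show "Idt \<Phi> x \<in> Arr \<Phi>" if "x \<in> Obj \<Phi>" for x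
      using Idt_closed[OF that] by (simp add: arrows_def)
    show "Cmp \<Phi> a b \<in> Arr \<Phi>" if "a \<in> arrows \<Phi> x y" "b \<in> arrows \<Phi> y z" for a b x y z
      using Cmp_closed[OF that] by (simp add: arrows_def)
    show "Inv \<Phi> a \<in> Arr \<Phi>" if "a \<in> Arr \<Phi>" for a
      using Inv_closed[OF Arr_arrows[OF that]] by (simp add: arrows_def)
  qed simp
  note unique = ex_unique_onD(2)[OF univ[OF this order_refl subset_trans[OF K(2,1)]], of f Inl a]
  have "groupoid_morphism \<Phi> (?\<Psi> (Arr \<Phi>)) (\<lambda>x. x) Inl"
    unfolding groupoid_morphism_def arrows_inl_groupoid[OF order_refl]
    by (simp add: inl_groupoid_def arrows_def)
  then have "f a = Inl a"
    using f' f(2) a by (intro unique) simp_all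
  moreover have "f a \<in> Inl ` K"
    using f_arrows[OF Arr_arrows[OF a]] by blast
  ultimately show "a \<in> K" by auto
qed


section \<open>Contracting homotopies of crossed complexes\<close>

lemma (in crossed_module) \<mu>_arrow: "\<lbrakk>x \<in> Obj \<Phi>; c \<in> carrier (M x)\<rbrakk> \<Longrightarrow> \<mu> c \<in> arrows \<Phi> x x"
  using \<mu>_hom by (auto simp: hom_def vertex_group_def)

lemma (in crossed_module) \<mu>_mult:
  "\<lbrakk>x \<in> Obj \<Phi>; c \<in> carrier (M x); d \<in> carrier (M x)\<rbrakk> \<Longrightarrow> \<mu> (c \<otimes>\<^bsub>M x\<^esub> d) = Cmp \<Phi> (\<mu> c) (\<mu> d)"
  using \<mu>_hom by (auto simp: hom_def vertex_group_def)

lemma (in crossed_module) \<mu>_group_hom: "x \<in> Obj \<Phi> \<Longrightarrow> group_hom (M x) (vertex_group \<Phi> x) \<mu>"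
  using \<mu>_hom fam_group group_vertex_group by (simp add: group_hom_def group_hom_axioms_def)

lemma (in crossed_module) \<mu>_inv: "\<lbrakk>x \<in> Obj \<Phi>; c \<in> carrier (M x)\<rbrakk> \<Longrightarrow> \<mu> (inv\<^bsub>M x\<^esub> c) = Inv \<Phi> (\<mu> c)"
  using group_hom.hom_inv[OF \<mu>_group_hom] inv_vertex_group[OF \<mu>_arrow] by simp

text \<open>By the Peiffer identity, conjugation by d is the action of \<mu> d, here an identity
  arrow. This is what makes cycles of dimension 2 commute with everything in their fibre.\<close>

lemma (in crossed_module) kernel_central:
  assumes x: "x \<in> Obj \<Phi>" and c: "c \<in> carrier (M x)" and d: "d \<in> carrier (M x)" "\<mu> d = Idt \<Phi> x"
  shows "c \<otimes>\<^bsub>M x\<^esub> d = d \<otimes>\<^bsub>M x\<^esub> c"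
proof -
  interpret group "M x" using fam_group x .
  have "inv\<^bsub>M x\<^esub> d \<otimes>\<^bsub>M x\<^esub> c \<otimes>\<^bsub>M x\<^esub> d = c"
    using peiffer[OF x c d(1)] act_Idt[OF x c] d(2) by simp
  then have "inv\<^bsub>M x\<^esub> d \<otimes>\<^bsub>M x\<^esub> (c \<otimes>\<^bsub>M x\<^esub> d) = c"
    using c d by (simp add: m_assoc)
  then show ?thesis
    using c d(1) by (metis inv_solve_left m_closed)
qed

text \<open>For the invariance of the homotopy right-hand side in dimension 2: moving the argument
  along an arrow conjugates both factors by the same e, which this pulls out of the
  quotient.\<close>

lemma (in group) conjugate_quotient:
  assumes "e \<in> carrier G" "p \<in> carrier G" "q \<in> carrier G"
  shows "inv (inv e \<otimes> p \<otimes> e) \<otimes> (inv e \<otimes> q \<otimes> e) = inv e \<otimes> (inv p \<otimes> q) \<otimes> e"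
proof -
  have "e \<otimes> (inv e \<otimes> (q \<otimes> e)) = q \<otimes> e"
    using assms by (simp add: m_assoc[symmetric])
  then show ?thesis
    using assms by (simp add: inv_mult_group m_assoc)
qed

sublocale truncated_crossed_complex \<subseteq> groupoid "gpd C"
  by (rule dim1)

context truncated_crossed_complex
begin

lemma action_dim: "2 \<le> n \<Longrightarrow> n \<le> m \<Longrightarrow> groupoid_action (gpd C) (fam C n) (action C n)"
  using crossed_module.axioms(1)[OF dim2] groupoid_module.axioms(1)[OF dim_ge3]
  by (cases "n = 2") auto

lemma base_point_eq:
  assumes "2 \<le> n" "n \<le> m" "x \<in> Obj (gpd C)" "c \<in> carrier (fam C n x)"
  shows "base_point C n c = x"
proof -
  interpret groupoid_action "gpd C" "fam C n" "action C n" using action_dim assms by auto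
  show ?thesis
    unfolding base_point_def using assms carrier_unique by blast
qed

lemma bdry_group_hom:
  assumes "3 \<le> n" "n \<le> m" "x \<in> Obj (gpd C)"
  shows "group_hom (fam C n x) (fam C (n - 1) x) (bdry C n)"
proof -
  have "groupoid_action (gpd C) (fam C n) (action C n)"
    "groupoid_action (gpd C) (fam C (n - 1)) (action C (n - 1))"
    using action_dim[of n] action_dim[of "n - 1"] assms by auto
  then show ?thesis
    using bdry_morphism[OF assms(1,2)] assms(3)
    by (auto simp: group_hom_def group_hom_axioms_def action_morphism_def dest: groupoid_action.fam_group)
qed

lemma bdry_act:
  assumes "3 \<le> n" "n \<le> m" "c \<in> carrier (fam C n x)" "u \<in> arrows (gpd C) x y"
  shows "bdry C n (action C n c u) = action C (n - 1) (bdry C n c) u"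
  using bdry_morphism[OF assms(1,2)] assms(3,4) by (auto simp: action_morphism_def)

end

text \<open>Formulated for any crossed complex with a base point, as it serves twice: for the cover
  of C, where the homotopy stops below dimension m, and for the cover of an extension, where it
  includes dimension m.\<close>

locale contracted_complex = truncated_crossed_complex m C
  for m :: nat and C :: "('o, 'c) crossed_complex" +
  fixes z :: 'o and h0 :: "'o \<Rightarrow> 'c" and h :: "nat \<Rightarrow> 'c \<Rightarrow> 'c"
  assumes z_Obj: "z \<in> Obj (gpd C)" and homotopy: "contracting_homotopy m C z h0 h"
begin

lemma h0_arrow: "x \<in> Obj (gpd C) \<Longrightarrow> h0 x \<in> arrows (gpd C) x z"
  using homotopy by (simp add: contracting_homotopy_def)

lemma h1_closed: "\<lbrakk>2 \<le> m; a \<in> Arr (gpd C)\<rbrakk> \<Longrightarrow> h 1 a \<in> carrier (fam C 2 z)"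
  using homotopy unfolding contracting_homotopy_def homotopy_component_def by fastforce

lemma h1_Cmp:
  "\<lbrakk>2 \<le> m; a \<in> arrows (gpd C) x y; b \<in> arrows (gpd C) y t\<rbrakk> \<Longrightarrow>
   h 1 (Cmp (gpd C) a b) = h 1 a \<otimes>\<^bsub>fam C 2 z\<^esub> h 1 b"
  using homotopy unfolding contracting_homotopy_def homotopy_component_def by fastforce

lemma rhs_1:
  "a \<in> arrows (gpd C) x y \<Longrightarrow>
   homotopy_rhs C z h0 h 1 a = Cmp (gpd C) (Cmp (gpd C) (Inv (gpd C) (h0 x)) a) (h0 y)"
  by (simp add: homotopy_rhs_def arrows_def)

lemma bdry_h:
  "\<lbrakk>1 \<le> n; n < m; c \<in> elems C n\<rbrakk> \<Longrightarrow> bdry C (Suc n) (h n c) = homotopy_rhs C z h0 h n c"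
  using homotopy by (simp add: contracting_homotopy_def)

lemma bdry_h1:
  "\<lbrakk>2 \<le> m; a \<in> arrows (gpd C) x y\<rbrakk> \<Longrightarrow>
   bdry C 2 (h 1 a) = Cmp (gpd C) (Cmp (gpd C) (Inv (gpd C) (h0 x)) a) (h0 y)"
  using bdry_h[of 1 a] rhs_1[of a x y] by (simp add: elems_def arrows_def numeral_2_eq_2)

lemma h_hom: "\<lbrakk>2 \<le> n; n < m; x \<in> Obj (gpd C)\<rbrakk> \<Longrightarrow> h n \<in> hom (fam C n x) (fam C (Suc n) z)"
  using homotopy by (auto simp: contracting_homotopy_def homotopy_component_def)

lemma h_act:
  "\<lbrakk>2 \<le> n; n < m; c \<in> carrier (fam C n x); a \<in> arrows (gpd C) x y\<rbrakk> \<Longrightarrow> h n (action C n c a) = h n c"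
  using homotopy unfolding contracting_homotopy_def homotopy_component_def
  by (metis One_nat_def Suc_1 Suc_leD Suc_n_not_le_n)

text \<open>In dimension 1 an identity arrow is idempotent and so goes to the unit of a group.
  \<open>unit_at\<close> treats this together with the higher dimensions, so that n - 1 and n - 2
  can be substituted without a case distinction.\<close>

lemma h_unit:
  assumes "1 \<le> n" "n < m" "x \<in> Obj (gpd C)"
  shows "h n (unit_at C n x) = \<one>\<^bsub>fam C (Suc n) z\<^esub>"
proof -
  interpret T: group "fam C (Suc n) z"
    using action_dim[of "Suc n"] assms z_Obj by (auto dest: groupoid_action.fam_group)
  show ?thesis
  proof (cases "n = 1")
    case True
    have I: "Idt (gpd C) x \<in> arrows (gpd C) x x" using Idt_closed assms(3) .
    then have "h 1 (Idt (gpd C) x) \<in> carrier (fam C (Suc n) z)"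
      using h1_closed True assms(2) by (simp add: arrows_def numeral_2_eq_2)
    moreover have "h 1 (Idt (gpd C) x) \<otimes>\<^bsub>fam C (Suc n) z\<^esub> h 1 (Idt (gpd C) x) = h 1 (Idt (gpd C) x)"
      using h1_Cmp[OF _ I I] Idt_left[OF I] True assms(2) by (simp add: numeral_2_eq_2)
    ultimately show ?thesis
      using True T.l_cancel_one by (simp add: unit_at_def)
  next
    case False
    then have "group (fam C n x)"
      using action_dim[of n] assms by (auto dest: groupoid_action.fam_group)
    then show ?thesis
      using hom_one[OF h_hom] False assms T.group_axioms by (auto simp: unit_at_def)
  qed
qed

lemma h_bdry_hom:
  assumes n: "2 \<le> n" "n \<le> m" and x: "x \<in> Obj (gpd C)"
  shows "(\<lambda>c. h (n - 1) (bdry C n c)) \<in> hom (fam C n x) (fam C n z)"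
proof (cases "n = 2")
  case True
  then interpret crossed_module "gpd C" "fam C n" "action C n" "bdry C n"
    using dim2 n by simp
  show ?thesis
    using \<mu>_arrow[OF x] \<mu>_mult[OF x] h1_closed h1_Cmp n True
    by (intro homI) (auto simp: arrows_def)
next
  case False
  then have n': "2 \<le> n - 1" "n - 1 < m" and Suc: "Suc (n - 1) = n" using n by auto
  interpret group_hom "fam C n x" "fam C (n - 1) x" "bdry C n"
    using bdry_group_hom False n x by simp
  show ?thesis
    using h_hom[OF n' x] hom_closed Suc by (intro homI) (auto simp: hom_def simp del: One_nat_def)
qed

section \<open>The right-hand side of the homotopy relation: cycles, homomorphism,
  invariance\<close>

lemma rhs_eq:
  assumes "2 \<le> n" "n \<le> m" "x \<in> Obj (gpd C)" "c \<in> carrier (fam C n x)"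
  shows "homotopy_rhs C z h0 h n c =
    inv\<^bsub>fam C n z\<^esub> (h (n - 1) (bdry C n c)) \<otimes>\<^bsub>fam C n z\<^esub> action C n c (h0 x)"
  using base_point_eq[OF assms] assms(1) by (simp add: homotopy_rhs_def)

lemma conjugate_arrow:
  "a \<in> arrows (gpd C) x y \<Longrightarrow>
   Cmp (gpd C) (Cmp (gpd C) (Inv (gpd C) (h0 x)) a) (h0 y) \<in> arrows (gpd C) z z"
  using h0_arrow arrows_Obj by (meson Cmp_closed Inv_closed)

text \<open>In dimension 1 the right-hand side carries an arrow to a loop at z along the chosen
  arrows \<open>h0\<close>. In a product of two such loops the inner \<open>h0 y\<close> and its
  inverse cancel.\<close>

lemma rhs_1_Cmp:
  assumes a: "a \<in> arrows (gpd C) x y" and b: "b \<in> arrows (gpd C) y t"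
  shows "homotopy_rhs C z h0 h 1 (Cmp (gpd C) a b)
    = Cmp (gpd C) (homotopy_rhs C z h0 h 1 a) (homotopy_rhs C z h0 h 1 b)"
proof -
  let ?c = "Cmp (gpd C)" and ?i = "Inv (gpd C)"
  have p: "h0 x \<in> arrows (gpd C) x z" "h0 y \<in> arrows (gpd C) y z" "h0 t \<in> arrows (gpd C) t z"
    using a b arrows_Obj h0_arrow by blast+
  note i = Inv_closed[OF p(1)] Inv_closed[OF p(2)]
  note ia = Cmp_closed[OF i(1) a] and ib = Cmp_closed[OF i(2) b]
  have "?c (?c (?c (?i (h0 x)) a) (h0 y)) (?c (?c (?i (h0 y)) b) (h0 t))
      = ?c (?c (?i (h0 x)) a) (?c (h0 y) (?c (?i (h0 y)) (?c b (h0 t))))"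
    using Cmp_assoc[OF ia p(2) Cmp_closed[OF ib p(3)]] Cmp_assoc[OF i(2) b p(3)] by simp
  also have "\<dots> = ?c (?c (?i (h0 x)) a) (?c b (h0 t))"
    using Cmp_Inv_cancel[OF p(2) Cmp_closed[OF b p(3)]] by simp
  also have "\<dots> = ?c (?c (?i (h0 x)) (?c a b)) (h0 t)"
    using Cmp_assoc[OF ia b p(3)] Cmp_assoc[OF i(1) a b] by simp
  finally show ?thesis
    using rhs_1[OF a] rhs_1[OF b] rhs_1[OF Cmp_closed[OF a b]] by simp
qed

text \<open>Both factors have the same boundary. For n = 2 it is the loop obtained from the boundary
  of c by conjugation with \<open>h0 x\<close>. For n at least 3, the relation in dimension n - 1,
  applied to the boundary of c, loses its first term since a boundary of a boundary is trivial; what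
  remains is that boundary acted on by \<open>h0 x\<close>.\<close>

lemma bdry_rhs:
  assumes n: "2 \<le> n" "n \<le> m" and x: "x \<in> Obj (gpd C)" and c: "c \<in> carrier (fam C n x)"
  shows "bdry C n (homotopy_rhs C z h0 h n c) = unit_at C (n - 1) z"
proof (cases "n = 2")
  case True
  then interpret crossed_module "gpd C" "fam C n" "action C n" "bdry C n"
    using dim2 n by simp
  let ?l = "Cmp (gpd C) (Cmp (gpd C) (Inv (gpd C) (h0 x)) (bdry C n c)) (h0 x)"
  have d: "bdry C n c \<in> arrows (gpd C) x x" using \<mu>_arrow x c .
  have hd: "h 1 (bdry C n c) \<in> carrier (fam C n z)"
    using h1_closed[of "bdry C n c"] d True n by (auto simp: arrows_def)
  have ch: "action C n c (h0 x) \<in> carrier (fam C n z)"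
    using act_closed[OF c h0_arrow[OF x]] .
  interpret Z: group "fam C n z" using fam_group z_Obj .
  have "bdry C n (homotopy_rhs C z h0 h n c) = Cmp (gpd C) (Inv (gpd C) (bdry C n (h 1 (bdry C n c))))
      (bdry C n (action C n c (h0 x)))"
    using rhs_eq[OF n x c] \<mu>_mult[OF z_Obj Z.inv_closed[OF hd] ch] \<mu>_inv[OF z_Obj hd] True by simp
  also have "bdry C n (h 1 (bdry C n c)) = ?l"
    using bdry_h1[OF _ d] True n by simp
  also have "bdry C n (action C n c (h0 x)) = ?l"
    using \<mu>_act[OF c h0_arrow[OF x]] .
  also have "Cmp (gpd C) (Inv (gpd C) ?l) ?l = Idt (gpd C) z"
    using Inv_left[OF conjugate_arrow[OF d]] .
  finally show ?thesis using True by (simp add: unit_at_def)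
next
  case False
  then have n3: "3 \<le> n" and n1: "n - 1 \<noteq> 1" using n by auto
  let ?b = "bdry C n c"
  interpret A: groupoid_action "gpd C" "fam C n" "action C n" using action_dim n .
  interpret B: groupoid_action "gpd C" "fam C (n - 1)" "action C (n - 1)" using action_dim n n3 by simp
  interpret X: group_hom "fam C n x" "fam C (n - 1) x" "bdry C n" using bdry_group_hom n3 n(2) x .
  interpret Z: group_hom "fam C n z" "fam C (n - 1) z" "bdry C n" using bdry_group_hom n3 n(2) z_Obj .
  have b: "?b \<in> carrier (fam C (n - 1) x)" using X.hom_closed[OF c] .
  have bh: "action C (n - 1) ?b (h0 x) \<in> carrier (fam C (n - 1) z)"
    using B.act_closed[OF b h0_arrow[OF x]] .
  have hb: "h (n - 1) ?b \<in> carrier (fam C n z)"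
    using h_bdry_hom[OF n x] c by (auto simp: hom_def)
  have ch: "action C n c (h0 x) \<in> carrier (fam C n z)"
    using A.act_closed[OF c h0_arrow[OF x]] .
  have "?b \<in> elems C (n - 1)"
    using b x n3 by (auto simp: elems_def)
  then have "bdry C n (h (n - 1) ?b) = homotopy_rhs C z h0 h (n - 1) ?b"
    using bdry_h[of "n - 1" ?b] n3 n(2) by simp
  also have "\<dots> = inv\<^bsub>fam C (n - 1) z\<^esub> (h (n - 2) (bdry C (n - 1) ?b)) \<otimes>\<^bsub>fam C (n - 1) z\<^esub>
      action C (n - 1) ?b (h0 x)"
    using rhs_eq[of "n - 1" x ?b] b x n3 n(2) by (simp add: numeral_2_eq_2)
  also have "h (n - 2) (bdry C (n - 1) ?b) = \<one>\<^bsub>fam C (n - 1) z\<^esub>"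
    using bdry_bdry[OF n3 n(2) x c] h_unit[of "n - 2" x] n3 n(2) x by (simp add: Suc_diff_Suc numeral_2_eq_2)
  also have "inv\<^bsub>fam C (n - 1) z\<^esub> \<one>\<^bsub>fam C (n - 1) z\<^esub> \<otimes>\<^bsub>fam C (n - 1) z\<^esub> action C (n - 1) ?b (h0 x)
      = action C (n - 1) ?b (h0 x)"
    using bh by (simp del: One_nat_def)
  finally show ?thesis
    using rhs_eq[OF n x c] bdry_act[OF n3 n(2) c h0_arrow[OF x]] hb ch bh n1
    by (simp add: unit_at_def del: One_nat_def)
qed

lemma rhs_closed:
  assumes n: "2 \<le> n" "n \<le> m" and x: "x \<in> Obj (gpd C)" and c: "c \<in> carrier (fam C n x)"
  shows "homotopy_rhs C z h0 h n c \<in> carrier (fam C n z)"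
proof -
  interpret A: groupoid_action "gpd C" "fam C n" "action C n" using action_dim n .
  interpret Z: group "fam C n z" using A.fam_group z_Obj .
  show ?thesis
    using h_bdry_hom[OF n x] c A.act_closed[OF c h0_arrow[OF x]]
    by (auto simp: rhs_eq[OF n x c] hom_def)
qed

lemma rhs_commute:
  assumes n: "2 \<le> n" "n \<le> m" and x: "x \<in> Obj (gpd C)" and c: "c \<in> carrier (fam C n x)"
    and d: "d \<in> carrier (fam C n z)"
  shows "d \<otimes>\<^bsub>fam C n z\<^esub> homotopy_rhs C z h0 h n c = homotopy_rhs C z h0 h n c \<otimes>\<^bsub>fam C n z\<^esub> d"
proof (cases "n = 2")
  case True
  then interpret crossed_module "gpd C" "fam C n" "action C n" "bdry C n"
    using dim2 n by simp
  show ?thesis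
    using kernel_central[OF z_Obj d rhs_closed[OF n x c]] bdry_rhs[OF n x c] True
    by (simp add: unit_at_def)
next
  case False
  then interpret groupoid_module "gpd C" "fam C n" "action C n"
    using dim_ge3 n by simp
  interpret comm_group "fam C n z" using fam_comm z_Obj .
  show ?thesis using m_comm d rhs_closed[OF n x c] .
qed

text \<open>A quotient of two homomorphisms p and q into a noncommutative group need not be a
  homomorphism. For a product c d, the inverse of p d comes out to the left of the value at c and
  must be moved past it; \<open>rhs_commute\<close> permits this.\<close>

lemma rhs_hom:
  assumes n: "2 \<le> n" "n \<le> m" and x: "x \<in> Obj (gpd C)"
  shows "homotopy_rhs C z h0 h n \<in> hom (fam C n x) (fam C n z)"
proof (rule homI)
  fix c d assume c: "c \<in> carrier (fam C n x)" and d: "d \<in> carrier (fam C n x)"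
  interpret A: groupoid_action "gpd C" "fam C n" "action C n" using action_dim n .
  interpret X: group "fam C n x" using A.fam_group x .
  interpret Z: group "fam C n z" using A.fam_group z_Obj .
  let ?p = "\<lambda>c. h (n - 1) (bdry C n c)" and ?q = "\<lambda>c. action C n c (h0 x)"
  have p: "?p c \<in> carrier (fam C n z)" "?p d \<in> carrier (fam C n z)"
    "?p (c \<otimes>\<^bsub>fam C n x\<^esub> d) = ?p c \<otimes>\<^bsub>fam C n z\<^esub> ?p d"
    using h_bdry_hom[OF n x] c d by (auto simp: hom_def)
  have q: "?q c \<in> carrier (fam C n z)" "?q d \<in> carrier (fam C n z)"
    "?q (c \<otimes>\<^bsub>fam C n x\<^esub> d) = ?q c \<otimes>\<^bsub>fam C n z\<^esub> ?q d"
    using A.act_hom[OF h0_arrow[OF x]] c d by (auto simp: hom_def)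
  have "homotopy_rhs C z h0 h n (c \<otimes>\<^bsub>fam C n x\<^esub> d)
      = inv\<^bsub>fam C n z\<^esub> ?p d \<otimes>\<^bsub>fam C n z\<^esub> (inv\<^bsub>fam C n z\<^esub> ?p c \<otimes>\<^bsub>fam C n z\<^esub> ?q c) \<otimes>\<^bsub>fam C n z\<^esub> ?q d"
    using p q rhs_eq[OF n x X.m_closed[OF c d]] by (simp add: Z.inv_mult_group Z.m_assoc)
  also have "\<dots> = (inv\<^bsub>fam C n z\<^esub> ?p c \<otimes>\<^bsub>fam C n z\<^esub> ?q c) \<otimes>\<^bsub>fam C n z\<^esub> (inv\<^bsub>fam C n z\<^esub> ?p d \<otimes>\<^bsub>fam C n z\<^esub> ?q d)"
    using p q rhs_commute[OF n x c Z.inv_closed[OF p(2)]] rhs_eq[OF n x c] by (simp add: Z.m_assoc)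
  finally show "homotopy_rhs C z h0 h n (c \<otimes>\<^bsub>fam C n x\<^esub> d)
      = homotopy_rhs C z h0 h n c \<otimes>\<^bsub>fam C n z\<^esub> homotopy_rhs C z h0 h n d"
    using rhs_eq[OF n x c] rhs_eq[OF n x d] by simp
qed (rule rhs_closed[OF n x])

text \<open>The path a followed by \<open>h0 y\<close> equals \<open>h0 x\<close> followed by a loop
  at z, and by the relation in dimension 1 that loop is the boundary of
  \<open>h 1 a\<close>.\<close>

lemma action_h0:
  assumes n: "2 \<le> n" "n \<le> m" and c: "c \<in> carrier (fam C n x)" and a: "a \<in> arrows (gpd C) x y"
  shows "action C n (action C n c a) (h0 y) = action C n (action C n c (h0 x)) (bdry C 2 (h 1 a))"
proof -
  interpret A: groupoid_action "gpd C" "fam C n" "action C n" using action_dim n .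
  have p: "h0 x \<in> arrows (gpd C) x z" "h0 y \<in> arrows (gpd C) y z"
    using a arrows_Obj h0_arrow by blast+
  let ?l = "Cmp (gpd C) (Cmp (gpd C) (Inv (gpd C) (h0 x)) a) (h0 y)"
  have "Cmp (gpd C) (h0 x) ?l = Cmp (gpd C) a (h0 y)"
    using Cmp_assoc[OF Inv_closed[OF p(1)] a p(2)] Cmp_Inv_cancel[OF p(1) Cmp_closed[OF a p(2)]] by simp
  then show ?thesis
    using A.act_Cmp[OF c p(1) conjugate_arrow[OF a]] A.act_Cmp[OF c a p(2)] bdry_h1[OF _ a] n by simp
qed

text \<open>For n = 2 let e be \<open>h 1 a\<close>. The first factor is conjugated by e because h
  preserves composition, the second by \<open>action_h0\<close> and the Peiffer identity. So the
  whole value is conjugated by e, and it is central. For n at least 3 neither factor changes: h is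
  invariant, and boundaries from dimension 2 act trivially.\<close>

lemma rhs_act:
  assumes n: "2 \<le> n" "n \<le> m" and c: "c \<in> carrier (fam C n x)" and a: "a \<in> arrows (gpd C) x y"
  shows "homotopy_rhs C z h0 h n (action C n c a) = homotopy_rhs C z h0 h n c"
proof -
  interpret A: groupoid_action "gpd C" "fam C n" "action C n" using action_dim n .
  interpret Z: group "fam C n z" using A.fam_group z_Obj .
  have x: "x \<in> Obj (gpd C)" and y: "y \<in> Obj (gpd C)" using a arrows_Obj by blast+
  have ca: "action C n c a \<in> carrier (fam C n y)" using A.act_closed[OF c a] .
  have ch: "action C n c (h0 x) \<in> carrier (fam C n z)" using A.act_closed[OF c h0_arrow[OF x]] .
  have h1a: "h 1 a \<in> carrier (fam C 2 z)" using h1_closed n a by (simp add: arrows_def)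
  show ?thesis
  proof (cases "n = 2")
    case True
    then interpret crossed_module "gpd C" "fam C n" "action C n" "bdry C n"
      using dim2 n by simp
    let ?d = "bdry C n c" and ?e = "h 1 a"
    let ?r = "homotopy_rhs C z h0 h n c"
    note e = h1a[folded True]
    have d: "?d \<in> arrows (gpd C) x x" using \<mu>_arrow x c .
    note ia = Inv_closed[OF a]
    have hd: "h 1 ?d \<in> carrier (fam C n z)" "h 1 (Inv (gpd C) a) \<in> carrier (fam C n z)"
      using h1_closed[of ?d] h1_closed[of "Inv (gpd C) a"] d ia True n by (auto simp: arrows_def)
    have "h 1 (Inv (gpd C) a) \<otimes>\<^bsub>fam C n z\<^esub> ?e = \<one>\<^bsub>fam C n z\<^esub>"
      using h1_Cmp[OF _ ia a] Inv_left[OF a] h_unit[of 1 y] y n True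
      by (simp add: unit_at_def numeral_2_eq_2)
    then have inv: "h 1 (Inv (gpd C) a) = inv\<^bsub>fam C n z\<^esub> ?e"
      using Z.inv_equality[OF _ e hd(2)] by simp
    have "h 1 (bdry C n (action C n c a)) = inv\<^bsub>fam C n z\<^esub> ?e \<otimes>\<^bsub>fam C n z\<^esub> h 1 ?d \<otimes>\<^bsub>fam C n z\<^esub> ?e"
      using \<mu>_act[OF c a] h1_Cmp[OF _ Cmp_closed[OF ia d] a] h1_Cmp[OF _ ia d] inv n True by simp
    moreover have "action C n (action C n c a) (h0 y)
        = inv\<^bsub>fam C n z\<^esub> ?e \<otimes>\<^bsub>fam C n z\<^esub> action C n c (h0 x) \<otimes>\<^bsub>fam C n z\<^esub> ?e"
      using action_h0[OF n c a] peiffer[OF z_Obj ch e] True by simp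
    ultimately have "homotopy_rhs C z h0 h n (action C n c a)
        = inv\<^bsub>fam C n z\<^esub> ?e \<otimes>\<^bsub>fam C n z\<^esub> (inv\<^bsub>fam C n z\<^esub> (h 1 ?d) \<otimes>\<^bsub>fam C n z\<^esub> action C n c (h0 x)) \<otimes>\<^bsub>fam C n z\<^esub> ?e"
      using rhs_eq[OF n y ca] True Z.conjugate_quotient[OF e hd(1) ch] by simp
    also have "inv\<^bsub>fam C n z\<^esub> (h 1 ?d) \<otimes>\<^bsub>fam C n z\<^esub> action C n c (h0 x) = ?r"
      using rhs_eq[OF n x c] True by simp
    also have "inv\<^bsub>fam C n z\<^esub> ?e \<otimes>\<^bsub>fam C n z\<^esub> ?r \<otimes>\<^bsub>fam C n z\<^esub> ?e = ?r"
      using rhs_commute[OF n x c Z.inv_closed[OF e]] e rhs_closed[OF n x c] by (simp add: Z.m_assoc)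
    finally show ?thesis .
  next
    case False
    then have n3: "3 \<le> n" using n by simp
    interpret X: group_hom "fam C n x" "fam C (n - 1) x" "bdry C n" using bdry_group_hom n3 n(2) x .
    have "h (n - 1) (bdry C n (action C n c a)) = h (n - 1) (bdry C n c)"
      using bdry_act[OF n3 n(2) c a] h_act[OF _ _ X.hom_closed[OF c] a] n3 n(2) by simp
    moreover have "action C n (action C n c a) (h0 y) = action C n c (h0 x)"
      using action_h0[OF n c a] bdry2_trivial_action[OF n3 n(2) z_Obj ch h1a] by simp
    ultimately show ?thesis
      using rhs_eq[OF n y ca] rhs_eq[OF n x c] by simp
  qed
qed

section \<open>Exactness at the base point of a contracted complex\<close>

lemma kernel_subset_image:
  assumes n: "2 \<le> n" "n < m"
  shows "bdry_kernel C n z \<subseteq> bdry C (Suc n) ` carrier (fam C (Suc n) z)"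
proof
  fix c assume c: "c \<in> bdry_kernel C n z"
  interpret A: groupoid_action "gpd C" "fam C n" "action C n" using action_dim n by simp
  interpret Z: group "fam C n z" using A.fam_group z_Obj .
  have cz: "c \<in> carrier (fam C n z)" and dc: "bdry C n c = unit_at C (n - 1) z"
    using c by (auto simp: bdry_kernel_def)
  note p = h0_arrow[OF z_Obj]
  \<comment> \<open>\<open>h0 z\<close> is a loop at z that need not be an identity; the inverse
    cancels the action by \<open>h0 z\<close> in the relation and keeps c' a cycle.\<close>
  define c' where "c' = action C n c (Inv (gpd C) (h0 z))"
  have c': "c' \<in> carrier (fam C n z)"
    using A.act_closed[OF cz Inv_closed[OF p]] by (simp add: c'_def)
  have "bdry C n c' = unit_at C (n - 1) z"
  proof (cases "n = 2")
    case True
    then interpret crossed_module "gpd C" "fam C n" "action C n" "bdry C n"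
      using dim2 n by simp
    have "bdry C n c' = Cmp (gpd C) (Cmp (gpd C) (Inv (gpd C) (Inv (gpd C) (h0 z))) (Idt (gpd C) z)) (Inv (gpd C) (h0 z))"
      using \<mu>_act[OF cz Inv_closed[OF p]] dc True by (simp add: c'_def unit_at_def)
    then show ?thesis
      using Inv_Inv[OF p] Idt_right[OF p] Inv_right[OF p] True by (simp add: unit_at_def)
  next
    case False
    then interpret B: groupoid_action "gpd C" "fam C (n - 1)" "action C (n - 1)" using action_dim n by simp
    show ?thesis
      using bdry_act[OF _ _ cz Inv_closed[OF p]] B.act_one[OF Inv_closed[OF p]] dc False n
      by (auto simp: c'_def unit_at_def)
  qed
  then have "h (n - 1) (bdry C n c') = \<one>\<^bsub>fam C n z\<^esub>"
    using h_unit[of "n - 1" z] n z_Obj by simp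
  then have "homotopy_rhs C z h0 h n c' = c"
    using rhs_eq[OF _ _ z_Obj c'] A.act_Inv_act[OF cz p] n cz by (simp add: c'_def)
  moreover have "c' \<in> elems C n"
    using c' z_Obj n by (auto simp: elems_def)
  ultimately have "c = bdry C (Suc n) (h n c')"
    using bdry_h[of n c'] n by simp
  moreover have "h n c' \<in> carrier (fam C (Suc n) z)"
    using h_hom[OF n z_Obj] c' by (auto simp: hom_def)
  ultimately show "c \<in> bdry C (Suc n) ` carrier (fam C (Suc n) z)" by blast
qed

text \<open>Conjugating a loop a in the opposite direction gives a loop whose homotopy right-hand
  side is a, so a is a boundary. In the universal cover the loops at 1 are the elements of the
  kernel of \<phi>, which yields exactness in dimension 1.\<close>

lemma loops_subset_image:
  assumes "2 \<le> m"
  shows "arrows (gpd C) z z \<subseteq> bdry C 2 ` carrier (fam C 2 z)"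
proof
  fix a assume a: "a \<in> arrows (gpd C) z z"
  note p = h0_arrow[OF z_Obj]
  let ?b = "Cmp (gpd C) (h0 z) (Cmp (gpd C) a (Inv (gpd C) (h0 z)))"
  note ai = Cmp_closed[OF a Inv_closed[OF p]]
  have b: "?b \<in> arrows (gpd C) z z" using Cmp_closed[OF p ai] .
  have "bdry C 2 (h 1 ?b) = Cmp (gpd C) (Cmp (gpd C) a (Inv (gpd C) (h0 z))) (h0 z)"
    using bdry_h1[OF assms b] Inv_Cmp_cancel[OF p ai] by simp
  also have "\<dots> = a"
    using Cmp_assoc[OF a Inv_closed[OF p] p] Inv_left[OF p] Idt_right[OF a] by simp
  finally show "a \<in> bdry C 2 ` carrier (fam C 2 z)"
    using h1_closed[OF assms, of ?b] b by (auto simp: arrows_def intro: rev_image_eqI)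
qed

end


section \<open>Universal covers\<close>

text \<open>Exactness is left out so that the covering construction is available for an extension of
  C before that extension is known to be a resolution.\<close>

locale one_point_complex = truncated_crossed_complex m C
  for m :: nat and C :: "('o, 'c) crossed_complex" +
  fixes G :: "'g monoid" and \<phi> :: "'c \<Rightarrow> 'g"
  assumes point: "Obj (gpd C) = {the_point C}" and group_G: "group G"
    and \<phi>_hom: "\<phi> \<in> hom (vertex_group (gpd C) (the_point C)) G"
begin

abbreviation pt :: 'o where "pt \<equiv> the_point C"

abbreviation D :: "('g, 'g \<times> 'c) crossed_complex" where "D \<equiv> universal_cover G \<phi> C"

lemma pt_Obj: "pt \<in> Obj (gpd C)"
  using point by simp

lemma arrows_pt: "x \<in> Obj (gpd C) \<Longrightarrow> y \<in> Obj (gpd C) \<Longrightarrow> arrows (gpd C) x y = Arr (gpd C)"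
  using point Src_closed Tgt_closed by (auto simp: arrows_def)

lemma arrows_eq: "arrows (gpd C) pt pt = Arr (gpd C)"
  using arrows_pt pt_Obj by blast

lemma \<phi>_closed: "u \<in> Arr (gpd C) \<Longrightarrow> \<phi> u \<in> carrier G"
  using \<phi>_hom by (auto simp: hom_def vertex_group_def arrows_eq)

lemma \<phi>_Cmp: "\<lbrakk>u \<in> Arr (gpd C); v \<in> Arr (gpd C)\<rbrakk> \<Longrightarrow> \<phi> (Cmp (gpd C) u v) = \<phi> u \<otimes>\<^bsub>G\<^esub> \<phi> v"
  using \<phi>_hom by (auto simp: hom_def vertex_group_def arrows_eq)

lemma \<phi>_group_hom: "group_hom (vertex_group (gpd C) pt) G \<phi>"
  using group_vertex_group[OF pt_Obj] group_G \<phi>_hom by (simp add: group_hom_def group_hom_axioms_def)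

lemma \<phi>_Idt: "\<phi> (Idt (gpd C) pt) = \<one>\<^bsub>G\<^esub>"
  using group_hom.hom_one[OF \<phi>_group_hom] by (simp add: vertex_group_def)

lemma \<phi>_Inv: "u \<in> Arr (gpd C) \<Longrightarrow> \<phi> (Inv (gpd C) u) = inv\<^bsub>G\<^esub> (\<phi> u)"
  using group_hom.hom_inv[OF \<phi>_group_hom, of u] inv_vertex_group[of u pt]
  by (simp add: vertex_group_def arrows_eq)

lemma kernel_\<phi>: "kernel (vertex_group (gpd C) pt) G \<phi> = {u \<in> Arr (gpd C). \<phi> u = \<one>\<^bsub>G\<^esub>}"
  by (simp add: kernel_def vertex_group_def arrows_eq)

section \<open>Structure maps of the universal cover\<close>

lemma cover_Obj [simp]: "Obj (gpd D) = carrier G"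
  by (simp add: universal_cover_def)

lemma cover_Arr [simp]: "Arr (gpd D) = carrier G \<times> Arr (gpd C)"
  by (simp add: universal_cover_def)

lemma cover_Cmp [simp]: "Cmp (gpd D) (g, u) (g', v) = (g, Cmp (gpd C) u v)"
  by (simp add: universal_cover_def)

lemma cover_Idt [simp]: "Idt (gpd D) g = (g, Idt (gpd C) pt)"
  by (simp add: universal_cover_def)

lemma cover_Inv [simp]: "Inv (gpd D) (g, u) = (g \<otimes>\<^bsub>G\<^esub> \<phi> u, Inv (gpd C) u)"
  by (simp add: universal_cover_def)

lemma cover_Src [simp]: "Src (gpd D) (g, u) = g"
  by (simp add: universal_cover_def)

lemma cover_Tgt [simp]: "Tgt (gpd D) (g, u) = g \<otimes>\<^bsub>G\<^esub> \<phi> u"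
  by (simp add: universal_cover_def)

lemma cover_carrier [simp]: "carrier (fam D n g) = {g} \<times> carrier (fam C n pt)"
  by (simp add: universal_cover_def)

lemma cover_mult [simp]: "(a, c) \<otimes>\<^bsub>fam D n g\<^esub> (a', d) = (g, c \<otimes>\<^bsub>fam C n pt\<^esub> d)"
  by (simp add: universal_cover_def)

lemma cover_one [simp]: "\<one>\<^bsub>fam D n g\<^esub> = (g, \<one>\<^bsub>fam C n pt\<^esub>)"
  by (simp add: universal_cover_def)

lemma cover_action [simp]: "action D n (g, c) (g', u) = (g \<otimes>\<^bsub>G\<^esub> \<phi> u, action C n c u)"
  by (simp add: universal_cover_def)

lemma cover_bdry [simp]: "bdry D n (g, c) = (g, bdry C n c)"
  by (simp add: universal_cover_def)

lemma cover_arrows: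
  "arrows (gpd D) g g' = {(g, u) | u. u \<in> Arr (gpd C) \<and> g \<in> carrier G \<and> g' = g \<otimes>\<^bsub>G\<^esub> \<phi> u}"
  by (auto simp: arrows_def)

section \<open>The axioms of a crossed complex for the universal cover\<close>

lemma groupoid_cover: "groupoid (gpd D)"
proof -
  interpret group G by (rule group_G)
  note arr = Cmp_closed[of _ pt pt _ pt, unfolded arrows_eq] Inv_closed[of _ pt pt, unfolded arrows_eq]
    Idt_closed[OF pt_Obj, unfolded arrows_eq]
  show ?thesis
    by (rule groupoid.intro)
      (auto simp: cover_arrows \<phi>_closed \<phi>_Cmp \<phi>_Idt \<phi>_Inv m_assoc arr
        Cmp_assoc[of _ pt pt _ pt _ pt, unfolded arrows_eq]
        Idt_left[of _ pt pt, unfolded arrows_eq] Idt_right[of _ pt pt, unfolded arrows_eq]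
        Inv_left[of _ pt pt, unfolded arrows_eq] Inv_right[of _ pt pt, unfolded arrows_eq])
qed

lemma group_cover:
  assumes "group (fam C n pt)"
  shows "group (fam D n g)"
proof -
  interpret group "fam C n pt" by fact
  have "\<exists>d\<in>carrier (fam C n pt). d \<otimes>\<^bsub>fam C n pt\<^esub> c = \<one>\<^bsub>fam C n pt\<^esub>" if "c \<in> carrier (fam C n pt)" for c
    using that l_inv by blast
  then show ?thesis
    by (intro groupI) (auto simp: m_assoc)
qed

lemma inv_cover:
  assumes "group (fam C n pt)" "c \<in> carrier (fam C n pt)"
  shows "inv\<^bsub>fam D n g\<^esub> (g, c) = (g, inv\<^bsub>fam C n pt\<^esub> c)"
  using assms by (intro group.inv_equality[OF group_cover]) (auto simp: group.l_inv)

lemma groupoid_action_cover: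
  assumes "groupoid_action (gpd C) (fam C n) (action C n)"
  shows "groupoid_action (gpd D) (fam D n) (action D n)"
proof -
  interpret A: groupoid_action "gpd C" "fam C n" "action C n" by fact
  interpret G: group G by (rule group_G)
  show ?thesis
  proof (intro groupoid_action.intro groupoid_cover groupoid_action_axioms.intro)
    show "group (fam D n g)" for g
      using group_cover A.fam_group pt_Obj by blast
    show "disjoint_family_on (\<lambda>g. carrier (fam D n g)) (Obj (gpd D))"
      by (auto simp: disjoint_family_on_def)
  qed (auto simp: cover_arrows \<phi>_Cmp \<phi>_Idt \<phi>_closed G.m_assoc A.act_Idt[OF pt_Obj]
        A.act_closed[of _ pt _ pt, unfolded arrows_eq] A.act_mult[of _ pt _ _ pt, unfolded arrows_eq]
        A.act_Cmp[of _ pt _ pt _ pt, unfolded arrows_eq])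
qed

text \<open>The lifted boundary of c at g is an arrow from g to g multiplied by the \<phi>-image of
  the boundary of c. It is a loop precisely because \<phi> kills boundaries.\<close>

lemma crossed_module_cover:
  assumes "crossed_module (gpd C) (fam C 2) (action C 2) (bdry C 2)"
    and triv: "\<And>c. c \<in> carrier (fam C 2 pt) \<Longrightarrow> \<phi> (bdry C 2 c) = \<one>\<^bsub>G\<^esub>"
  shows "crossed_module (gpd D) (fam D 2) (action D 2) (bdry D 2)"
proof -
  interpret A: crossed_module "gpd C" "fam C 2" "action C 2" "bdry C 2" by fact
  interpret G: group G by (rule group_G)
  note arrow = A.\<mu>_arrow[OF pt_Obj, unfolded arrows_eq]
  show ?thesis
  proof (intro crossed_module.intro crossed_module_axioms.intro)
    show "groupoid_action (gpd D) (fam D 2) (action D 2)"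
      using groupoid_action_cover A.groupoid_action_axioms .
    show "bdry D 2 \<in> hom (fam D 2 g) (vertex_group (gpd D) g)" if "g \<in> Obj (gpd D)" for g
      using that by (auto simp: hom_def vertex_group_def cover_arrows arrow triv A.\<mu>_mult[OF pt_Obj])
    show "bdry D 2 (action D 2 c u) = Cmp (gpd D) (Cmp (gpd D) (Inv (gpd D) u) (bdry D 2 c)) u"
      if "c \<in> carrier (fam D 2 g)" "u \<in> arrows (gpd D) g g'" for c u g g'
      using that by (auto simp: cover_arrows A.\<mu>_act[of _ pt _ pt, unfolded arrows_eq])
    show "inv\<^bsub>fam D 2 g\<^esub> d \<otimes>\<^bsub>fam D 2 g\<^esub> c \<otimes>\<^bsub>fam D 2 g\<^esub> d = action D 2 c (bdry D 2 d)"
      if "g \<in> Obj (gpd D)" "c \<in> carrier (fam D 2 g)" "d \<in> carrier (fam D 2 g)" for c d g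
      using that A.peiffer[OF pt_Obj] by (auto simp: inv_cover[OF A.fam_group[OF pt_Obj]] triv)
  qed
qed

lemma groupoid_module_cover:
  assumes "groupoid_module (gpd C) (fam C n) (action C n)"
  shows "groupoid_module (gpd D) (fam D n) (action D n)"
proof -
  interpret A: groupoid_module "gpd C" "fam C n" "action C n" by fact
  interpret U: groupoid_action "gpd D" "fam D n" "action D n"
    using groupoid_action_cover A.groupoid_action_axioms .
  interpret X: comm_group "fam C n pt" using A.fam_comm[OF pt_Obj] .
  show ?thesis
  proof (intro groupoid_module.intro U.groupoid_action_axioms groupoid_module_axioms.intro)
    show "comm_group (fam D n g)" if "g \<in> Obj (gpd D)" for g
      by (rule group.group_comm_groupI[OF U.fam_group[OF that]]) (auto simp: X.m_comm)
  qed
qed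

lemma truncated_crossed_complex_cover:
  assumes triv: "\<And>c. \<lbrakk>2 \<le> m; c \<in> carrier (fam C 2 pt)\<rbrakk> \<Longrightarrow> \<phi> (bdry C 2 c) = \<one>\<^bsub>G\<^esub>"
  shows "truncated_crossed_complex m D"
proof -
  interpret G: group G by (rule group_G)
  show ?thesis
  proof (rule truncated_crossed_complex.intro)
    show "crossed_module (gpd D) (fam D 2) (action D 2) (bdry D 2)" if "2 \<le> m"
      using crossed_module_cover dim2 triv that by blast
    show "groupoid_module (gpd D) (fam D n) (action D n)" if "3 \<le> n" "n \<le> m" for n
      using groupoid_module_cover dim_ge3 that by blast
    show "action_morphism (gpd D) (fam D n) (action D n) (fam D (n - 1)) (action D (n - 1)) (bdry D n)"
      if n: "3 \<le> n" "n \<le> m" for n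
    proof -
      interpret group_hom "fam C n pt" "fam C (n - 1) pt" "bdry C n"
        using bdry_group_hom n pt_Obj .
      show ?thesis
        using hom_closed by (auto simp: action_morphism_def hom_def cover_arrows bdry_act[OF n, of _ pt _ pt, unfolded arrows_eq] simp del: One_nat_def)
    qed
    show "bdry D (n - 1) (bdry D n c) = unit_at D (n - 2) g"
      if "3 \<le> n" "n \<le> m" "g \<in> Obj (gpd D)" "c \<in> carrier (fam D n g)" for n g c
      using that bdry_bdry[OF that(1,2) pt_Obj] by (auto simp: unit_at_def)
    show "action D n c (bdry D 2 b) = c"
      if n: "3 \<le> n" "n \<le> m" and "g \<in> Obj (gpd D)" "c \<in> carrier (fam D n g)" "b \<in> carrier (fam D 2 g)"
      for n g b c
      using that triv bdry2_trivial_action[OF n pt_Obj] by auto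
  qed (rule groupoid_cover)
qed

lemma cover_kernel: "(g, c) \<in> bdry_kernel D n g \<longleftrightarrow> c \<in> bdry_kernel C n pt"
  by (auto simp: bdry_kernel_def unit_at_def)

end


section \<open>Kernels, equalizers and trivial actions\<close>

text \<open>With f the new boundary and K the cycles, this reduces the claim that boundaries are
  cycles to the generators.\<close>

lemma closed_subfamily_preimage:
  assumes "\<And>x. x \<in> Obj \<Phi> \<Longrightarrow> group (M x)" "\<And>x. x \<in> Obj \<Phi> \<Longrightarrow> group (N x)"
    and act: "\<And>x y c u. \<lbrakk>c \<in> carrier (M x); u \<in> arrows \<Phi> x y; x \<in> Obj \<Phi>\<rbrakk> \<Longrightarrow> act c u \<in> carrier (M y)"
    and f: "action_morphism \<Phi> M act N act' f" and K: "closed_subfamily \<Phi> N act' K"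
    and Obj: "\<And>x y u. u \<in> arrows \<Phi> x y \<Longrightarrow> x \<in> Obj \<Phi>"
  shows "closed_subfamily \<Phi> M act {c. f c \<in> K}"
  unfolding closed_subfamily_def
proof (intro conjI ballI allI)
  fix x assume x: "x \<in> Obj \<Phi>"
  interpret group_hom "M x" "N x" f
    using assms(1,2)[OF x] f x by (simp add: group_hom_def group_hom_axioms_def action_morphism_def)
  interpret K: subgroup "K \<inter> carrier (N x)" "N x"
    using K x by (simp add: closed_subfamily_def)
  show "subgroup ({c. f c \<in> K} \<inter> carrier (M x)) (M x)"
    by (rule subgroup.intro) (use K.one_closed K.m_closed K.m_inv_closed hom_one in auto)
next
  fix x y c u assume c: "c \<in> {c. f c \<in> K} \<inter> carrier (M x)" and u: "u \<in> arrows \<Phi> x y"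
  then have "f c \<in> carrier (N x)"
    using f Obj[OF u] by (auto simp: action_morphism_def hom_def)
  then show "act c u \<in> {c. f c \<in> K}"
    using f K c u by (auto simp: action_morphism_def closed_subfamily_def)
qed

text \<open>The family N carries no action; the last hypothesis only asks that agreement persist
  along arrows. This fits invariant maps into one fibre as well as morphisms compatible with an
  action.\<close>

lemma closed_subfamily_equalizer:
  assumes M: "groupoid_action \<Phi> M act"
    and N: "\<And>x. x \<in> Obj \<Phi> \<Longrightarrow> group (N x)"
    and f: "\<And>x. x \<in> Obj \<Phi> \<Longrightarrow> f \<in> hom (M x) (N x)" and f': "\<And>x. x \<in> Obj \<Phi> \<Longrightarrow> f' \<in> hom (M x) (N x)"
    and act: "\<And>x y c u. \<lbrakk>c \<in> carrier (M x); u \<in> arrows \<Phi> x y; f c = f' c\<rbrakk> \<Longrightarrow> f (act c u) = f' (act c u)"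
  shows "closed_subfamily \<Phi> M act {c. f c = f' c}"
  unfolding closed_subfamily_def
proof (intro conjI ballI allI)
  interpret groupoid_action \<Phi> M act by fact
  fix x assume x: "x \<in> Obj \<Phi>"
  interpret F: group_hom "M x" "N x" f
    using fam_group N f x by (simp add: group_hom_def group_hom_axioms_def)
  interpret F': group_hom "M x" "N x" f'
    using fam_group N f' x by (simp add: group_hom_def group_hom_axioms_def)
  show "subgroup ({c. f c = f' c} \<inter> carrier (M x)) (M x)"
    by (rule subgroup.intro) (use F.hom_one F'.hom_one in auto)
qed (use act in auto)

text \<open>The comparison goes through generation by X rather than through the uniqueness clause of
  \<open>free_groupoid_on\<close>, so K may have elements of any type.\<close>

lemma free_groupoid_unique:
  assumes free: "free_groupoid_on \<Phi> X" and K: "group K"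
    and f: "\<And>a. a \<in> Arr \<Phi> \<Longrightarrow> f a \<in> carrier K" "\<And>a. a \<in> Arr \<Phi> \<Longrightarrow> f' a \<in> carrier K"
    and Cmp: "\<And>x y z a b. \<lbrakk>a \<in> arrows \<Phi> x y; b \<in> arrows \<Phi> y z\<rbrakk> \<Longrightarrow> f (Cmp \<Phi> a b) = f a \<otimes>\<^bsub>K\<^esub> f b"
      "\<And>x y z a b. \<lbrakk>a \<in> arrows \<Phi> x y; b \<in> arrows \<Phi> y z\<rbrakk> \<Longrightarrow> f' (Cmp \<Phi> a b) = f' a \<otimes>\<^bsub>K\<^esub> f' b"
    and eq: "\<And>a. a \<in> X \<Longrightarrow> f a = f' a" and a: "a \<in> Arr \<Phi>"
  shows "f a = f' a"
proof -
  interpret groupoid \<Phi> using free by (simp add: free_groupoid_on_def)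
  interpret K: group K by fact
  \<comment> \<open>Stated for an arbitrary multiplicative g, to be applied to f and to f'.\<close>
  have Idt: "g (Idt \<Phi> x) = \<one>\<^bsub>K\<^esub>" and Inv: "a \<in> arrows \<Phi> x y \<Longrightarrow> g (Inv \<Phi> a) = inv\<^bsub>K\<^esub> g a"
    if x: "x \<in> Obj \<Phi>" and g: "\<And>a. a \<in> Arr \<Phi> \<Longrightarrow> g a \<in> carrier K"
      "\<And>x y z a b. \<lbrakk>a \<in> arrows \<Phi> x y; b \<in> arrows \<Phi> y z\<rbrakk> \<Longrightarrow> g (Cmp \<Phi> a b) = g a \<otimes>\<^bsub>K\<^esub> g b" for g x y a
  proof -
    have one: "g (Idt \<Phi> x) = \<one>\<^bsub>K\<^esub>" if "x \<in> Obj \<Phi>" for x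
    proof -
      note I = Idt_closed[OF that]
      have "g (Idt \<Phi> x) \<otimes>\<^bsub>K\<^esub> g (Idt \<Phi> x) = g (Idt \<Phi> x)"
        using g(2)[OF I I] Idt_left[OF I] by simp
      then show ?thesis
        using g(1)[of "Idt \<Phi> x"] I K.l_cancel_one by (simp add: arrows_def)
    qed
    then show "g (Idt \<Phi> x) = \<one>\<^bsub>K\<^esub>" using x .
    assume a: "a \<in> arrows \<Phi> x y"
    note i = Inv_closed[OF a]
    have "g (Inv \<Phi> a) \<otimes>\<^bsub>K\<^esub> g a = \<one>\<^bsub>K\<^esub>"
      using g(2)[OF i a] Inv_left[OF a] one arrows_Obj[OF a] by simp
    then show "g (Inv \<Phi> a) = inv\<^bsub>K\<^esub> g a"
      using K.inv_equality[of "g (Inv \<Phi> a)" "g a"] g(1) a i by (simp add: arrows_def)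
  qed
  have "Arr \<Phi> \<subseteq> {a \<in> Arr \<Phi>. f a = f' a}"
  proof (rule free_groupoid_generated[OF free])
    show "X \<subseteq> {a \<in> Arr \<Phi>. f a = f' a}"
      using eq free by (auto simp: free_groupoid_on_def)
    show "Idt \<Phi> x \<in> {a \<in> Arr \<Phi>. f a = f' a}" if "x \<in> Obj \<Phi>" for x
      using Idt[OF that f(1) Cmp(1)] Idt[OF that f(2) Cmp(2)] Idt_closed[OF that]
      by (simp add: arrows_def)
    show "Cmp \<Phi> a b \<in> {a \<in> Arr \<Phi>. f a = f' a}"
      if "a \<in> {a \<in> Arr \<Phi>. f a = f' a}" "b \<in> {a \<in> Arr \<Phi>. f a = f' a}"
        "a \<in> arrows \<Phi> x y" "b \<in> arrows \<Phi> y z" for a b x y z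
      using Cmp(1)[OF that(3,4)] Cmp(2)[OF that(3,4)] Cmp_closed[OF that(3,4)] that(1,2)
      by (simp add: arrows_def)
    show "Inv \<Phi> a \<in> {a \<in> Arr \<Phi>. f a = f' a}" if a: "a \<in> {a \<in> Arr \<Phi>. f a = f' a}" for a
    proof -
      have A: "a \<in> arrows \<Phi> (Src \<Phi> a) (Tgt \<Phi> a)" using a Arr_arrows by simp
      show ?thesis
        using Inv[OF arrows_Obj(1)[OF A] f(1) Cmp(1) A] Inv[OF arrows_Obj(1)[OF A] f(2) Cmp(2) A]
          Inv_closed[OF A] a by (simp add: arrows_def)
    qed
  qed auto
  then show ?thesis using a by blast
qed

text \<open>An invariant homomorphism \<open>M \<rightarrow> A\<close> is not a morphism of crossed modules over \<open>\<Phi>\<close>. It becomes the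
  second component of one into \<open>M \<times> A\<close>, whose boundary and action ignore \<open>A\<close>.\<close>

lemma groupoid_action_times:
  assumes "groupoid_action \<Phi> M act" "group A"
  shows "groupoid_action \<Phi> (\<lambda>x. M x \<times>\<times> A) (\<lambda>(c, e) u. (act c u, e))"
proof -
  interpret groupoid_action \<Phi> M act by fact
  show ?thesis
  proof (intro groupoid_action.intro groupoid_axioms groupoid_action_axioms.intro)
    show "disjoint_family_on (\<lambda>x. carrier (M x \<times>\<times> A)) (Obj \<Phi>)"
      using fam_disjoint by (fastforce simp: disjoint_family_on_def DirProd_def)
    show "group (M x \<times>\<times> A)" if "x \<in> Obj \<Phi>" for x
      using DirProd_group fam_group[OF that] assms(2) .
    show "(case c of (c, e) \<Rightarrow> \<lambda>u. (act c u, e)) u \<in> carrier (M y \<times>\<times> A)"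
      if "c \<in> carrier (M x \<times>\<times> A)" "u \<in> arrows \<Phi> x y" for c u x y
      using that act_closed[OF _ that(2)] by (auto simp: DirProd_def)
    show "(case c \<otimes>\<^bsub>M x \<times>\<times> A\<^esub> d of (c, e) \<Rightarrow> \<lambda>u. (act c u, e)) u
        = (case c of (c, e) \<Rightarrow> \<lambda>u. (act c u, e)) u \<otimes>\<^bsub>M y \<times>\<times> A\<^esub> (case d of (c, e) \<Rightarrow> \<lambda>u. (act c u, e)) u"
      if "c \<in> carrier (M x \<times>\<times> A)" "d \<in> carrier (M x \<times>\<times> A)" "u \<in> arrows \<Phi> x y" for c d u x y
      using that act_mult[OF _ _ that(3)] by (auto simp: DirProd_def)
    show "(case c of (c, e) \<Rightarrow> \<lambda>u. (act c u, e)) (Cmp \<Phi> u v)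
        = (case (case c of (c, e) \<Rightarrow> \<lambda>u. (act c u, e)) u of (c, e) \<Rightarrow> \<lambda>u. (act c u, e)) v"
      if "c \<in> carrier (M x \<times>\<times> A)" "u \<in> arrows \<Phi> x y" "v \<in> arrows \<Phi> y z" for c u v x y z
      using that act_Cmp[OF _ that(2,3)] by (auto simp: DirProd_def)
  qed (auto simp: DirProd_def act_Idt)
qed

lemma crossed_module_times:
  assumes "crossed_module \<Phi> M act \<mu>" "comm_group A"
  shows "crossed_module \<Phi> (\<lambda>x. M x \<times>\<times> A) (\<lambda>(c, e) u. (act c u, e)) (\<lambda>(c, e). \<mu> c)"
proof -
  interpret crossed_module \<Phi> M act \<mu> by fact
  interpret A: comm_group A by fact
  show ?thesis
  proof (intro crossed_module.intro crossed_module_axioms.intro)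
    show "groupoid_action \<Phi> (\<lambda>x. M x \<times>\<times> A) (\<lambda>(c, e) u. (act c u, e))"
      using groupoid_action_times groupoid_action_axioms A.group_axioms .
    show "(\<lambda>(c, e). \<mu> c) \<in> hom (M x \<times>\<times> A) (vertex_group \<Phi> x)" if "x \<in> Obj \<Phi>" for x
      using \<mu>_hom[OF that] by (auto simp: hom_def DirProd_def)
    show "(case (case c of (c, e) \<Rightarrow> \<lambda>u. (act c u, e)) u of (c, e) \<Rightarrow> \<mu> c)
        = Cmp \<Phi> (Cmp \<Phi> (Inv \<Phi> u) (case c of (c, e) \<Rightarrow> \<mu> c)) u"
      if "c \<in> carrier (M x \<times>\<times> A)" "u \<in> arrows \<Phi> x y" for c u x y
      using that \<mu>_act[OF _ that(2)] by (auto simp: DirProd_def)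
    show "inv\<^bsub>M x \<times>\<times> A\<^esub> d \<otimes>\<^bsub>M x \<times>\<times> A\<^esub> c \<otimes>\<^bsub>M x \<times>\<times> A\<^esub> d
        = (case c of (c, e) \<Rightarrow> \<lambda>u. (act c u, e)) (case d of (c, e) \<Rightarrow> \<mu> c)"
      if x: "x \<in> Obj \<Phi>" and "c \<in> carrier (M x \<times>\<times> A)" "d \<in> carrier (M x \<times>\<times> A)" for c d x
    proof -
      obtain c1 c2 d1 d2 where cd: "c = (c1, c2)" "d = (d1, d2)" "c1 \<in> carrier (M x)" "d1 \<in> carrier (M x)"
          "c2 \<in> carrier A" "d2 \<in> carrier A"
        using \<open>c \<in> _\<close> \<open>d \<in> _\<close> by (auto simp: DirProd_def)
      \<comment> \<open>The action ignores A, so the Peiffer identity forces conjugation in A to be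
        trivial; this is where A must be commutative.\<close>
      have "inv\<^bsub>A\<^esub> d2 \<otimes>\<^bsub>A\<^esub> c2 \<otimes>\<^bsub>A\<^esub> d2 = c2"
        using cd(5,6) A.m_comm[of "inv\<^bsub>A\<^esub> d2" c2] by (simp add: A.m_assoc)
      then show ?thesis
        using cd peiffer[OF x cd(3,4)] inv_DirProd[OF fam_group[OF x] A.group_axioms cd(4,6)] by simp
    qed
  qed
qed

lemma groupoid_module_times:
  assumes "groupoid_module \<Phi> M act" "comm_group A"
  shows "groupoid_module \<Phi> (\<lambda>x. M x \<times>\<times> A) (\<lambda>(c, e) u. (act c u, e))"
proof -
  interpret groupoid_module \<Phi> M act by fact
  interpret A: comm_group A by fact
  interpret N: groupoid_action \<Phi> "\<lambda>x. M x \<times>\<times> A" "\<lambda>(c, e) u. (act c u, e)"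
    using groupoid_action_times groupoid_action_axioms A.group_axioms .
  show ?thesis
  proof (intro groupoid_module.intro N.groupoid_action_axioms groupoid_module_axioms.intro)
    fix x assume x: "x \<in> Obj \<Phi>"
    interpret comm_group "M x" using fam_comm x .
    show "comm_group (M x \<times>\<times> A)"
      by (rule group.group_comm_groupI[OF N.fam_group[OF x]]) (auto simp: DirProd_def m_comm A.m_comm)
  qed
qed

text \<open>The shape of a homotopy component in dimension at least 2, with A the fibre at the base
  point in the next dimension.\<close>

definition invariant_hom ::
  "('o, 'a) groupoid \<Rightarrow> ('o \<Rightarrow> 'm monoid) \<Rightarrow> ('m \<Rightarrow> 'a \<Rightarrow> 'm) \<Rightarrow> 'n monoid \<Rightarrow> ('m \<Rightarrow> 'n) \<Rightarrow> bool" where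
  "invariant_hom \<Phi> M act A f \<longleftrightarrow>
     (\<forall>x \<in> Obj \<Phi>. f \<in> hom (M x) A) \<and>
     (\<forall>x y. \<forall>c \<in> carrier (M x). \<forall>u \<in> arrows \<Phi> x y. f (act c u) = f c)"

lemma invariant_hom_snd:
  assumes "groupoid \<Phi>" and f: "action_morphism \<Phi> M act (\<lambda>x. M x \<times>\<times> A) (\<lambda>(c, e) u. (act' c u, e)) f"
  shows "invariant_hom \<Phi> M act A (\<lambda>c. snd (f c))"
  unfolding invariant_hom_def
proof (intro conjI ballI allI)
  fix x assume "x \<in> Obj \<Phi>"
  then have "f \<in> hom (M x) (M x \<times>\<times> A)"
    using f by (simp add: action_morphism_def)
  then show "(\<lambda>c. snd (f c)) \<in> hom (M x) A"
    by (force simp: hom_def DirProd_def Pi_iff split_beta)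
next
  fix x y c u assume "c \<in> carrier (M x)" "u \<in> arrows \<Phi> x y"
  then show "snd (f (act c u)) = snd (f c)"
    using f by (simp add: action_morphism_def split_beta)
qed

text \<open>A generator is sent to the pair of itself and its prescribed value: the first entry
  supplies the boundary that a morphism over \<Phi> has to preserve, the second yields the invariant
  map.\<close>

lemma free_crossed_module_invariant_hom:
  fixes \<Phi> :: "('o, 'a) groupoid" and A :: "'n monoid" and S :: "'o \<Rightarrow> 's set"
    and M :: "'o \<Rightarrow> 'm monoid" and \<iota> :: "'m \<times> 'n \<Rightarrow> ('o, 'a, 's, 'm) action_target"
  assumes free: "free_crossed_module \<Phi> M act \<mu> S w i" and A: "comm_group A" and \<iota>: "inj \<iota>"
    and k: "\<And>x s. x \<in> Obj \<Phi> \<Longrightarrow> s \<in> S x \<Longrightarrow> k x s \<in> carrier A"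
  shows "\<exists>f. invariant_hom \<Phi> M act A f \<and> (\<forall>x \<in> Obj \<Phi>. \<forall>s \<in> S x. f (i x s) = k x s)"
proof -
  have M: "crossed_module \<Phi> M act \<mu>"
    and i: "\<And>x s. x \<in> Obj \<Phi> \<Longrightarrow> s \<in> S x \<Longrightarrow> i x s \<in> carrier (M x) \<and> \<mu> (i x s) = w x s"
    using free by (auto simp: free_crossed_module_def)
  interpret crossed_module \<Phi> M act \<mu> by fact
  obtain f where f: "crossed_module_morphism \<Phi> M act \<mu> (\<lambda>x. M x \<times>\<times> A) (\<lambda>(c, e) u. (act c u, e)) (\<lambda>(c, e). \<mu> c) f"
      "\<forall>x \<in> Obj \<Phi>. \<forall>s \<in> S x. f (i x s) = (i x s, k x s)"
    using ex_unique_onD(1)[OF free_crossed_module_universal[OF free crossed_module_times[OF M A] _ \<iota>,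
        of "\<lambda>x s. (i x s, k x s)"]] i k by (auto simp: DirProd_def)
  then show ?thesis
    using invariant_hom_snd[OF groupoid_axioms]
    by (intro exI[of _ "\<lambda>c. snd (f c)"]) (auto simp: crossed_module_morphism_def)
qed

lemma free_module_invariant_hom:
  fixes \<Phi> :: "('o, 'a) groupoid" and A :: "'n monoid" and S :: "'o \<Rightarrow> 's set"
    and M :: "'o \<Rightarrow> 'm monoid" and \<iota> :: "'m \<times> 'n \<Rightarrow> ('o, 'a, 's, 'm) action_target"
  assumes free: "free_module \<Phi> M act S i" and A: "comm_group A" and \<iota>: "inj \<iota>"
    and k: "\<And>x s. x \<in> Obj \<Phi> \<Longrightarrow> s \<in> S x \<Longrightarrow> k x s \<in> carrier A"
  shows "\<exists>f. invariant_hom \<Phi> M act A f \<and> (\<forall>x \<in> Obj \<Phi>. \<forall>s \<in> S x. f (i x s) = k x s)"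
proof -
  have M: "groupoid_module \<Phi> M act"
    and i: "\<And>x s. x \<in> Obj \<Phi> \<Longrightarrow> s \<in> S x \<Longrightarrow> i x s \<in> carrier (M x)"
    using free by (auto simp: free_module_def)
  interpret groupoid_module \<Phi> M act by fact
  obtain f where f: "action_morphism \<Phi> M act (\<lambda>x. M x \<times>\<times> A) (\<lambda>(c, e) u. (act c u, e)) f"
      "\<forall>x \<in> Obj \<Phi>. \<forall>s \<in> S x. f (i x s) = (i x s, k x s)"
    using ex_unique_onD(1)[OF free_module_universal[OF free groupoid_module_times[OF M A] _ \<iota>,
        of "\<lambda>x s. (i x s, k x s)"]] i k by (auto simp: DirProd_def)
  then show ?thesis
    using invariant_hom_snd[OF groupoid_axioms]
    by (intro exI[of _ "\<lambda>c. snd (f c)"]) auto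
qed


section \<open>One-step extensions of free crossed resolutions\<close>

context one_point_complex
begin

section \<open>Passing between actions of \<open>C_1\<close> and actions of G\<close>

abbreviation \<Gamma> :: "('o, 'g) groupoid" where "\<Gamma> \<equiv> group_groupoid pt G"

lemma \<Gamma>_Obj [simp]: "Obj \<Gamma> = {pt}"
  by (simp add: group_groupoid_def)

lemma \<Gamma>_arrows: "arrows \<Gamma> x y = (if x = pt \<and> y = pt then carrier G else {})"
  by (auto simp: group_groupoid_def arrows_def)

lemma groupoid_\<Gamma>: "groupoid \<Gamma>"
  using groupoid_group_groupoid group_G .

lemma arrows_pt_iff: "u \<in> arrows (gpd C) x y \<longleftrightarrow> x = pt \<and> y = pt \<and> u \<in> Arr (gpd C)"
  using point arrows_eq arrows_Obj[of u x y] by auto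

text \<open>The action of \<open>C_1\<close> is that of G pulled back along \<phi>, so it inherits
  the module axioms, and elements of the kernel of \<phi> act as the unit of G does.\<close>

lemma groupoid_module_along:
  assumes "free_module_along (gpd C) \<Gamma> \<phi> M act S i"
  shows "groupoid_module (gpd C) M act"
    and "\<lbrakk>c \<in> carrier (M pt); u \<in> Arr (gpd C); \<phi> u = \<one>\<^bsub>G\<^esub>\<rbrakk> \<Longrightarrow> act c u = c"
proof -
  obtain act' where eq: "\<And>x y c u. c \<in> carrier (M x) \<Longrightarrow> u \<in> arrows (gpd C) x y \<Longrightarrow> act' c (\<phi> u) = act c u"
    and free: "free_module \<Gamma> M act' S i"
    using assms unfolding free_module_along_def by blast
  interpret L: groupoid_module \<Gamma> M act' using free by (simp add: free_module_def)
  have eq: "act c u = act' c (\<phi> u)" if "c \<in> carrier (M pt)" "u \<in> Arr (gpd C)" for c u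
    using eq[of c pt u pt] that arrows_eq by simp
  have closed: "act' c g \<in> carrier (M pt)" if "c \<in> carrier (M pt)" "g \<in> carrier G" for c g
    using L.act_closed[of c pt g pt] that by (simp add: \<Gamma>_arrows)
  have Idt: "act' c \<one>\<^bsub>G\<^esub> = c" if "c \<in> carrier (M pt)" for c
    using L.act_Idt[of pt c] that by (simp add: group_groupoid_def)
  have mult: "act' (c \<otimes>\<^bsub>M pt\<^esub> d) g = act' c g \<otimes>\<^bsub>M pt\<^esub> act' d g"
    if "c \<in> carrier (M pt)" "d \<in> carrier (M pt)" "g \<in> carrier G" for c d g
    using L.act_mult[of c pt d g pt] that by (simp add: \<Gamma>_arrows)
  have mult_closed: "c \<otimes>\<^bsub>M pt\<^esub> d \<in> carrier (M pt)"
    if "c \<in> carrier (M pt)" "d \<in> carrier (M pt)" for c d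
    using that L.fam_group[of pt] by (simp add: group.is_monoid monoid.m_closed)
  have Cmp: "act' c (g \<otimes>\<^bsub>G\<^esub> g') = act' (act' c g) g'"
    if "c \<in> carrier (M pt)" "g \<in> carrier G" "g' \<in> carrier G" for c g g'
    using L.act_Cmp[of c pt g pt g' pt] that by (simp add: \<Gamma>_arrows) (simp add: group_groupoid_def)
  show "groupoid_module (gpd C) M act"
  proof (intro groupoid_module.intro groupoid_action.intro groupoid_axioms groupoid_action_axioms.intro
      groupoid_module_axioms.intro)
    show "group (M x)" "comm_group (M x)" if "x \<in> Obj (gpd C)" for x
      using that point L.fam_group L.fam_comm by auto
    show "disjoint_family_on (\<lambda>x. carrier (M x)) (Obj (gpd C))"
      using point by (simp add: disjoint_family_on_def)
    show "act c (Idt (gpd C) x) = c" if "x \<in> Obj (gpd C)" "c \<in> carrier (M x)" for x c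
      using that point Idt_closed[of x] by (simp add: arrows_pt_iff eq \<phi>_Idt Idt)
    show "act c (Cmp (gpd C) u v) = act (act c u) v"
      if "c \<in> carrier (M x)" "u \<in> arrows (gpd C) x y" "v \<in> arrows (gpd C) y t" for c u v x y t
      using that Cmp_closed[OF that(2,3)] by (simp add: arrows_pt_iff eq \<phi>_Cmp \<phi>_closed Cmp closed)
  qed (auto simp: arrows_pt_iff eq \<phi>_closed mult closed mult_closed)
  show "act c u = c" if "c \<in> carrier (M pt)" "u \<in> Arr (gpd C)" "\<phi> u = \<one>\<^bsub>G\<^esub>"
    using that eq Idt by simp
qed

lemma free_module_along_generated_pt:
  assumes "free_module_along (gpd C) \<Gamma> \<phi> M act S i" and "\<phi> ` Arr (gpd C) = carrier G"
    and "closed_subfamily (gpd C) M act K" and "\<And>s. s \<in> S pt \<Longrightarrow> i pt s \<in> K"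
    and "c \<in> carrier (M pt)"
  shows "c \<in> K"
proof (rule free_module_along_generated[OF assms(1)])
  show "\<exists>u\<in>arrows (gpd C) x y. \<phi> u = v" if "v \<in> arrows \<Gamma> x y" for x y v
  proof -
    have "v \<in> \<phi> ` Arr (gpd C)" "x = pt" "y = pt"
      using that assms(2) by (auto simp: \<Gamma>_arrows split: if_splits)
    then show ?thesis by (auto simp: arrows_eq)
  qed
qed (use assms point in auto)

text \<open>If \<phi> u = \<phi> v, then u composed with the inverse of v lies in the kernel of
  \<phi> and acts trivially. Hence an element of G may act through any chosen preimage.\<close>

lemma groupoid_module_descend:
  assumes N: "groupoid_module (gpd C) N act" and surj: "\<phi> ` Arr (gpd C) = carrier G"
    and triv: "\<And>c u. \<lbrakk>c \<in> carrier (N pt); u \<in> Arr (gpd C); \<phi> u = \<one>\<^bsub>G\<^esub>\<rbrakk> \<Longrightarrow> act c u = c"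
  shows "\<exists>act'. groupoid_module \<Gamma> N act' \<and>
    (\<forall>c \<in> carrier (N pt). \<forall>u \<in> Arr (gpd C). act' c (\<phi> u) = act c u)"
proof -
  interpret N: groupoid_module "gpd C" N act by fact
  interpret G: group G by (rule group_G)
  have indep: "act c u = act c v"
    if c: "c \<in> carrier (N pt)" and u: "u \<in> Arr (gpd C)" and v: "v \<in> Arr (gpd C)" and uv: "\<phi> u = \<phi> v" for c u v
  proof -
    note a = u[folded arrows_eq] v[folded arrows_eq]
    note w = Cmp_closed[OF a(1) Inv_closed[OF a(2)]]
    have "\<phi> (Cmp (gpd C) u (Inv (gpd C) v)) = \<one>\<^bsub>G\<^esub>"
      using uv u v Inv_closed[OF a(2)] by (simp add: \<phi>_Cmp \<phi>_Inv arrows_eq \<phi>_closed)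
    then have "act c (Cmp (gpd C) u (Inv (gpd C) v)) = c"
      using triv[OF c] w by (simp add: arrows_eq)
    moreover have "Cmp (gpd C) (Cmp (gpd C) u (Inv (gpd C) v)) v = u"
      using Cmp_assoc[OF a(1) Inv_closed[OF a(2)] a(2)] Inv_left[OF a(2)] Idt_right[OF a(1)] by simp
    ultimately show ?thesis
      using N.act_Cmp[OF c w a(2)] by simp
  qed
  define act' where "act' c g = act c (SOME u. u \<in> Arr (gpd C) \<and> \<phi> u = g)" for c g
  have act': "act' c (\<phi> u) = act c u" if "c \<in> carrier (N pt)" "u \<in> Arr (gpd C)" for c u
  proof -
    have "(SOME v. v \<in> Arr (gpd C) \<and> \<phi> v = \<phi> u) \<in> Arr (gpd C) \<and> \<phi> (SOME v. v \<in> Arr (gpd C) \<and> \<phi> v = \<phi> u) = \<phi> u"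
      by (rule someI[of "\<lambda>v. v \<in> Arr (gpd C) \<and> \<phi> v = \<phi> u" u]) (use that in simp)
    then show ?thesis
      using indep that unfolding act'_def by blast
  qed
  note closed = N.act_closed[of _ pt _ pt, unfolded arrows_eq]
  have "groupoid_module \<Gamma> N act'"
  proof (intro groupoid_module.intro groupoid_action.intro groupoid_\<Gamma> groupoid_action_axioms.intro
      groupoid_module_axioms.intro)
    show "group (N x)" "comm_group (N x)" if "x \<in> Obj \<Gamma>" for x
      using that N.fam_group[OF pt_Obj] N.fam_comm[OF pt_Obj] by auto
    show "disjoint_family_on (\<lambda>x. carrier (N x)) (Obj \<Gamma>)"
      by (simp add: disjoint_family_on_def)
    show "act' c (Idt \<Gamma> x) = c" if "x \<in> Obj \<Gamma>" "c \<in> carrier (N x)" for x c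
      using that act'[of c "Idt (gpd C) pt"] N.act_Idt[OF pt_Obj] Idt_closed[OF pt_Obj]
      by (simp add: arrows_eq \<phi>_Idt) (simp add: group_groupoid_def)
    show "act' c g \<in> carrier (N y)" if "c \<in> carrier (N x)" "g \<in> arrows \<Gamma> x y" for c g x y
    proof -
      have "g \<in> carrier G" and xy: "x = pt" "y = pt"
        using that(2) by (auto simp: \<Gamma>_arrows split: if_splits)
      then obtain u where "u \<in> Arr (gpd C)" "g = \<phi> u" using surj by blast
      then show ?thesis
        using that(1) xy act' closed by simp
    qed
    show "act' (c \<otimes>\<^bsub>N x\<^esub> d) g = act' c g \<otimes>\<^bsub>N y\<^esub> act' d g"
      if "c \<in> carrier (N x)" "d \<in> carrier (N x)" "g \<in> arrows \<Gamma> x y" for c d g x y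
    proof -
      have "g \<in> carrier G" and xy: "x = pt" "y = pt"
        using that(3) by (auto simp: \<Gamma>_arrows split: if_splits)
      then obtain u where u: "u \<in> Arr (gpd C)" "g = \<phi> u" using surj by blast
      have "c \<otimes>\<^bsub>N pt\<^esub> d \<in> carrier (N pt)"
        using that(1,2) xy N.fam_group[OF pt_Obj] by (simp add: group.is_monoid monoid.m_closed)
      then show ?thesis
        using u that(1,2) xy act' N.act_mult[of c pt d u pt] by (simp add: arrows_eq)
    qed
    show "act' c (Cmp \<Gamma> g g') = act' (act' c g) g'"
      if "c \<in> carrier (N x)" "g \<in> arrows \<Gamma> x y" "g' \<in> arrows \<Gamma> y t" for c g g' x y t
    proof -
      have "g \<in> carrier G" "g' \<in> carrier G" and xy: "x = pt" "y = pt" "t = pt"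
        using that(2,3) by (auto simp: \<Gamma>_arrows split: if_splits)
      then obtain u v where uv: "u \<in> Arr (gpd C)" "g = \<phi> u" "v \<in> Arr (gpd C)" "g' = \<phi> v" using surj by blast
      have "Cmp (gpd C) u v \<in> Arr (gpd C)"
        using Cmp_closed[of u pt pt v pt] uv by (simp add: arrows_eq)
      then have "act' c (\<phi> (Cmp (gpd C) u v)) = act' (act' c g) g'"
        using that(1) xy act' uv N.act_Cmp[of c pt u pt v pt] closed by (simp add: arrows_eq)
      then show ?thesis
        using uv by (simp add: \<phi>_Cmp) (simp add: group_groupoid_def)
    qed
  qed
  then show ?thesis using act' by blast
qed

lemma closed_bdry_kernel:
  assumes n: "2 \<le> n" "n \<le> m"
  shows "closed_subfamily (gpd C) (fam C n) (action C n) (bdry_kernel C n pt)"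
  unfolding closed_subfamily_def
proof (intro conjI ballI allI)
  \<comment> \<open>\<open>unit_at C (n - 1)\<close> is an identity arrow for n = 2 and a unit of a
    group of the family otherwise, which is why both parts split on n = 2.\<close>
  have n1: "n = 2 \<or> n - 1 \<noteq> 1" using n by auto
  interpret A: groupoid_action "gpd C" "fam C n" "action C n" using action_dim n .
  have K: "bdry_kernel C n pt \<inter> carrier (fam C n pt) = bdry_kernel C n pt"
    by (auto simp: bdry_kernel_def)
  show "subgroup (bdry_kernel C n pt \<inter> carrier (fam C n x)) (fam C n x)" if "x \<in> Obj (gpd C)" for x
  proof (cases "n = 2")
    case True
    then interpret M: crossed_module "gpd C" "fam C n" "action C n" "bdry C n"
      using dim2 n by simp
    have "bdry_kernel C n pt = kernel (fam C n pt) (vertex_group (gpd C) pt) (bdry C n)"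
      using True by (simp add: bdry_kernel_def kernel_def vertex_group_def unit_at_def)
    then show ?thesis
      using group_hom.subgroup_kernel[OF M.\<mu>_group_hom[OF pt_Obj]] K that point by simp
  next
    case False
    then have "group_hom (fam C n pt) (fam C (n - 1) pt) (bdry C n)"
      using bdry_group_hom[of n pt] n pt_Obj by simp
    moreover have "bdry_kernel C n pt = kernel (fam C n pt) (fam C (n - 1) pt) (bdry C n)"
      using False n1 by (auto simp: bdry_kernel_def kernel_def unit_at_def simp del: One_nat_def)
    ultimately show ?thesis
      using group_hom.subgroup_kernel K that point by fastforce
  qed
  show "action C n c u \<in> bdry_kernel C n pt"
    if "c \<in> bdry_kernel C n pt \<inter> carrier (fam C n x)" "u \<in> arrows (gpd C) x y" for c u x y
  proof -
    have u: "u \<in> arrows (gpd C) pt pt" using that(2) by (simp add: arrows_pt_iff)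
    have c: "c \<in> carrier (fam C n pt)" "bdry C n c = unit_at C (n - 1) pt"
      using that(1) by (auto simp: bdry_kernel_def)
    have "bdry C n (action C n c u) = unit_at C (n - 1) pt"
    proof (cases "n = 2")
      case True
      then interpret M: crossed_module "gpd C" "fam C n" "action C n" "bdry C n"
        using dim2 n by simp
      show ?thesis
        using M.\<mu>_act[OF c(1) u] c(2) True Idt_right[OF Inv_closed[OF u]] Inv_left[OF u]
        by (simp add: unit_at_def)
    next
      case False
      then interpret B: groupoid_action "gpd C" "fam C (n - 1)" "action C (n - 1)"
        using action_dim n by simp
      show ?thesis
        using bdry_act[OF _ n(2) c(1) u] B.act_one[OF u] c(2) False n n1
        by (simp add: unit_at_def del: One_nat_def)
    qed
    then show ?thesis
      using A.act_closed[OF c(1) u] by (simp add: bdry_kernel_def)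
  qed
qed

end

locale free_resolution = one_point_complex m C G \<phi>
  for m :: nat and C :: "('o, 'c) crossed_complex" and G :: "'g monoid" and \<phi> :: "'c \<Rightarrow> 'g" +
  assumes m_pos: "1 \<le> m" and resolution: "free_crossed_resolution m G \<phi> C"
begin

lemma \<phi>_surj: "\<phi> ` Arr (gpd C) = carrier G"
  using resolution by (simp add: free_crossed_resolution_def)

lemma image_bdry2:
  "2 \<le> m \<Longrightarrow> bdry C 2 ` carrier (fam C 2 pt) = kernel (vertex_group (gpd C) pt) G \<phi>"
  using resolution by (simp add: free_crossed_resolution_def)

lemma \<phi>_bdry2: "\<lbrakk>2 \<le> m; c \<in> carrier (fam C 2 pt)\<rbrakk> \<Longrightarrow> \<phi> (bdry C 2 c) = \<one>\<^bsub>G\<^esub>"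
  using image_bdry2 kernel_\<phi> by blast

lemma cover_complex: "truncated_crossed_complex m D"
  using truncated_crossed_complex_cover \<phi>_bdry2 .

definition cycles :: "'c set" where
  "cycles = (if m = 1 then kernel (vertex_group (gpd C) pt) G \<phi> else bdry_kernel C m pt)"

lemma cycles_1: "m = 1 \<Longrightarrow> cycles = {u \<in> Arr (gpd C). \<phi> u = \<one>\<^bsub>G\<^esub>}"
  using kernel_\<phi> unfolding cycles_def by simp

lemma cycles_ge2: "m \<noteq> 1 \<Longrightarrow> cycles = bdry_kernel C m pt"
  unfolding cycles_def by simp

text \<open>This holds for n = 2 as well. The kernel is abelian because it is central. An element of
  the kernel of \<phi> is a boundary of some b by exactness; for n = 2 it acts on cycles as
  conjugation by b, which is trivial, and for n at least 3 its action is trivial by the axioms. So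
  the action descends to G, and a free G-module can be mapped into the kernel.\<close>

lemma kernel_module:
  assumes n: "2 \<le> n" "n \<le> m"
  shows "\<exists>act'. groupoid_module \<Gamma> (restrict_family (fam C n) (bdry_kernel C n pt)) act' \<and>
    (\<forall>c \<in> bdry_kernel C n pt. \<forall>u \<in> Arr (gpd C). act' c (\<phi> u) = action C n c u)"
proof -
  let ?N = "restrict_family (fam C n) (bdry_kernel C n pt)"
  interpret A: groupoid_action "gpd C" "fam C n" "action C n" using action_dim n .
  note K = closed_bdry_kernel[OF n]
  have carrier: "carrier (?N pt) = bdry_kernel C n pt"
    by (auto simp: restrict_family_def bdry_kernel_def)
  have "groupoid_module (gpd C) ?N (action C n)"
  proof (cases "n = 2")
    case True
    then interpret M: crossed_module "gpd C" "fam C n" "action C n" "bdry C n"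
      using dim2 n by simp
    interpret N: groupoid_action "gpd C" ?N "action C n"
      using groupoid_action_restrict A.groupoid_action_axioms K .
    have "comm_group (?N x)" if x: "x \<in> Obj (gpd C)" for x
      using x point M.kernel_central[OF x] True
      by (intro group.group_comm_groupI[OF N.fam_group[OF x]])
        (auto simp: restrict_family_def bdry_kernel_def unit_at_def)
    then show ?thesis
      by (intro groupoid_module.intro N.groupoid_action_axioms groupoid_module_axioms.intro)
  next
    case False
    then show ?thesis
      using groupoid_module_restrict[OF dim_ge3 K] n by simp
  qed
  moreover have "action C n c u = c"
    if c: "c \<in> carrier (?N pt)" and u: "u \<in> Arr (gpd C)" "\<phi> u = \<one>\<^bsub>G\<^esub>" for c u
  proof -
    obtain b where b: "b \<in> carrier (fam C 2 pt)" "u = bdry C 2 b"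
      using u image_bdry2 n kernel_\<phi> by auto
    have c: "c \<in> carrier (fam C n pt)" "bdry C n c = unit_at C (n - 1) pt"
      using c carrier by (auto simp: bdry_kernel_def)
    show ?thesis
    proof (cases "n = 2")
      case True
      then interpret M: crossed_module "gpd C" "fam C n" "action C n" "bdry C n"
        using dim2 n by simp
      interpret X: group "fam C n pt" using A.fam_group pt_Obj .
      have b': "b \<in> carrier (fam C n pt)" using b True by simp
      have "b \<otimes>\<^bsub>fam C n pt\<^esub> c = c \<otimes>\<^bsub>fam C n pt\<^esub> b"
        using M.kernel_central[OF pt_Obj b' c(1)] c(2) True by (simp add: unit_at_def)
      then have "inv\<^bsub>fam C n pt\<^esub> b \<otimes>\<^bsub>fam C n pt\<^esub> c \<otimes>\<^bsub>fam C n pt\<^esub> b = c"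
        using b' c(1) X.inv_solve_left[of c b "c \<otimes>\<^bsub>fam C n pt\<^esub> b"] by (simp add: X.m_assoc)
      then show ?thesis
        using M.peiffer[OF pt_Obj c(1) b'] b(2) True by simp
    next
      case False
      then show ?thesis
        using bdry2_trivial_action[OF _ n(2) pt_Obj c(1) b(1)] b(2) n by simp
    qed
  qed
  ultimately show ?thesis
    using groupoid_module_descend[of ?N "action C n"] \<phi>_surj carrier by auto
qed

end

lemma free_resolutionI:
  assumes "1 \<le> m" "free_crossed_resolution m G \<phi> C"
  shows "free_resolution m C G \<phi>"
proof -
  have C: "truncated_crossed_complex m C" and "is_singleton (Obj (gpd C))" and G: "group G"
    and \<phi>: "\<phi> \<in> hom (vertex_group (gpd C) (the_point C)) G"
    using assms(2) by (simp_all add: free_crossed_resolution_def)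
  then have "Obj (gpd C) = {the_point C}"
    unfolding the_point_def by (simp add: is_singleton_the_elem)
  then show ?thesis
    by (intro free_resolution.intro one_point_complex.intro one_point_complex_axioms.intro
        free_resolution_axioms.intro C G \<phi> assms)
qed

text \<open>Asking for cycles on the generators fits both uses: the extension on X built from the
  homotopy, and its replacement on the smaller basis Y.\<close>

locale resolution_extension = free_resolution m C G \<phi>
  for m :: nat and C :: "('o, 'c) crossed_complex" and G :: "'g monoid" and \<phi> :: "'c \<Rightarrow> 'g" +
  fixes E :: "('o, 'c) crossed_complex" and X :: "'c set"
  assumes extension: "free_extension m G \<phi> C E X"
    and bdry_cycle: "x \<in> X \<Longrightarrow> bdry E (Suc m) x \<in> cycles"
begin

lemma gpd_E [simp]: "gpd E = gpd C"
  using extension by (simp add: free_extension_def)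

lemma pt_E [simp]: "the_point E = pt"
  by (simp add: the_point_def)

lemma lower_dim: "\<lbrakk>2 \<le> n; n \<le> m\<rbrakk> \<Longrightarrow> fam E n = fam C n \<and> action E n = action C n \<and> bdry E n = bdry C n"
  using extension by (simp add: free_extension_def)

lemma unit_at_E: "1 \<le> n \<Longrightarrow> n \<le> m \<Longrightarrow> unit_at E n x = unit_at C n x"
  using lower_dim[of n] by (simp add: unit_at_def)

lemma top_dim1:
  "m = 1 \<Longrightarrow> free_crossed_module_on (gpd C) (fam E 2) (action E 2) (bdry E 2) X"
  using extension by (simp add: free_extension_def)

lemma top_dim_crossed: "m = 1 \<Longrightarrow> crossed_module (gpd C) (fam E 2) (action E 2) (bdry E 2)"
  using top_dim1 by (simp add: free_crossed_module_on_def free_crossed_module_def)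

lemma top_dim:
  assumes "m \<noteq> 1"
  shows "free_module_along (gpd C) \<Gamma> \<phi> (fam E (Suc m)) (action E (Suc m))
      (\<lambda>x. X \<inter> carrier (fam E (Suc m) x)) (\<lambda>_ s. s)"
    and "action_morphism (gpd C) (fam E (Suc m)) (action E (Suc m)) (fam C m) (action C m) (bdry E (Suc m))"
  using extension assms by (auto simp: free_extension_def free_module_along_on_def)

lemma X_subset: "X \<subseteq> carrier (fam E (Suc m) pt)"
  using extension point
  by (auto simp: free_extension_def free_module_along_on_def free_crossed_module_on_def numeral_2_eq_2
      split: if_splits)

lemma top_module: "m \<noteq> 1 \<Longrightarrow> groupoid_module (gpd C) (fam E (Suc m)) (action E (Suc m))"
  using groupoid_module_along(1)[OF top_dim(1)] .

lemma top_generated: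
  assumes "closed_subfamily (gpd C) (fam E (Suc m)) (action E (Suc m)) K" "X \<subseteq> K"
    and c: "c \<in> carrier (fam E (Suc m) pt)"
  shows "c \<in> K"
proof (cases "m = 1")
  case True
  then show ?thesis
    using free_crossed_module_generated[of "gpd C" "fam E 2" "action E 2" "bdry E 2" _ _ _ K pt c] assms pt_Obj
      top_dim1 by (auto simp: free_crossed_module_on_def numeral_2_eq_2)
next
  case False
  then show ?thesis
    using free_module_along_generated_pt[OF top_dim(1) \<phi>_surj assms(1)] assms(2) c by auto
qed

text \<open>The elements with boundary in \<open>cycles\<close> form a closed subfamily containing
  X. For m = 1 the boundary takes values in a groupoid instead of a family with an action, so
  closure is checked by hand; stability under the action is then normality of the kernel of
  \<phi>.\<close>

lemma bdry_cycles:
  assumes "c \<in> carrier (fam E (Suc m) pt)"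
  shows "bdry E (Suc m) c \<in> cycles"
proof -
  have "closed_subfamily (gpd C) (fam E (Suc m)) (action E (Suc m)) {c. bdry E (Suc m) c \<in> cycles}"
  proof (cases "m = 1")
    case True
    interpret M: crossed_module "gpd C" "fam E (Suc m)" "action E (Suc m)" "bdry E (Suc m)"
      using top_dim_crossed True by (simp add: numeral_2_eq_2)
    interpret F: group_hom "vertex_group (gpd C) pt" G \<phi> by (rule \<phi>_group_hom)
    interpret B: group_hom "fam E (Suc m) pt" "vertex_group (gpd C) pt" "bdry E (Suc m)"
      using M.\<mu>_group_hom pt_Obj .
    have carr: "carrier (vertex_group (gpd C) pt) = Arr (gpd C)"
      by (simp add: vertex_group_def arrows_eq)
    note cyc = cycles_1[OF True]
    show ?thesis
      unfolding closed_subfamily_def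
    proof (intro conjI ballI allI)
      show "subgroup ({c. bdry E (Suc m) c \<in> cycles} \<inter> carrier (fam E (Suc m) x)) (fam E (Suc m) x)"
        if "x \<in> Obj (gpd C)" for x
      proof -
        have "x = pt" using that point by simp
        then show ?thesis
          using B.hom_closed B.hom_mult B.hom_inv B.hom_one F.hom_mult F.hom_inv F.hom_one
            F.G.m_closed[unfolded carr] F.G.one_closed[unfolded carr] F.G.inv_closed[unfolded carr]
          by (intro subgroup.intro) (auto simp: cyc carr)
      qed
      show "action E (Suc m) c u \<in> {c. bdry E (Suc m) c \<in> cycles}"
        if "c \<in> {c. bdry E (Suc m) c \<in> cycles} \<inter> carrier (fam E (Suc m) x)" "u \<in> arrows (gpd C) x y" for c u x y
      proof -
        have u: "u \<in> arrows (gpd C) pt pt" and c: "c \<in> carrier (fam E (Suc m) pt)" "bdry E (Suc m) c \<in> cycles"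
          using that by (auto simp: arrows_pt_iff)
        note b = M.\<mu>_arrow[OF pt_Obj c(1)]
        show ?thesis
          using M.\<mu>_act[OF c(1) u] Cmp_closed[OF Cmp_closed[OF Inv_closed[OF u] b] u]
            Cmp_closed[OF Inv_closed[OF u] b] Inv_closed[OF u] b u c(2) group_G
          by (simp add: cyc arrows_eq \<phi>_Cmp \<phi>_Inv \<phi>_closed group.l_inv)
      qed
    qed
  next
    case False
    then have m: "2 \<le> m" using m_pos by simp
    interpret M: groupoid_module "gpd C" "fam E (Suc m)" "action E (Suc m)" using top_module False .
    interpret A: groupoid_action "gpd C" "fam C m" "action C m" using action_dim m by simp
    show ?thesis
      using closed_subfamily_preimage[OF M.fam_group A.fam_group M.act_closed top_dim(2)[OF False]
          closed_bdry_kernel[OF m order_refl] arrows_Obj(1)] cycles_ge2[OF False] by simp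
  qed
  then show ?thesis
    using top_generated bdry_cycle assms by blast
qed

lemma \<phi>_bdry2_E:
  assumes "c \<in> carrier (fam E 2 pt)"
  shows "\<phi> (bdry E 2 c) = \<one>\<^bsub>G\<^esub>"
proof (cases "m = 1")
  case True
  then show ?thesis
    using bdry_cycles[of c, unfolded cycles_1[OF True]] assms by (simp add: numeral_2_eq_2)
next
  case False
  then show ?thesis
    using \<phi>_bdry2 lower_dim[of 2] assms m_pos by simp
qed

lemma bdry2_E_Arr:
  assumes "c \<in> carrier (fam E 2 pt)"
  shows "bdry E 2 c \<in> Arr (gpd C)"
proof -
  have "crossed_module (gpd C) (fam E 2) (action E 2) (bdry E 2)"
    using top_dim_crossed dim2 lower_dim[of 2] m_pos by (cases "m = 1") auto
  then show ?thesis
    using crossed_module.\<mu>_arrow[of "gpd C" "fam E 2" _ _ pt c] pt_Obj assms by (simp add: arrows_eq)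
qed

text \<open>Two axioms are new in the top dimension. Boundaries of boundaries vanish because
  boundaries are cycles, and boundaries from dimension 2 act trivially because the action factors
  through \<phi>, which kills them.\<close>

lemma complex_E: "truncated_crossed_complex (Suc m) E"
proof (rule truncated_crossed_complex.intro)
  show "groupoid (gpd E)" using groupoid_axioms by simp
  show "crossed_module (gpd E) (fam E 2) (action E 2) (bdry E 2)"
    using top_dim_crossed dim2 lower_dim[of 2] m_pos by (cases "m = 1") auto
  fix n assume n: "3 \<le> n" "n \<le> Suc m"
  have top: "n = Suc m \<Longrightarrow> m \<noteq> 1 \<and> 2 \<le> m" using n by auto
  show module: "groupoid_module (gpd E) (fam E n) (action E n)"
    using top_module dim_ge3[of n] lower_dim[of n] n top by (cases "n = Suc m") auto
  show "action_morphism (gpd E) (fam E n) (action E n) (fam E (n - 1)) (action E (n - 1)) (bdry E n)"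
  proof (cases "n = Suc m")
    case True
    then show ?thesis using top_dim(2) lower_dim[of m] top by simp
  next
    case False
    then have "2 \<le> n - 1" "n - 1 \<le> m" "n \<le> m" using n by auto
    then show ?thesis using bdry_morphism[of n] lower_dim[of n] lower_dim[of "n - 1"] n by simp
  qed
  fix x c assume x: "x \<in> Obj (gpd E)" and c: "c \<in> carrier (fam E n x)"
  have xpt: "x = pt" using x point by simp
  show "bdry E (n - 1) (bdry E n c) = unit_at E (n - 2) x"
  proof (cases "n = Suc m")
    case True
    then have "bdry E n c \<in> bdry_kernel C m pt"
      using bdry_cycles[of c] c xpt top cycles_ge2 by simp
    then show ?thesis
      using True top lower_dim[of m] unit_at_E[of "m - 1"] xpt by (auto simp: bdry_kernel_def numeral_2_eq_2)
  next
    case False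
    then have "2 \<le> n - 1" "n - 1 \<le> m" "n \<le> m" "1 \<le> n - 2" "n - 2 \<le> m" using n by auto
    then show ?thesis
      using bdry_bdry[of n x c] lower_dim[of n] lower_dim[of "n - 1"] unit_at_E[of "n - 2"] n x c by simp
  qed
  show "action E n c (bdry E 2 b) = c" if b: "b \<in> carrier (fam E 2 x)" for b
  proof (cases "n = Suc m")
    case True
    then show ?thesis
      using groupoid_module_along(2)[OF top_dim(1)] \<phi>_bdry2_E bdry2_E_Arr top b c xpt by simp
  next
    case False
    then show ?thesis
      using bdry2_trivial_action[of n x c b] lower_dim[of n] lower_dim[of 2] n x b c by simp
  qed
qed

sublocale E: one_point_complex "Suc m" E G \<phi>
  using complex_E point group_G \<phi>_hom
  by (intro one_point_complex.intro one_point_complex_axioms.intro) simp_all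

lemma cover_complex_E: "truncated_crossed_complex (Suc m) E.D"
  using E.truncated_crossed_complex_cover \<phi>_bdry2_E by simp

text \<open>The fibre of the cover over 1 is a copy of E in dimensions at least 2, and the loops at
  1 are a copy of the kernel of \<phi>. Exactness of the contracted cover at 1 is therefore
  exactness of E.\<close>

lemma resolution_E:
  assumes hom: "contracting_homotopy (Suc m) E.D \<one>\<^bsub>G\<^esub> h0 h"
  shows "free_crossed_resolution (Suc m) G \<phi> E"
proof -
  interpret G: group G by (rule group_G)
  interpret H: contracted_complex "Suc m" E.D "\<one>\<^bsub>G\<^esub>" h0 h
    using cover_complex_E hom by (intro contracted_complex.intro contracted_complex_axioms.intro) auto
  have free2: "\<exists>(S :: 'o \<Rightarrow> 'c set) w i. free_crossed_module (gpd E) (fam E 2) (action E 2) (bdry E 2) S w i"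
  proof (cases "m = 1")
    case True
    then show ?thesis using top_dim1 by (auto simp: free_crossed_module_on_def)
  next
    case False
    then show ?thesis
      using resolution lower_dim[of 2] m_pos by (simp add: free_crossed_resolution_def)
  qed
  have kernel2: "bdry E 2 ` carrier (fam E 2 pt) = kernel (vertex_group (gpd C) pt) G \<phi>"
  proof
    show "bdry E 2 ` carrier (fam E 2 pt) \<subseteq> kernel (vertex_group (gpd C) pt) G \<phi>"
      using \<phi>_bdry2_E bdry2_E_Arr kernel_\<phi> by auto
    show "kernel (vertex_group (gpd C) pt) G \<phi> \<subseteq> bdry E 2 ` carrier (fam E 2 pt)"
    proof
      fix u assume "u \<in> kernel (vertex_group (gpd C) pt) G \<phi>"
      then have "(\<one>\<^bsub>G\<^esub>, u) \<in> arrows (gpd E.D) \<one>\<^bsub>G\<^esub> \<one>\<^bsub>G\<^esub>"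
        by (simp add: E.cover_arrows kernel_\<phi>)
      then have "(\<one>\<^bsub>G\<^esub>, u) \<in> bdry E.D 2 ` carrier (fam E.D 2 \<one>\<^bsub>G\<^esub>)"
        using H.loops_subset_image m_pos by auto
      then show "u \<in> bdry E 2 ` carrier (fam E 2 pt)" by auto
    qed
  qed
  have free_n: "\<exists>(S :: 'o \<Rightarrow> 'c set) i. free_module_along (gpd E) \<Gamma> \<phi> (fam E n) (action E n) S i"
    if "3 \<le> n" "n \<le> Suc m" for n
  proof (cases "n = Suc m")
    case True
    then show ?thesis using top_dim(1) that by auto
  next
    case False
    then show ?thesis
      using resolution lower_dim[of n] that by (simp add: free_crossed_resolution_def)
  qed
  have exact: "bdry_kernel E n pt = bdry E (Suc n) ` carrier (fam E (Suc n) pt)"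
    if n: "2 \<le> n" "n < Suc m" for n
  proof
    show "bdry_kernel E n pt \<subseteq> bdry E (Suc n) ` carrier (fam E (Suc n) pt)"
    proof
      fix c assume "c \<in> bdry_kernel E n pt"
      then have "(\<one>\<^bsub>G\<^esub>, c) \<in> bdry_kernel E.D n \<one>\<^bsub>G\<^esub>"
        using E.cover_kernel by simp
      then have "(\<one>\<^bsub>G\<^esub>, c) \<in> bdry E.D (Suc n) ` carrier (fam E.D (Suc n) \<one>\<^bsub>G\<^esub>)"
        using H.kernel_subset_image n by blast
      then show "c \<in> bdry E (Suc n) ` carrier (fam E (Suc n) pt)" by auto
    qed
    interpret B: group_hom "fam E (Suc n) pt" "fam E (Suc n - 1) pt" "bdry E (Suc n)"
      using E.bdry_group_hom[of "Suc n" pt] n pt_Obj by simp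
    show "bdry E (Suc n) ` carrier (fam E (Suc n) pt) \<subseteq> bdry_kernel E n pt"
      using E.bdry_bdry[of "Suc n" pt] B.hom_closed n pt_Obj
      by (auto simp: bdry_kernel_def numeral_2_eq_2)
  qed
  show ?thesis
    using resolution complex_E free2 kernel2 free_n exact
    by (simp add: free_crossed_resolution_def)
qed

end


section \<open>Extending the contracting homotopy\<close>

locale contracted_resolution = free_resolution m C G \<phi>
  for m :: nat and C :: "('o, 'c) crossed_complex" and G :: "'g monoid" and \<phi> :: "'c \<Rightarrow> 'g" +
  fixes h0 :: "'g \<Rightarrow> 'g \<times> 'c" and h :: "nat \<Rightarrow> 'g \<times> 'c \<Rightarrow> 'g \<times> 'c" and Xt :: "('g \<times> 'c) set"
  assumes homotopy: "contracting_homotopy m D \<one>\<^bsub>G\<^esub> h0 h"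
    and free: "cover_free_on m G \<phi> C Xt"
begin

lemma one_G: "\<one>\<^bsub>G\<^esub> \<in> carrier G"
  using group_G by (simp add: group.is_monoid monoid.one_closed)

sublocale cov: contracted_complex m D "\<one>\<^bsub>G\<^esub>" h0 h
  using cover_complex homotopy one_G by (intro contracted_complex.intro contracted_complex_axioms.intro) auto

lemma Xt_elems: "Xt \<subseteq> elems D m"
  using free m_pos
  by (auto simp: cover_free_on_def Let_def elems_def free_groupoid_on_def free_crossed_module_on_def
      free_module_along_on_def simp del: cover_carrier split: if_splits)

text \<open>The definition of the new boundary applies \<open>snd\<close> to these values. Nothing
  is lost, as they lie over 1, and the second components are admissible boundaries.\<close>

lemma rhs_generator:
  assumes "c \<in> elems D m"
  shows "homotopy_rhs D \<one>\<^bsub>G\<^esub> h0 h m c = (\<one>\<^bsub>G\<^esub>, snd (homotopy_rhs D \<one>\<^bsub>G\<^esub> h0 h m c))"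
    and "snd (homotopy_rhs D \<one>\<^bsub>G\<^esub> h0 h m c) \<in> cycles"
proof -
  let ?r = "homotopy_rhs D \<one>\<^bsub>G\<^esub> h0 h m c"
  have "?r = (\<one>\<^bsub>G\<^esub>, snd ?r) \<and> snd ?r \<in> cycles"
  proof (cases "m = 1")
    case True
    then have c: "c \<in> arrows (gpd D) (Src (gpd D) c) (Tgt (gpd D) c)"
      using assms cov.Arr_arrows by (simp add: elems_def del: cover_Arr)
    have "homotopy_rhs D \<one>\<^bsub>G\<^esub> h0 h 1 c \<in> arrows (gpd D) \<one>\<^bsub>G\<^esub> \<one>\<^bsub>G\<^esub>"
      unfolding cov.rhs_1[OF c] using cov.conjugate_arrow[OF c] .
    then have "?r \<in> arrows (gpd D) \<one>\<^bsub>G\<^esub> \<one>\<^bsub>G\<^esub>" unfolding True .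
    \<comment> \<open>A loop at 1 in the cover ends at \<phi> u, so being a loop forces \<phi> u =
      1.\<close>
    then obtain u where "?r = (\<one>\<^bsub>G\<^esub>, u)" "u \<in> Arr (gpd C)" "\<one>\<^bsub>G\<^esub> = \<one>\<^bsub>G\<^esub> \<otimes>\<^bsub>G\<^esub> \<phi> u"
      unfolding cover_arrows by blast
    then show ?thesis
      using group_G \<phi>_closed unfolding cycles_1[OF True] by (simp add: group.is_monoid monoid.l_one)
  next
    case False
    then have m: "2 \<le> m" using m_pos by simp
    obtain g where g: "g \<in> Obj (gpd D)" "c \<in> carrier (fam D m g)"
      using assms False by (auto simp: elems_def)
    have "?r \<in> carrier (fam D m \<one>\<^bsub>G\<^esub>)"
      using cov.rhs_closed[OF m order_refl g] .
    then obtain c' where c': "?r = (\<one>\<^bsub>G\<^esub>, c')" "c' \<in> carrier (fam C m pt)" by auto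
    then have "(\<one>\<^bsub>G\<^esub>, c') \<in> bdry_kernel D m \<one>\<^bsub>G\<^esub>"
      using cov.bdry_rhs[OF m order_refl g] by (simp add: bdry_kernel_def)
    then show ?thesis
      using c' cover_kernel cycles_ge2[OF False] by simp
  qed
  then show "?r = (\<one>\<^bsub>G\<^esub>, snd ?r)" "snd ?r \<in> cycles" by auto
qed

lemma cover_free_crossed_module:
  assumes "m = 2"
  shows "free_crossed_module (gpd D) (fam D m) (action D m) (bdry D m)
    (\<lambda>x. Xt \<inter> carrier (fam D m x)) (\<lambda>_ s. bdry D m s) (\<lambda>_ s. s)"
  using free assms by (simp add: cover_free_on_def free_crossed_module_on_def Let_def del: cover_carrier)

lemma cover_free_module:
  assumes "2 \<le> m" "m \<noteq> 2"
  shows "free_module_along (gpd D) (translation_groupoid G) (\<lambda>(g, u). (g, \<phi> u)) (fam D m) (action D m)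
    (\<lambda>x. Xt \<inter> carrier (fam D m x)) (\<lambda>_ s. s)"
  using free assms by (simp add: cover_free_on_def free_module_along_on_def Let_def del: cover_carrier)

lemma cover_generated:
  assumes m: "2 \<le> m" and K: "closed_subfamily (gpd D) (fam D m) (action D m) K" "Xt \<subseteq> K"
    and c: "c \<in> elems D m"
  shows "c \<in> K"
proof -
  obtain g where g: "g \<in> Obj (gpd D)" "c \<in> carrier (fam D m g)"
    using c m by (auto simp: elems_def)
  show ?thesis
  proof (cases "m = 2")
    case True
    from free_crossed_module_generated[OF cover_free_crossed_module[OF this] K(1) _ g] show ?thesis
      using K(2) by blast
  next
    case False
    note F = cover_free_module[OF m False]
    \<comment> \<open>Arrows of the translation groupoid lift to the cover because \<phi> is
      onto.\<close>
    have surj: "\<exists>u\<in>arrows (gpd D) x y. (\<lambda>(g, u). (g, \<phi> u)) u = v"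
      if v: "v \<in> arrows (translation_groupoid G) x y" for x y v
    proof -
      obtain a where a: "v = (x, a)" "a \<in> carrier G" "x \<in> carrier G" "y = x \<otimes>\<^bsub>G\<^esub> a"
        using v by (auto simp: arrows_def translation_groupoid_def)
      from \<open>a \<in> carrier G\<close> obtain u where u: "u \<in> Arr (gpd C)" "a = \<phi> u"
        unfolding \<phi>_surj[symmetric] by (rule imageE)
      show ?thesis
        using a(1,3,4) u by (intro bexI[of _ "(x, u)"]) (simp_all add: cover_arrows)
    qed
    have "Obj (translation_groupoid G) = Obj (gpd D)"
      by (simp add: translation_groupoid_def)
    from free_module_along_generated[OF F this surj K(1) _ g] show ?thesis
      using K(2) by blast
  qed
qed

lemma cover_invariant_hom:
  fixes A :: "('g \<times> 'c) monoid"
  assumes m: "2 \<le> m" and A: "comm_group A" and k: "k \<in> Xt \<rightarrow> carrier A"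
  shows "\<exists>f. invariant_hom (gpd D) (fam D m) (action D m) A f \<and> (\<forall>xt \<in> Xt. f xt = k xt)"
proof -
  have elems: "\<exists>g \<in> Obj (gpd D). xt \<in> Xt \<inter> carrier (fam D m g)" if "xt \<in> Xt" for xt
    using Xt_elems m that by (auto simp: elems_def simp del: cover_carrier)
  have kA: "k s \<in> carrier A" if "s \<in> Xt" for s
    using funcset_mem[OF k that] .
  show ?thesis
  proof (cases "m = 2")
    case True
    note F = cover_free_crossed_module[OF True]
    \<comment> \<open>The product of a fibre with A has pairs as elements, which the left summand
      cannot hold. The pair (c, e) is coded in the right summand as a word with the two letters c
      and e; object, arrows and signs are fillers.\<close>
    have "inj (\<lambda>(c, e). Inr (undefined, [(c, undefined, True), (e, undefined, True)]) ::
        ('g, 'g \<times> 'c, 'g \<times> 'c, 'g \<times> 'c) action_target)"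
      by (auto simp: inj_on_def)
    from free_crossed_module_invariant_hom[OF F A this, of "\<lambda>_. k"]
    obtain f where f: "invariant_hom (gpd D) (fam D m) (action D m) A f"
        "\<forall>g \<in> Obj (gpd D). \<forall>s \<in> Xt \<inter> carrier (fam D m g). f s = k s"
      using kA by blast
    then show ?thesis
      using elems by (metis (no_types))
  next
    case False
    obtain act' where F: "free_module (translation_groupoid G) (fam D m) act'
        (\<lambda>x. Xt \<inter> carrier (fam D m x)) (\<lambda>_ s. s)"
      and act': "\<And>x y c u. c \<in> carrier (fam D m x) \<Longrightarrow> u \<in> arrows (gpd D) x y \<Longrightarrow>
          act' c ((\<lambda>(g, u). (g, \<phi> u)) u) = action D m c u"
      using cover_free_module[OF m False] unfolding free_module_along_def by blast
    have Obj: "Obj (translation_groupoid G) = Obj (gpd D)"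
      by (simp add: translation_groupoid_def)
    have "inj (\<lambda>(c, e). Inr (undefined, [(c, undefined, True), (e, undefined, True)]) ::
        ('g, 'g \<times> 'g, 'g \<times> 'c, 'g \<times> 'c) action_target)"
      by (auto simp: inj_on_def)
    from free_module_invariant_hom[OF F A this, of "\<lambda>_. k"]
    obtain f where f: "invariant_hom (translation_groupoid G) (fam D m) act' A f"
        "\<forall>g \<in> Obj (gpd D). \<forall>s \<in> Xt \<inter> carrier (fam D m g). f s = k s"
      using kA unfolding Obj by blast
    \<comment> \<open>Invariance is known over the translation groupoid; it pulls back along the map
      from the cover, through which the action factors.\<close>
    have "f (action D m c u) = f c" if "c \<in> carrier (fam D m x)" "u \<in> arrows (gpd D) x y" for c u x y
    proof -
      have "(\<lambda>(g, u). (g, \<phi> u)) u \<in> arrows (translation_groupoid G) x y"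
        using that(2) \<phi>_closed by (auto simp: arrows_def translation_groupoid_def)
      then show ?thesis
        using f(1) act'[OF that] that(1) unfolding invariant_hom_def by metis
    qed
    then have "invariant_hom (gpd D) (fam D m) (action D m) A f"
      using f(1) unfolding invariant_hom_def Obj by blast
    then show ?thesis
      using f(2) elems by (metis (no_types))
  qed
qed

text \<open>For m = 1 a free crossed module comes with its boundary, so a boundary has to be
  constructed only from m = 2 on. It is obtained by freeness over G as a map into the kernel of the
  previous boundary, followed by the inclusion, where the action of G is turned back into that of
  \<open>C_1\<close>.\<close>

lemma homotopy_extension_exists:
  assumes m: "2 \<le> m" and b: "bij_betw b Xt X"
    and A: "free_module_along_on (gpd C) \<Gamma> \<phi> A a X"
  shows "\<exists>E. homotopy_extension m G \<phi> C h0 h Xt b X E \<and> fam E (Suc m) = A \<and> action E (Suc m) = a"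
proof -
  let ?r = "\<lambda>c. snd (homotopy_rhs D \<one>\<^bsub>G\<^esub> h0 h m c)"
  let ?N = "restrict_family (fam C m) (bdry_kernel C m pt)"
  obtain a' where a': "\<And>x y c u. c \<in> carrier (A x) \<Longrightarrow> u \<in> arrows (gpd C) x y \<Longrightarrow> a' c (\<phi> u) = a c u"
    and F: "free_module \<Gamma> A a' (\<lambda>x. X \<inter> carrier (A x)) (\<lambda>_ s. s)"
    using A unfolding free_module_along_on_def free_module_along_def by blast
  obtain act' where N: "groupoid_module \<Gamma> ?N act'"
    and act': "\<And>c u. c \<in> bdry_kernel C m pt \<Longrightarrow> u \<in> Arr (gpd C) \<Longrightarrow> act' c (\<phi> u) = action C m c u"
    using kernel_module[OF m order_refl] by blast
  have r: "?r (the_inv_into Xt b x) \<in> carrier (?N pt)" if "x \<in> X" for x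
  proof -
    have "the_inv_into Xt b x \<in> Xt"
      using b that by (metis bij_betw_def the_inv_into_into order_refl)
    then have "?r (the_inv_into Xt b x) \<in> bdry_kernel C m pt"
      using rhs_generator(2)[OF subsetD[OF Xt_elems]] cycles_ge2 m by simp
    then show ?thesis by (auto simp: restrict_family_def bdry_kernel_def)
  qed
  \<comment> \<open>The kernel consists of elements of the same type as A, so \<open>Inl\<close>
    embeds it in the target type.\<close>
  obtain f where f: "action_morphism \<Gamma> A a' ?N act' f"
      "\<forall>x \<in> Obj \<Gamma>. \<forall>s \<in> X \<inter> carrier (A x). f s = ?r (the_inv_into Xt b s)"
    using ex_unique_onD(1)[OF free_module_universal[OF F N _ inj_Inl, of "\<lambda>_ s. ?r (the_inv_into Xt b s)"]] r
    by auto
  have f_hom: "f \<in> hom (A pt) (?N pt)"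
    using f(1) by (simp add: action_morphism_def)
  have "action_morphism (gpd C) A a (fam C m) (action C m) f"
    unfolding action_morphism_def
  proof (intro conjI ballI allI)
    show "f \<in> hom (A x) (fam C m x)" if "x \<in> Obj (gpd C)" for x
      using f_hom that point by (auto simp: hom_def restrict_family_def)
    show "f (a c u) = action C m (f c) u" if "c \<in> carrier (A x)" "u \<in> arrows (gpd C) x y" for x y c u
    proof -
      have xy: "x = pt" "y = pt" and u: "u \<in> Arr (gpd C)" using that(2) by (auto simp: arrows_pt_iff)
      have c: "c \<in> carrier (A pt)" using that(1) xy by simp
      have fc: "f c \<in> bdry_kernel C m pt"
        using f_hom that(1) xy by (auto simp: hom_def restrict_family_def)
      have "\<phi> u \<in> arrows \<Gamma> pt pt" using \<phi>_closed[OF u] by (simp add: \<Gamma>_arrows)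
      then have "f (a' c (\<phi> u)) = act' (f c) (\<phi> u)"
        using f(1) c unfolding action_morphism_def by blast
      then show ?thesis
        using a'[OF that] act'[OF fc u] by simp
    qed
  qed
  moreover have "f (b xt) = ?r xt" if "xt \<in> Xt" for xt
  proof -
    have "b xt \<in> X" using b that by (auto simp: bij_betw_def)
    moreover from this have "b xt \<in> carrier (A pt)"
      using A point by (auto simp: free_module_along_on_def)
    ultimately show ?thesis
      using f(2) the_inv_into_f_f[of b Xt xt] b that by (auto simp: bij_betw_def)
  qed
  ultimately show ?thesis
    using A m
    by (intro exI[of _ "C\<lparr>fam := (fam C)(Suc m := A), action := (action C)(Suc m := a),
        bdry := (bdry C)(Suc m := f)\<rparr>"])
      (simp add: homotopy_extension_def free_extension_def)
qed

lemma homotopy_extension_resolution: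
  assumes "bij_betw b Xt X" "homotopy_extension m G \<phi> C h0 h Xt b X E"
  shows "resolution_extension m C G \<phi> E X"
proof unfold_locales
  show "free_extension m G \<phi> C E X"
    using assms(2) by (simp add: homotopy_extension_def)
  show "bdry E (Suc m) x \<in> cycles" if "x \<in> X" for x
  proof -
    obtain xt where "xt \<in> Xt" "x = b xt" using assms(1) \<open>x \<in> X\<close> by (auto simp: bij_betw_def)
    then show ?thesis
      using assms(2) rhs_generator(2)[OF subsetD[OF Xt_elems]] by (simp add: homotopy_extension_def)
  qed
qed

end

section \<open>The extended homotopy on the cover of the extension\<close>

locale contracted_extension = contracted_resolution m C G \<phi> h0 h Xt + resolution_extension m C G \<phi> E X
  for m :: nat and C :: "('o, 'c) crossed_complex" and G :: "'g monoid" and \<phi> :: "'c \<Rightarrow> 'g"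
    and h0 :: "'g \<Rightarrow> 'g \<times> 'c" and h :: "nat \<Rightarrow> 'g \<times> 'c \<Rightarrow> 'g \<times> 'c" and Xt :: "('g \<times> 'c) set"
    and E :: "('o, 'c) crossed_complex" and X :: "'c set"
begin

sublocale covE: truncated_crossed_complex "Suc m" E.D
  by (rule cover_complex_E)

lemma cover_gpd: "gpd E.D = gpd D"
  by (simp add: universal_cover_def)

lemma cover_lower:
  "\<lbrakk>2 \<le> n; n \<le> m\<rbrakk> \<Longrightarrow> fam E.D n = fam D n \<and> action E.D n = action D n \<and> bdry E.D n = bdry D n"
  using lower_dim[of n] by (simp add: universal_cover_def)

lemma cover_elems: "\<lbrakk>1 \<le> n; n \<le> m\<rbrakk> \<Longrightarrow> elems E.D n = elems D n"
  using cover_lower[of n] cover_gpd by (cases "n = 1") (auto simp: elems_def)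

text \<open>For n at least 2 the right-hand side involves the homotopy only in dimension n - 1,
  which is below m; for n = 1 it involves \<open>h0\<close> alone. So the new component is not
  seen.\<close>

lemma rhs_E:
  assumes "1 \<le> n" "n \<le> m"
  shows "homotopy_rhs E.D z h0 (h(m := k)) n c = homotopy_rhs D z h0 h n c"
proof (cases "n = 1")
  case True
  then show ?thesis by (simp add: homotopy_rhs_def cover_gpd)
next
  case False
  moreover have "n - 1 \<noteq> m" using assms by simp
  ultimately show ?thesis
    using cover_lower[of n] assms by (simp add: homotopy_rhs_def cover_gpd base_point_def)
qed

lemma component_lower:
  assumes "1 \<le> n" "n < m"
  shows "homotopy_component E.D z n f \<longleftrightarrow> homotopy_component D z n f"
proof (cases "n = 1")
  case True
  then show ?thesis
    using cover_lower[of 2] assms by (simp add: homotopy_component_def cover_gpd)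
next
  case False
  then show ?thesis
    using cover_lower[of n] cover_lower[of "Suc n"] assms by (simp add: homotopy_component_def cover_gpd)
qed

lemma contracting_homotopy_step:
  assumes k: "homotopy_component E.D \<one>\<^bsub>G\<^esub> m k"
    and rel: "\<And>c. c \<in> elems D m \<Longrightarrow> bdry E.D (Suc m) (k c) = homotopy_rhs D \<one>\<^bsub>G\<^esub> h0 h m c"
  shows "contracting_homotopy (Suc m) E.D \<one>\<^bsub>G\<^esub> h0 (h(m := k))"
  unfolding contracting_homotopy_def
proof (intro conjI allI impI ballI)
  show "h0 x \<in> arrows (gpd E.D) x \<one>\<^bsub>G\<^esub>" if "x \<in> Obj (gpd E.D)" for x
    using cov.h0_arrow that by (simp only: cover_gpd)
  fix n assume n: "1 \<le> n \<and> n < Suc m"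
  show "homotopy_component E.D \<one>\<^bsub>G\<^esub> n ((h(m := k)) n)"
  proof (cases "n = m")
    case False
    then show ?thesis
      using homotopy n component_lower[of n] by (simp add: contracting_homotopy_def)
  qed (use k in simp)
  fix c assume c: "c \<in> elems E.D n"
  have c: "c \<in> elems D n" using c cover_elems n by simp
  show "bdry E.D (Suc n) ((h(m := k)) n c) = homotopy_rhs E.D \<one>\<^bsub>G\<^esub> h0 (h(m := k)) n c"
  proof (cases "n = m")
    case True
    then show ?thesis using rel c rhs_E[of m] m_pos by simp
  next
    case False
    then show ?thesis
      using cov.bdry_h[of n c] n c rhs_E[of n] cover_lower[of "Suc n"] by simp
  qed
qed

lemma top_cover_module: "m \<noteq> 1 \<Longrightarrow> groupoid_module (gpd E.D) (fam E.D (Suc m)) (action E.D (Suc m))"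
  using covE.dim_ge3[of "Suc m"] m_pos by simp

lemma top_cover_crossed: "m = 1 \<Longrightarrow> crossed_module (gpd E.D) (fam E.D 2) (action E.D 2) (bdry E.D 2)"
  using covE.dim2 by simp

lemma component_invariant_hom:
  assumes "m \<noteq> 1"
  shows "homotopy_component E.D \<one>\<^bsub>G\<^esub> m k \<longleftrightarrow>
    invariant_hom (gpd D) (fam D m) (action D m) (fam E.D (Suc m) \<one>\<^bsub>G\<^esub>) k"
  using assms m_pos cover_lower[of m] by (simp add: homotopy_component_def invariant_hom_def cover_gpd)

lemma component_exists:
  assumes b: "\<And>xt. xt \<in> Xt \<Longrightarrow> b xt \<in> X"
  shows "\<exists>k. homotopy_component E.D \<one>\<^bsub>G\<^esub> m k \<and> (\<forall>xt \<in> Xt. k xt = (\<one>\<^bsub>G\<^esub>, b xt))"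
proof -
  have b: "(\<lambda>xt. (\<one>\<^bsub>G\<^esub>, b xt)) \<in> Xt \<rightarrow> carrier (fam E.D (Suc m) \<one>\<^bsub>G\<^esub>)"
    using b X_subset by auto
  show ?thesis
  proof (cases "m = 1")
    case True
    have F: "free_groupoid_on (gpd D) Xt"
      using free True by (simp add: cover_free_on_def Let_def)
    interpret crossed_module "gpd E.D" "fam E.D 2" "action E.D 2" "bdry E.D 2"
      using top_cover_crossed True .
    have "group (fam E.D (Suc m) \<one>\<^bsub>G\<^esub>)"
      using fam_group[of "\<one>\<^bsub>G\<^esub>"] one_G True by (simp add: numeral_2_eq_2)
    \<comment> \<open>Arrows and higher elements of the cover share one type, so the fibre of
      dimension 2 embeds by \<open>Inl\<close>.\<close>
    from free_groupoid_extend[OF F this b inj_Inl]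
    show ?thesis
      using True by (auto simp: homotopy_component_def cover_gpd numeral_2_eq_2 simp del: cover_Arr)
  next
    case False
    interpret groupoid_module "gpd E.D" "fam E.D (Suc m)" "action E.D (Suc m)"
      using top_cover_module False .
    have "comm_group (fam E.D (Suc m) \<one>\<^bsub>G\<^esub>)"
      using fam_comm[of "\<one>\<^bsub>G\<^esub>"] one_G by simp
    then show ?thesis
      using cover_invariant_hom[OF _ _ b] component_invariant_hom[OF False] False m_pos by simp
  qed
qed

lemma homotopy_relation:
  assumes k: "homotopy_component E.D \<one>\<^bsub>G\<^esub> m k"
    and gen: "\<And>xt. xt \<in> Xt \<Longrightarrow> bdry E.D (Suc m) (k xt) = homotopy_rhs D \<one>\<^bsub>G\<^esub> h0 h m xt"
    and c: "c \<in> elems D m"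
  shows "bdry E.D (Suc m) (k c) = homotopy_rhs D \<one>\<^bsub>G\<^esub> h0 h m c"
proof (cases "m = 1")
  case True
  let ?V = "vertex_group (gpd D) \<one>\<^bsub>G\<^esub>" and ?r = "homotopy_rhs D \<one>\<^bsub>G\<^esub> h0 h 1"
  have F: "free_groupoid_on (gpd D) Xt"
    using free True by (simp add: cover_free_on_def Let_def)
  interpret M: crossed_module "gpd D" "fam E.D 2" "action E.D 2" "bdry E.D 2"
    using top_cover_crossed True unfolding cover_gpd .
  have k_closed: "k a \<in> carrier (fam E.D 2 \<one>\<^bsub>G\<^esub>)" if "a \<in> Arr (gpd D)" for a
    using k that True by (auto simp: homotopy_component_def cover_gpd)
  have k_Cmp: "k (Cmp (gpd D) a b) = k a \<otimes>\<^bsub>fam E.D 2 \<one>\<^bsub>G\<^esub>\<^esub> k b"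
    if "a \<in> arrows (gpd D) x y" "b \<in> arrows (gpd D) y t" for a b x y t
    using k that True unfolding homotopy_component_def cover_gpd by simp
  have one: "\<one>\<^bsub>G\<^esub> \<in> Obj (gpd D)" using one_G by simp
  have "bdry E.D 2 (k c) = ?r c"
  \<comment> \<open>Both maps turn composites of arrows of the cover into products of loops at
    1.\<close>
  proof (rule free_groupoid_unique[OF F cov.group_vertex_group[OF one],
        where f = "\<lambda>a. bdry E.D 2 (k a)" and f' = ?r])
    show "bdry E.D 2 (k a) \<in> carrier ?V" if "a \<in> Arr (gpd D)" for a
      using M.\<mu>_arrow[OF one k_closed[OF that]] by (simp add: vertex_group_def)
    show "?r a \<in> carrier ?V" if "a \<in> Arr (gpd D)" for a
      unfolding cov.rhs_1[OF cov.Arr_arrows[OF that]]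
      using cov.conjugate_arrow[OF cov.Arr_arrows[OF that]] by (simp add: vertex_group_def)
    show "bdry E.D 2 (k (Cmp (gpd D) a b)) = bdry E.D 2 (k a) \<otimes>\<^bsub>?V\<^esub> bdry E.D 2 (k b)"
      if "a \<in> arrows (gpd D) x y" "b \<in> arrows (gpd D) y t" for a b x y t
    proof -
      have "a \<in> Arr (gpd D)" "b \<in> Arr (gpd D)" using that unfolding arrows_def by blast+
      then show ?thesis
        using k_Cmp[OF that] M.\<mu>_mult[OF one k_closed k_closed] by (simp only: vertex_group_def monoid.simps)
    qed
    show "?r (Cmp (gpd D) a b) = ?r a \<otimes>\<^bsub>?V\<^esub> ?r b"
      if "a \<in> arrows (gpd D) x y" "b \<in> arrows (gpd D) y t" for a b x y t
      using cov.rhs_1_Cmp[OF that] by (simp only: vertex_group_def monoid.simps)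
    show "bdry E.D 2 (k a) = ?r a" if "a \<in> Xt" for a
      using gen[OF that] True by (simp add: numeral_2_eq_2)
    show "c \<in> Arr (gpd D)"
      using c True by (simp add: elems_def del: cover_Arr)
  qed
  then show ?thesis
    using True by (simp add: numeral_2_eq_2)
next
  case False
  then have m: "2 \<le> m" using m_pos by simp
  have k: "invariant_hom (gpd D) (fam D m) (action D m) (fam E.D (Suc m) \<one>\<^bsub>G\<^esub>) k"
    using k component_invariant_hom[OF False] by simp
  interpret A: groupoid_action "gpd D" "fam D m" "action D m" using cov.action_dim[OF m order_refl] .
  have one: "\<one>\<^bsub>G\<^esub> \<in> Obj (gpd D)" using one_G by simp
  interpret B: group_hom "fam E.D (Suc m) \<one>\<^bsub>G\<^esub>" "fam D m \<one>\<^bsub>G\<^esub>" "bdry E.D (Suc m)"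
    using covE.bdry_group_hom[of "Suc m" "\<one>\<^bsub>G\<^esub>"] cover_lower[of m] one_G m by simp
  \<comment> \<open>Both maps are invariant, so agreement at c persists at every translate of
    c.\<close>
  have "closed_subfamily (gpd D) (fam D m) (action D m)
      {c. bdry E.D (Suc m) (k c) = homotopy_rhs D \<one>\<^bsub>G\<^esub> h0 h m c}"
  proof (rule closed_subfamily_equalizer[OF A.groupoid_action_axioms, where N = "\<lambda>_. fam D m \<one>\<^bsub>G\<^esub>"])
    show "group (fam D m \<one>\<^bsub>G\<^esub>)" using A.fam_group one .
    show "homotopy_rhs D \<one>\<^bsub>G\<^esub> h0 h m \<in> hom (fam D m x) (fam D m \<one>\<^bsub>G\<^esub>)" if "x \<in> Obj (gpd D)" for x
      using cov.rhs_hom[OF m order_refl that] .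
    show "(\<lambda>c. bdry E.D (Suc m) (k c)) \<in> hom (fam D m x) (fam D m \<one>\<^bsub>G\<^esub>)" if "x \<in> Obj (gpd D)" for x
    proof -
      have "k \<in> hom (fam D m x) (fam E.D (Suc m) \<one>\<^bsub>G\<^esub>)"
        using k that by (simp only: invariant_hom_def)
      from hom_compose[OF this B.homh] show ?thesis by (simp add: comp_def)
    qed
    show "bdry E.D (Suc m) (k (action D m c u)) = homotopy_rhs D \<one>\<^bsub>G\<^esub> h0 h m (action D m c u)"
      if "c \<in> carrier (fam D m x)" "u \<in> arrows (gpd D) x y"
        "bdry E.D (Suc m) (k c) = homotopy_rhs D \<one>\<^bsub>G\<^esub> h0 h m c" for x y c u
    proof -
      have "k (action D m c u) = k c"
        using k that(1,2) unfolding invariant_hom_def by blast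
      then show ?thesis
        using that(3) cov.rhs_act[OF m order_refl that(1,2)] by simp
    qed
  qed
  from cover_generated[OF m this _ c] show ?thesis
    using gen by blast
qed

end

text \<open>Applying \<xi> in the fibre over 1 is a homomorphism, so the morphism and invariance
  properties of k survive. That \<xi> preserves boundaries is part of being a morphism of crossed
  modules if m = 1. If m is at least 2 it is given on X and spreads to all elements, since the set
  where the two boundaries agree is a closed subfamily.\<close>

lemma boundary_retraction_component:
  assumes E: "contracted_extension m C G \<phi> h0 h Xt E X" and E': "contracted_extension m C G \<phi> h0 h Xt E' Y"
    and \<xi>: "boundary_retraction m E X E' Y \<xi>"
    and k: "homotopy_component (universal_cover G \<phi> E) \<one>\<^bsub>G\<^esub> m k"
  shows "homotopy_component (universal_cover G \<phi> E') \<one>\<^bsub>G\<^esub> m ((\<lambda>(g, c). (g, \<xi> c)) \<circ> k)"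
    and "c \<in> elems (universal_cover G \<phi> C) m \<Longrightarrow>
      bdry (universal_cover G \<phi> E') (Suc m) (((\<lambda>(g, c). (g, \<xi> c)) \<circ> k) c)
        = bdry (universal_cover G \<phi> E) (Suc m) (k c)"
proof -
  interpret E: contracted_extension m C G \<phi> h0 h Xt E X by fact
  interpret E': contracted_extension m C G \<phi> h0 h Xt E' Y by fact
  let ?M = "fam E (Suc m) E.pt" and ?M' = "fam E' (Suc m) E.pt"
  have \<xi>_hom: "\<xi> \<in> hom ?M ?M'"
    using \<xi> E.pt_Obj by (auto simp: boundary_retraction_def crossed_module_morphism_def action_morphism_def
        numeral_2_eq_2 split: if_splits)
  have bdry_\<xi>: "bdry E' (Suc m) (\<xi> c) = bdry E (Suc m) c" if "c \<in> carrier ?M" for c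
  proof (cases "m = 1")
    case True
    then show ?thesis
      using \<xi> that E.pt_Obj by (auto simp: boundary_retraction_def crossed_module_morphism_def numeral_2_eq_2)
  next
    case False
    then have m: "2 \<le> m" using E.m_pos by simp
    interpret M: groupoid_module "gpd C" "fam E (Suc m)" "action E (Suc m)" using E.top_module False .
    interpret N: groupoid_action "gpd C" "fam C m" "action C m" using E.action_dim m by simp
    note d = E.top_dim(2)[OF False] and d' = E'.top_dim(2)[OF False]
    have \<xi>': "action_morphism (gpd C) (fam E (Suc m)) (action E (Suc m)) (fam E' (Suc m)) (action E' (Suc m)) \<xi>"
      using \<xi> False by (simp add: boundary_retraction_def)
    have "closed_subfamily (gpd C) (fam E (Suc m)) (action E (Suc m))
        {c. bdry E' (Suc m) (\<xi> c) = bdry E (Suc m) c}"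
    proof (rule closed_subfamily_equalizer[OF M.groupoid_action_axioms N.fam_group])
      show "(\<lambda>c. bdry E' (Suc m) (\<xi> c)) \<in> hom (fam E (Suc m) x) (fam C m x)" if "x \<in> Obj (gpd C)" for x
      proof -
        have "\<xi> \<in> hom (fam E (Suc m) x) (fam E' (Suc m) x)" "bdry E' (Suc m) \<in> hom (fam E' (Suc m) x) (fam C m x)"
          using \<xi>' d' that by (simp_all add: action_morphism_def)
        from hom_compose[OF this] show ?thesis by (simp add: comp_def)
      qed
      show "bdry E (Suc m) \<in> hom (fam E (Suc m) x) (fam C m x)" if "x \<in> Obj (gpd C)" for x
        using d that by (simp add: action_morphism_def)
      show "bdry E' (Suc m) (\<xi> (action E (Suc m) c u)) = bdry E (Suc m) (action E (Suc m) c u)"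
        if "c \<in> carrier (fam E (Suc m) x)" "u \<in> arrows (gpd C) x y"
          "bdry E' (Suc m) (\<xi> c) = bdry E (Suc m) c" for x y c u
      proof -
        have "\<xi> c \<in> carrier (fam E' (Suc m) x)"
          using \<xi>' that(1) E.arrows_Obj(1)[OF that(2)] by (auto simp: action_morphism_def hom_def)
        then show ?thesis
          using \<xi>' d d' that unfolding action_morphism_def by simp
      qed
    qed simp
    from E.top_generated[OF this _ that] show ?thesis
      using \<xi> by (auto simp: boundary_retraction_def)
  qed
  let ?k' = "(\<lambda>(g, c). (g, \<xi> c)) \<circ> k"
  have \<xi>_cover: "(\<lambda>(g, c). (g, \<xi> c)) \<in> hom (fam E.E.D (Suc m) \<one>\<^bsub>G\<^esub>) (fam E'.E.D (Suc m) \<one>\<^bsub>G\<^esub>)"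
    using \<xi>_hom by (auto simp: hom_def)
  show "homotopy_component E'.E.D \<one>\<^bsub>G\<^esub> m ?k'"
  proof (cases "m = 1")
    case True
    have k_closed: "k a \<in> carrier (fam E.E.D (Suc m) \<one>\<^bsub>G\<^esub>)" if "a \<in> Arr (gpd E.D)" for a
      using k that True by (auto simp: homotopy_component_def E.cover_gpd numeral_2_eq_2)
    have k_Cmp: "k (Cmp (gpd E.D) a b) = k a \<otimes>\<^bsub>fam E.E.D (Suc m) \<one>\<^bsub>G\<^esub>\<^esub> k b"
      if "a \<in> arrows (gpd E.D) x y" "b \<in> arrows (gpd E.D) y t" for a b x y t
      using k that True unfolding homotopy_component_def E.cover_gpd by (simp add: numeral_2_eq_2)
    have "?k' \<in> Arr (gpd E.D) \<rightarrow> carrier (fam E'.E.D (Suc m) \<one>\<^bsub>G\<^esub>)"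
      unfolding comp_def using hom_in_carrier[OF \<xi>_cover k_closed] by (rule funcsetI)
    moreover have "?k' (Cmp (gpd E.D) a b) = ?k' a \<otimes>\<^bsub>fam E'.E.D (Suc m) \<one>\<^bsub>G\<^esub>\<^esub> ?k' b"
      if ab: "a \<in> arrows (gpd E.D) x y" "b \<in> arrows (gpd E.D) y t" for a b x y t
    proof -
      have "a \<in> Arr (gpd E.D)" "b \<in> Arr (gpd E.D)" using ab unfolding arrows_def by blast+
      then show ?thesis
        unfolding comp_def k_Cmp[OF ab] using hom_mult[OF \<xi>_cover k_closed k_closed] by blast
    qed
    ultimately show ?thesis
      unfolding homotopy_component_def E'.cover_gpd
      by (simp only: True numeral_2_eq_2 One_nat_def if_True simp_thms) blast
  next
    case False
    have "invariant_hom (gpd E.D) (fam E.D m) (action E.D m) (fam E.E.D (Suc m) \<one>\<^bsub>G\<^esub>) k"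
      using k E.component_invariant_hom[OF False] by simp
    then have "invariant_hom (gpd E.D) (fam E.D m) (action E.D m) (fam E'.E.D (Suc m) \<one>\<^bsub>G\<^esub>) ?k'"
      unfolding invariant_hom_def by (metis hom_compose[OF _ \<xi>_cover] comp_apply)
    then show ?thesis
      using E'.component_invariant_hom[OF False] by simp
  qed
  show "bdry E'.E.D (Suc m) (?k' c) = bdry E.E.D (Suc m) (k c)" if c: "c \<in> elems E.D m"
  proof -
    have "k c \<in> carrier (fam E.E.D (Suc m) \<one>\<^bsub>G\<^esub>)"
    proof (cases "m = 1")
      case True
      then show ?thesis
        using k c by (auto simp: homotopy_component_def E.cover_gpd elems_def numeral_2_eq_2)
    next
      case False
      then have "invariant_hom (gpd E.D) (fam E.D m) (action E.D m) (fam E.E.D (Suc m) \<one>\<^bsub>G\<^esub>) k"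
        using k E.component_invariant_hom by simp
      then show ?thesis
        using c False by (auto simp: invariant_hom_def elems_def hom_def)
    qed
    then show ?thesis
      using bdry_\<xi> by auto
  qed
qed

theorem theorem9p2:
  fixes m :: nat
    and G :: "'g monoid"
    and \<phi> :: "'c \<Rightarrow> 'g"
    and C :: "('o, 'c) crossed_complex"
    and h0 :: "'g \<Rightarrow> 'g \<times> 'c"
    and h :: "nat \<Rightarrow> 'g \<times> 'c \<Rightarrow> 'g \<times> 'c"
    and Xt :: "('g \<times> 'c) set"
    and X :: "'c set"
    and b :: "'g \<times> 'c \<Rightarrow> 'c"
  assumes "1 \<le> m"
    and "free_crossed_resolution m G \<phi> C"
    and "contracting_homotopy m (universal_cover G \<phi> C) \<one>\<^bsub>G\<^esub> h0 h"
    and "cover_free_on m G \<phi> C Xt"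
    and "bij_betw b Xt X"
  shows
    "(2 \<le> m \<longrightarrow>
        (\<forall>A a. free_module_along_on (gpd C) (group_groupoid (the_point C) G) \<phi> A a X \<longrightarrow>
           (\<exists>E. homotopy_extension m G \<phi> C h0 h Xt b X E \<and>
                fam E (Suc m) = A \<and> action E (Suc m) = a))) \<and>
     (\<forall>E. homotopy_extension m G \<phi> C h0 h Xt b X E \<longrightarrow>
        free_crossed_resolution (Suc m) G \<phi> E \<and>
        (\<exists>k. homotopy_component (universal_cover G \<phi> E) \<one>\<^bsub>G\<^esub> m k \<and>
             (\<forall>xt \<in> Xt. k xt = (\<one>\<^bsub>G\<^esub>, b xt))) \<and>
        (\<forall>k. homotopy_component (universal_cover G \<phi> E) \<one>\<^bsub>G\<^esub> m k \<and>
             (\<forall>xt \<in> Xt. k xt = (\<one>\<^bsub>G\<^esub>, b xt)) \<longrightarrow>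
           contracting_homotopy (Suc m) (universal_cover G \<phi> E) \<one>\<^bsub>G\<^esub> h0 (h(m := k)) \<and>
           (\<forall>Y E' \<xi>.
              Y \<subseteq> X \<and>
              generates_kernel m G \<phi> C (bdry E (Suc m) ` Y) \<and>
              free_extension m G \<phi> C E' Y \<and>
              (\<forall>y \<in> Y. bdry E' (Suc m) y = bdry E (Suc m) y) \<and>
              boundary_retraction m E X E' Y \<xi> \<longrightarrow>
                free_crossed_resolution (Suc m) G \<phi> E' \<and>
                contracting_homotopy (Suc m) (universal_cover G \<phi> E') \<one>\<^bsub>G\<^esub> h0
                  (h(m := (\<lambda>(g, c). (g, \<xi> c)) \<circ> k)))))"
proof -
  interpret free_resolution m C G \<phi>
    using free_resolutionI assms(1,2) .
  interpret contracted_resolution m C G \<phi> h0 h Xt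
    using assms(3,4) by unfold_locales
  have step: "contracting_homotopy (Suc m) (universal_cover G \<phi> E) \<one>\<^bsub>G\<^esub> h0 (h(m := k))"
    and resolution': "free_crossed_resolution (Suc m) G \<phi> E"
    and relation: "c \<in> elems D m \<Longrightarrow>
      bdry (universal_cover G \<phi> E) (Suc m) (k c) = homotopy_rhs D \<one>\<^bsub>G\<^esub> h0 h m c"
    if E: "homotopy_extension m G \<phi> C h0 h Xt b X E"
      and k: "homotopy_component (universal_cover G \<phi> E) \<one>\<^bsub>G\<^esub> m k" "\<forall>xt \<in> Xt. k xt = (\<one>\<^bsub>G\<^esub>, b xt)"
    for E k c
  proof -
    interpret E: resolution_extension m C G \<phi> E X
      using homotopy_extension_resolution assms(5) E .
    interpret E: contracted_extension m C G \<phi> h0 h Xt E X ..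
    have gen: "bdry E.E.D (Suc m) (k xt) = homotopy_rhs D \<one>\<^bsub>G\<^esub> h0 h m xt" if "xt \<in> Xt" for xt
    proof -
      have "bdry E (Suc m) (b xt) = snd (homotopy_rhs D \<one>\<^bsub>G\<^esub> h0 h m xt)"
        using E that unfolding homotopy_extension_def by blast
      then have "bdry E.E.D (Suc m) (k xt) = (\<one>\<^bsub>G\<^esub>, snd (homotopy_rhs D \<one>\<^bsub>G\<^esub> h0 h m xt))"
        using k(2) that by simp
      then show ?thesis
        using rhs_generator(1) Xt_elems that by (metis subsetD)
    qed
    have relation: "bdry E.E.D (Suc m) (k c) = homotopy_rhs D \<one>\<^bsub>G\<^esub> h0 h m c" if "c \<in> elems D m" for c
      using E.homotopy_relation[OF k(1) gen that] .
    show "contracting_homotopy (Suc m) E.E.D \<one>\<^bsub>G\<^esub> h0 (h(m := k))"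
      using E.contracting_homotopy_step[OF k(1) relation] .
    then show "free_crossed_resolution (Suc m) G \<phi> E"
      using E.resolution_E by blast
    show "bdry E.E.D (Suc m) (k c) = homotopy_rhs D \<one>\<^bsub>G\<^esub> h0 h m c" if "c \<in> elems D m"
      using relation[OF that] .
  qed
  have exists: "\<exists>k. homotopy_component (universal_cover G \<phi> E) \<one>\<^bsub>G\<^esub> m k \<and> (\<forall>xt \<in> Xt. k xt = (\<one>\<^bsub>G\<^esub>, b xt))"
    if E: "homotopy_extension m G \<phi> C h0 h Xt b X E" for E
  proof -
    interpret E: resolution_extension m C G \<phi> E X
      using homotopy_extension_resolution assms(5) E .
    interpret E: contracted_extension m C G \<phi> h0 h Xt E X ..
    show ?thesis
      using E.component_exists[of b] assms(5) by (auto simp: bij_betw_def)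
  qed
  have retract: "free_crossed_resolution (Suc m) G \<phi> E' \<and>
      contracting_homotopy (Suc m) (universal_cover G \<phi> E') \<one>\<^bsub>G\<^esub> h0 (h(m := (\<lambda>(g, c). (g, \<xi> c)) \<circ> k))"
    if E: "homotopy_extension m G \<phi> C h0 h Xt b X E"
      and k: "homotopy_component (universal_cover G \<phi> E) \<one>\<^bsub>G\<^esub> m k" "\<forall>xt \<in> Xt. k xt = (\<one>\<^bsub>G\<^esub>, b xt)"
      and Y: "Y \<subseteq> X" and E': "free_extension m G \<phi> C E' Y"
      and bdry: "\<forall>y \<in> Y. bdry E' (Suc m) y = bdry E (Suc m) y"
      and \<xi>: "boundary_retraction m E X E' Y \<xi>" for E k Y E' \<xi>
  proof -
    interpret E: resolution_extension m C G \<phi> E X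
      using homotopy_extension_resolution assms(5) E .
    interpret E: contracted_extension m C G \<phi> h0 h Xt E X ..
    \<comment> \<open>On Y the boundaries of E' are those of E, hence cycles; the results on
      extensions thus apply to E' with basis Y.\<close>
    interpret E': resolution_extension m C G \<phi> E' Y
      by unfold_locales (use E' bdry Y E.bdry_cycle in auto)
    interpret E': contracted_extension m C G \<phi> h0 h Xt E' Y ..
    note retraction = boundary_retraction_component[OF E.contracted_extension_axioms
        E'.contracted_extension_axioms \<xi> k(1)]
    have "contracting_homotopy (Suc m) E'.E.D \<one>\<^bsub>G\<^esub> h0 (h(m := (\<lambda>(g, c). (g, \<xi> c)) \<circ> k))"
      \<comment> \<open>The relation for k carries over, because \<xi> leaves the boundary of
        \<open>k c\<close> unchanged and the right-hand side lives in the cover of C.\<close>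
      by (rule E'.contracting_homotopy_step[OF retraction(1)]) (simp only: retraction(2) relation[OF E k])
    then show ?thesis
      using E'.resolution_E by blast
  qed
  show ?thesis
    using homotopy_extension_exists[OF _ assms(5)] exists step resolution' retract by meson
qed

end
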